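(* Let $k,p,s\in\mathbb{N}$, let $Y_s=\{y_i\}_{i=1}^s$ with $-1<y_s<\dots<y_1<1$, and let $A_p=\{\alpha_i\}_{i=1}^p$ with $-1\le\alpha_p<\dots<\alpha_1\le 1$, where $Y_s\cap A_p=\emptyset$. Let $$(r,m_1,m_2,m_3)\in\{(2j,2j-1,2j-2,2j-1): j\in\mathbb{N}\}\cup\{(2j+1,2j-1,2j,2j): j\in\mathbb{N}_0\}.$$ Then there is a number $N$ depending only on $d(Y_s,A_p)$ and a constant $c=c(k,r,s,p)$ such that for every $f\in C^r[-1,1]$ and every $n\ge N$ there exists an algebraic polynomial $P_n$ of degree $\le n$ such that (a) $P_n-f\in\Delta^{(0)}(Y_s)$; (b) $P_n^{(i)}(\alpha)=f^{(i)}(\alpha)$ for all $\alpha\in A_p$ and $0\le i\le m_1$ (this condition is vacuous if $m_1=-1$); (c) $P_n^{(i)}(y)=f^{(i)}(y)$ for all $y\in Y_s$ and $0\le i\le m_2$; (d) $P_n^{(i)}(\pm1)=f^{(i)}(\pm1)$ for $0\le i\le m_3$; and $$|f(x)-P_n(x)|\le c\,\rho_n^r(x)\,\omega_k(f^{(r)},\rho_n(x)),\qquad x\in[-1,1].$$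
   Context: $I=[-1,1]$; $C^r=C^r(I)$. $\rho_n(x):=n^{-1}\sqrt{1-x^2}+n^{-2}$. $\omega_k(g,t)=\omega_k(g,t;I)$ is the classical $k$-th modulus of smoothness: $\omega_k(g,t;J)=\sup_{0<h\le t}\sup\{|\Delta_h^k g(x)|: x,x+kh\in J\}$ with $\Delta_h^k g(x)=\sum_{i=0}^k(-1)^{k-i}\binom{k}{i}g(x+ih)$. Set $y_0:=1$, $y_{s+1}:=-1$. A function $h$ belongs to $\Delta^{(0)}(Y_s)$ iff $(-1)^i h\ge 0$ on $[y_{i+1},y_i]$ for $0\le i\le s$ (i.e. $h$ is nonnegative on $[y_1,1]$ and changes sign exactly at the points $y_i$). Writing $Y_s\cup A_p=\{\beta_i\}_{i=1}^{s+p}$ with $-1\le\beta_{s+p}<\dots<\beta_1\le1$, $\beta_0:=1$, $\beta_{s+p+1}:=-1$, the quantity $d(Y_s,A_p)$ is the smallest positive number among $\beta_{i-1}-\beta_i$, $1\le i\le s+p+1$ (equivalently, the minimal distance between distinct points of $Y_s\cup A_p\cup\{\pm1\}$). *)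

theory Defs
  imports "HOL-Analysis.Analysis" "HOL-Computational_Algebra.Polynomial"
begin

definition yext :: "(nat \<Rightarrow> real) \<Rightarrow> nat \<Rightarrow> nat \<Rightarrow> real" where
  "yext y s i = (if i = 0 then 1 else if i = Suc s then -1 else y i)"

definition Delta0 :: "(nat \<Rightarrow> real) \<Rightarrow> nat \<Rightarrow> (real \<Rightarrow> real) \<Rightarrow> bool" where
  "Delta0 y s h \<longleftrightarrow>
     (\<forall>i\<le>s. \<forall>x \<in> {yext y s (Suc i)..yext y s i}. (-1) ^ i * h x \<ge> 0)"

definition dYA :: "(nat \<Rightarrow> real) \<Rightarrow> nat \<Rightarrow> (nat \<Rightarrow> real) \<Rightarrow> nat \<Rightarrow> real" where
  "dYA y s \<alpha> p =
     (let S = y ` {1..s} \<union> \<alpha> ` {1..p} \<union> {-1, 1}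
      in Min {\<bar>a - b\<bar> | a b. a \<in> S \<and> b \<in> S \<and> a \<noteq> b})"

definition rho :: "nat \<Rightarrow> real \<Rightarrow> real" where
  "rho n x = sqrt (1 - x\<^sup>2) / real n + 1 / (real n)\<^sup>2"

definition fdiff :: "nat \<Rightarrow> real \<Rightarrow> (real \<Rightarrow> real) \<Rightarrow> real \<Rightarrow> real" where
  "fdiff k h g x = (\<Sum>i=0..k. (-1) ^ (k - i) * real (k choose i) * g (x + real i * h))"

definition modsm :: "nat \<Rightarrow> (real \<Rightarrow> real) \<Rightarrow> real \<Rightarrow> real set \<Rightarrow> real" where
  "modsm k g t J = Sup {\<bar>fdiff k h g x\<bar> | h x. 0 < h \<and> h \<le> t \<and> x \<in> J \<and> x + real k * h \<in> J}"

definition Cr_derivs :: "nat \<Rightarrow> (real \<Rightarrow> real) \<Rightarrow> (nat \<Rightarrow> real \<Rightarrow> real) \<Rightarrow> bool" where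
  "Cr_derivs r f F \<longleftrightarrow>
     (\<forall>x\<in>{-1..1}. F 0 x = f x) \<and>
     (\<forall>i<r. \<forall>x\<in>{-1..1}. (F i has_real_derivative F (Suc i) x) (at x within {-1..1})) \<and>
     continuous_on {-1..1} (F r)"

end

theory Submission
  imports Defs
begin

text \<open>Let \<open>Z\<close> consist of the points \<open>y\<^sub>i\<close>, \<open>\<alpha>\<^sub>i\<close> and \<open>-1, 1\<close>. Around every \<open>z\<close> Whitney's inequality for
  the \<open>r\<close>-th derivative of \<open>f\<close> gives a polynomial of bounded degree that agrees with \<open>f\<close> to order \<open>r\<close> at \<open>z\<close> and whose error
  grows at most polynomially in \<open>1 + |x - z| / \<rho>\<^sub>n(z)\<close>. A polynomial partition of unity built from powers
  of Fejer kernels absorbs this growth and glues local polynomials to an approximant \<open>Q\<close> of the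
  right order; polynomial cutoffs \<open>V\<^sub>z\<close> with \<open>V\<^sub>z - 1\<close> vanishing to order \<open>r\<close> at \<open>z\<close> and \<open>V\<^sub>z\<close> vanishing to
  order \<open>r\<close> on the rest of \<open>Z\<close> turn it into \<open>Q + \<Sum> V\<^sub>z (p\<^sub>z - Q)\<close>, whose error is
  \<open>O(min (1, |x - z| / \<rho>\<^sub>n(z))\<^sup>r \<rho>\<^sub>n\<^sup>r \<omega>)\<close> for every \<open>z\<close>. The same partition yields a positive polynomial \<open>B\<close>
  such that \<open>B \<Prod> (x - z)^e(z)\<close> is of exactly this size; adding a large multiple of it fixes the sign. The
  interpolation conditions need no computation: they follow from the error bound by Taylor's formula.\<close>

section \<open>Fejer-type kernels in Chebyshev form\<close>

text \<open>The obstacle is to control sign, order of contact and size by one polynomial, with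
  constants that see neither f nor the position of the points. The sign is encoded in exponents: r
  at -1 and 1, an odd number at the \<open>y i\<close>, an even number at the remaining
  \<open>\<alpha> i\<close>; up to the factor (-1)^r the product of the powers of x - z then has the
  required sign pattern. No exponent exceeds r, so an error of order r at every z is as small as
  that product demands. This comparison, like the cutoffs, needs points further apart than the scale
  rho, which is how d enters N. Away from Z the correction must still dominate the error, so its
  size is needed from below as well as from above; hence B is an average, with positive weights, of
  the very function it has to imitate. Moving an estimate from one point to another always costs a
  power of \<open>rdist\<close>, the distance in units of rho. That power depends only on k, r and
  the number of points, so Fejer powers of sufficient order can be fixed in advance to absorb
  it.\<close>

fun cheb :: "nat \<Rightarrow> real poly" where
  "cheb 0 = 1"
| "cheb (Suc 0) = [:0, 1:]"
| "cheb (Suc (Suc n)) = [:0, 2:] * cheb (Suc n) - cheb n"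

lemma poly_cheb_cos: "poly (cheb n) (cos t) = cos (real n * t)"
proof (induction n rule: cheb.induct)
  case (3 n)
  have "cos ((real n + 2) * t) + cos (real n * t) = 2 * cos ((real n + 1) * t) * cos t"
    by (subst cos_plus_cos) (simp add: algebra_simps add_divide_distrib)
  with 3 show ?case by (simp add: algebra_simps)
qed simp_all

lemma degree_cheb: "degree (cheb n) \<le> n"
proof (induction n rule: cheb.induct)
  case (3 n)
  have "degree ([:0, 2:] * cheb (Suc n)) \<le> Suc (Suc n)"
    using degree_mult_le[of "[:0, 2:]" "cheb (Suc n)"] 3 by simp
  moreover have "degree (cheb n) \<le> Suc (Suc n)" using 3 by simp
  ultimately show ?case by (simp add: degree_diff_le)
qed simp_all

section \<open>Angles versus cosines, and the scale rho in the angle variable\<close>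

lemma abs_sin_nat_mult_le: "\<bar>sin (real l * s)\<bar> \<le> real l * \<bar>sin s\<bar>"
proof (induction l)
  case (Suc l)
  have "sin (real (Suc l) * s) = sin (real l * s) * cos s + cos (real l * s) * sin s"
    by (simp add: distrib_right sin_add)
  also have "\<bar>...\<bar> \<le> \<bar>sin (real l * s)\<bar> * \<bar>cos s\<bar> + \<bar>cos (real l * s)\<bar> * \<bar>sin s\<bar>"
    by (metis abs_mult abs_triangle_ineq)
  also have "... \<le> \<bar>sin (real l * s)\<bar> * 1 + 1 * \<bar>sin s\<bar>"
    by (intro add_mono mult_left_mono mult_right_mono) auto
  also have "... \<le> real (Suc l) * \<bar>sin s\<bar>"
    using Suc by (simp add: algebra_simps)
  finally show ?case .
qed simp

text \<open>A crude form of Jordan's inequality. Up to pi/3 the derivative of sin x - x/3 is at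
  least 1/6; beyond it sin x is at least sqrt 3 / 2 > 2/3, while x/3 stays below 2/3.\<close>

lemma sin_ge_third:
  assumes "0 \<le> x" "x \<le> pi / 2"
  shows "x / 3 \<le> sin x"
proof (cases "x \<le> pi / 3")
  case True
  have "sin 0 - 0 / 3 \<le> sin x - x / 3"
  proof (rule DERIV_nonneg_imp_nondecreasing[OF assms(1)])
    fix u assume u: "0 \<le> u" "u \<le> x"
    have "cos u \<ge> cos (pi / 3)"
      using u True by (intro cos_monotone_0_pi_le) auto
    hence "cos u - 1 / 3 \<ge> 0" by (simp add: cos_60)
    moreover have "((\<lambda>x. sin x - x / 3) has_real_derivative cos u - 1 / 3) (at u)"
      by (auto intro!: derivative_eq_intros)
    ultimately show "\<exists>y. ((\<lambda>x. sin x - x / 3) has_real_derivative y) (at u) \<and> 0 \<le> y"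
      by blast
  qed
  then show ?thesis by simp
next
  case False
  have "sin (pi / 3) \<le> sin x"
    using False assms by (intro sin_monotone_2pi_le) auto
  moreover have "sin (pi / 3) \<ge> 2 / 3"
    unfolding sin_60 using real_le_rsqrt[of "4/3" 3] by (simp add: power2_eq_square)
  moreover have "x / 3 \<le> 2 / 3" using assms pi_less_4 by simp
  ultimately show ?thesis by simp
qed

lemma abs_sin_half_diff_ge:
  assumes "t \<in> {0..pi}" "v \<in> {0..pi}"
  shows "\<bar>t - v\<bar> / 6 \<le> \<bar>sin ((t - v) / 2)\<bar>"
proof (cases "v \<le> t")
  case True
  thus ?thesis using sin_ge_third[of "(t - v) / 2"] assms by auto
next
  case False
  have "\<bar>sin ((t - v) / 2)\<bar> = \<bar>sin ((v - t) / 2)\<bar>"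
    by (metis abs_minus_cancel minus_diff_eq minus_divide_left sin_minus)
  thus ?thesis using False sin_ge_third[of "(v - t) / 2"] assms by auto
qed

text \<open>In half angles sin ((t+v)/2) and sin ((t-v)/2) are the sum and the difference of the
  same two nonnegative terms. The second bound uses sin + cos >= 1 in the first quadrant. Together
  they turn \<open>abs_cos_diff\<close> into two-sided bounds by the difference of the
  angles.\<close>

lemma sin_half_sum_ge:
  assumes "t \<in> {0..pi}" "v \<in> {0..pi}"
  shows "\<bar>sin ((t - v) / 2)\<bar> \<le> sin ((t + v) / 2)"
    and "sin v / 2 \<le> sin ((t + v) / 2)"
    and "sin ((t + v) / 2) \<le> sin v + \<bar>t - v\<bar> / 2"
proof -
  have nn: "0 \<le> sin (t/2)" "0 \<le> cos (t/2)" "0 \<le> sin (v/2)" "0 \<le> cos (v/2)"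
    using assms by (auto intro!: sin_ge_zero cos_ge_zero)
  have nn2: "0 \<le> sin (t/2) * cos (v/2)" "0 \<le> cos (t/2) * sin (v/2)"
    using nn by auto
  have e: "sin ((t + v) / 2) = sin (t/2) * cos (v/2) + cos (t/2) * sin (v/2)"
    "sin ((t - v) / 2) = sin (t/2) * cos (v/2) - cos (t/2) * sin (v/2)"
    by (simp_all add: add_divide_distrib diff_divide_distrib sin_add sin_diff)
  show "\<bar>sin ((t - v) / 2)\<bar> \<le> sin ((t + v) / 2)"
    unfolding e using nn2 by linarith
  show "sin v / 2 \<le> sin ((t + v) / 2)"
  proof -
    have sv: "sin v = 2 * sin (v/2) * cos (v/2)" using sin_double[of "v/2"] by simp
    have s1: "sin (t/2) + cos (t/2) \<ge> 1"
    proof -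
      have "(sin (t/2) + cos (t/2))^2 = 1 + 2 * (sin (t/2) * cos (t/2))"
        by (simp add: power2_sum)
      also have "... \<ge> 1^2" using nn by simp
      finally show ?thesis using nn by (intro power2_le_imp_le[of 1]) auto
    qed
    have "sin v / 2 = sin (v/2) * cos (v/2)" using sv by simp
    also have "... \<le> sin (v/2) * cos (v/2) * (sin (t/2) + cos (t/2))"
      using mult_left_mono[OF s1, of "sin (v/2) * cos (v/2)"] nn by simp
    also have "... = sin (v/2) * (sin (t/2) * cos (v/2)) + cos (v/2) * (cos (t/2) * sin (v/2))"
      by (simp add: algebra_simps)
    also have "... \<le> 1 * (sin (t/2) * cos (v/2)) + 1 * (cos (t/2) * sin (v/2))"
      using nn2 by (intro add_mono mult_right_mono) auto
    finally show ?thesis by (simp add: e)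
  qed
  have "sin ((t + v) / 2) = sin (v + (t - v)/2)" by (rule arg_cong[of _ _ sin]) (simp add: field_simps)
  also have "... = sin v * cos ((t - v)/2) + cos v * sin ((t - v)/2)" by (rule sin_add)
  also have "... \<le> sin v * 1 + \<bar>cos v * sin ((t - v)/2)\<bar>"
    using assms by (intro add_mono mult_left_mono) (auto intro: sin_ge_zero)
  also have "\<bar>cos v * sin ((t - v)/2)\<bar> \<le> 1 * \<bar>(t - v)/2\<bar>"
    unfolding abs_mult by (intro mult_mono abs_sin_x_le_abs_x) auto
  finally show "sin ((t + v) / 2) \<le> sin v + \<bar>t - v\<bar> / 2" by simp
qed

lemma abs_cos_diff:
  assumes "t \<in> {0..pi}" "v \<in> {0..pi}"
  shows "\<bar>cos t - cos v\<bar> = 2 * sin ((t + v) / 2) * \<bar>sin ((t - v) / 2)\<bar>"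
proof -
  have "\<bar>cos t - cos v\<bar> = 2 * \<bar>sin ((t + v) / 2)\<bar> * \<bar>sin ((v - t) / 2)\<bar>"
    by (simp add: cos_diff_cos abs_mult)
  moreover have "\<bar>sin ((v - t) / 2)\<bar> = \<bar>sin ((t - v) / 2)\<bar>"
    by (metis abs_minus_cancel minus_diff_eq minus_divide_left sin_minus)
  moreover have "sin ((t + v) / 2) \<ge> 0"
    using sin_half_sum_ge(1)[OF assms] by linarith
  ultimately show ?thesis by simp
qed

lemma rho_cos:
  assumes "v \<in> {0..pi}"
  shows "rho n (cos v) = sin v / real n + 1 / (real n)^2"
proof -
  have "sqrt (1 - (cos v)^2) = sin v"
    using assms by (simp add: sin_squared_eq[symmetric] sin_ge_zero)
  thus ?thesis by (simp add: rho_def)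
qed

lemma rho_pos: "n \<ge> 1 \<Longrightarrow> x \<in> {-1..1} \<Longrightarrow> rho n x > 0"
  unfolding rho_def by (auto intro!: add_nonneg_pos simp: abs_square_le_1 abs_le_iff)

text \<open>Distance from x to z in units of the scale at the centre z, not at x. The summand 1
  makes powers increase with the exponent.\<close>

definition rdist :: "nat \<Rightarrow> real \<Rightarrow> real \<Rightarrow> real" where
  "rdist n x z = 1 + \<bar>x - z\<bar> / rho n z"

lemma rdist_ge_1: "n \<ge> 1 \<Longrightarrow> z \<in> {-1..1} \<Longrightarrow> rdist n x z \<ge> 1"
  using rho_pos[of n z] by (simp add: rdist_def)

text \<open>The square is forced by the endpoints, where the cosine moves quadratically in the
  angle: with d = |t - v| the displacement is at most d sin v + d^2/2. The first term is paid by n d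
  rho, the second by (n d)^2 rho.\<close>

lemma rdist_cos_le:
  assumes "n \<ge> 1" "t \<in> {0..pi}" "v \<in> {0..pi}"
  shows "rdist n (cos t) (cos v) \<le> (1 + real n * \<bar>t - v\<bar>)^2"
proof -
  define d where "d = \<bar>t - v\<bar>"
  have d: "d \<ge> 0" by (simp add: d_def)
  have sv: "sin v \<ge> 0" using assms by (auto intro: sin_ge_zero)
  have r: "rho n (cos v) > 0" using rho_pos[of n "cos v"] assms by simp
  have "\<bar>cos t - cos v\<bar> \<le> 2 * (sin v + d / 2) * (d / 2)"
    unfolding abs_cos_diff[OF assms(2,3)]
    using sin_half_sum_ge(1,3)[OF assms(2,3)] abs_sin_x_le_abs_x[of "(t - v)/2"] sv d
    by (intro mult_mono) (auto simp: d_def)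
  also have "... = d * sin v + d^2 / 2" by (simp add: power2_eq_square algebra_simps)
  also have "... \<le> (real n * d + (real n * d)^2) * rho n (cos v)"
  proof -
    have "(real n * d + (real n * d)^2) * rho n (cos v)
       = d * sin v + d / real n + real n * d^2 * sin v + d^2"
      unfolding rho_cos[OF assms(3)] using assms(1) by (simp add: field_simps power2_eq_square)
    moreover have "d / real n \<ge> 0" "real n * d^2 * sin v \<ge> 0" "d^2 \<ge> 0" using d sv by auto
    ultimately show ?thesis by linarith
  qed
  finally have "\<bar>cos t - cos v\<bar> / rho n (cos v) \<le> real n * d + (real n * d)^2"
    using r by (simp add: field_simps)
  moreover have "real n * d \<ge> 0" using d by simp
  ultimately show ?thesis unfolding rdist_def d_def[symmetric] power2_sum by simp
qed

text \<open>When \<open>sin v \<ge> 1/n\<close> the bound follows from the Lipschitz property in the angle; near the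
  endpoints it is Markov's inequality for the Chebyshev polynomials.\<close>

lemma cheb_lipschitz:
  assumes "n \<ge> 1" "l \<le> n" "t \<in> {0..pi}" "v \<in> {0..pi}"
  shows "\<bar>cos (real l * t) - cos (real l * v)\<bar> \<le> 12 * (\<bar>cos t - cos v\<bar> / rho n (cos v))"
proof -
  define d where "d = \<bar>t - v\<bar>"
  define \<rho> where "\<rho> = rho n (cos v)"
  have n: "real n > 0" using assms by simp
  have r: "\<rho> > 0" using rho_pos[of n "cos v"] assms by (simp add: \<rho>_def)
  have eq: "\<bar>cos (real l * t) - cos (real l * v)\<bar>
     = 2 * \<bar>sin (real l * ((t + v) / 2))\<bar> * \<bar>sin (real l * ((t - v) / 2))\<bar>"
  proof -
    have "(real l * t + real l * v) / 2 = real l * ((t + v) / 2)"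
      "(real l * v - real l * t) / 2 = - (real l * ((t - v) / 2))"
      by (simp_all add: field_simps)
    thus ?thesis by (simp only: cos_diff_cos abs_mult sin_minus abs_minus_cancel abs_numeral)
  qed
  have ln: "real l \<le> real n" using assms by simp
  show ?thesis
  proof (cases "sin v \<ge> 1 / real n")
    case True
    have "1 / (real n)^2 \<le> sin v / real n"
      using True n by (simp add: field_simps power2_eq_square)
    hence rl: "\<rho> \<le> 2 * sin v / real n"
      unfolding \<rho>_def rho_cos[OF assms(4)] by simp
    have "2 * \<bar>sin (real l * ((t + v) / 2))\<bar> * \<bar>sin (real l * ((t - v) / 2))\<bar>
       \<le> 2 * 1 * \<bar>real l * ((t - v) / 2)\<bar>"
      by (intro mult_mono abs_sin_x_le_abs_x) auto
    also have "... = real l * d" by (simp add: abs_mult d_def)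
    also have "... \<le> real n * d" using ln by (intro mult_right_mono) (auto simp: d_def)
    finally have 1: "\<bar>cos (real l * t) - cos (real l * v)\<bar> \<le> real n * d" by (simp add: eq)
    have sv: "sin v \<ge> 0" using assms by (auto intro: sin_ge_zero)
    have "2 * (sin v / 2) * (d / 6) \<le> \<bar>cos t - cos v\<bar>"
      unfolding abs_cos_diff[OF assms(3,4)]
      using sin_half_sum_ge[OF assms(3,4)] abs_sin_half_diff_ge[OF assms(3,4)] sv
      by (intro mult_mono) (auto simp: d_def)
    hence 2: "sin v * d \<le> 6 * \<bar>cos t - cos v\<bar>" by simp
    have "real n * d * \<rho> \<le> real n * d * (2 * sin v / real n)"
      using rl by (intro mult_left_mono) (auto simp: d_def)
    also have "... = 2 * (sin v * d)" using n by simp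
    also have "... \<le> 12 * \<bar>cos t - cos v\<bar>" using 2 by linarith
    finally have "real n * d \<le> 12 * (\<bar>cos t - cos v\<bar> / \<rho>)" using r by (simp add: field_simps)
    thus ?thesis using 1 by (simp add: \<rho>_def)
  next
    case False
    have rl: "\<rho> \<le> 2 / (real n)^2"
      using False n unfolding \<rho>_def rho_cos[OF assms(4)] by (simp add: field_simps power2_eq_square)
    have "2 * \<bar>sin (real l * ((t + v) / 2))\<bar> * \<bar>sin (real l * ((t - v) / 2))\<bar>
      \<le> 2 * (real l * \<bar>sin ((t + v) / 2)\<bar>) * (real l * \<bar>sin ((t - v) / 2)\<bar>)"
      by (intro mult_mono abs_sin_nat_mult_le) auto
    also have "... = (real l)^2 * \<bar>cos t - cos v\<bar>"
      using sin_half_sum_ge(1)[OF assms(3,4)] unfolding abs_cos_diff[OF assms(3,4)]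
      by (simp add: power2_eq_square)
    also have "... \<le> (real n)^2 * \<bar>cos t - cos v\<bar>"
      using ln by (intro mult_right_mono power_mono) auto
    also have "... \<le> 2 * (\<bar>cos t - cos v\<bar> / \<rho>)"
    proof -
      have "(real n)^2 * \<bar>cos t - cos v\<bar> * \<rho> \<le> (real n)^2 * \<bar>cos t - cos v\<bar> * (2 / (real n)^2)"
        using rl by (intro mult_left_mono) auto
      also have "... = 2 * \<bar>cos t - cos v\<bar>" using n by simp
      finally show ?thesis using r by (simp add: field_simps)
    qed
    also have "... \<le> 12 * (\<bar>cos t - cos v\<bar> / \<rho>)"
      using r by (intro mult_right_mono) auto
    finally show ?thesis by (simp add: eq \<rho>_def)
  qed
qed

section \<open>Convex combinations of cosines and powers of the Fejer kernel\<close>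

definition cos_mean :: "nat \<Rightarrow> (nat \<Rightarrow> real) \<Rightarrow> (real \<Rightarrow> real) \<Rightarrow> bool" where
  "cos_mean D w T \<longleftrightarrow> (\<forall>l. 0 \<le> w l) \<and> (\<Sum>l\<le>D. w l) = 1 \<and>
     (\<forall>t. T t = (\<Sum>l\<le>D. w l * cos (real l * t)))"

text \<open>Frequencies may repeat in the family, so products and squares can be listed term by term
  before equal frequencies are collected.\<close>

lemma cos_meanI:
  fixes c :: "'i \<Rightarrow> real" and v :: "'i \<Rightarrow> nat"
  assumes "finite I" "\<And>i. i \<in> I \<Longrightarrow> 0 \<le> c i" "sum c I = 1" "\<And>i. i \<in> I \<Longrightarrow> v i \<le> D"
  shows "\<exists>w. cos_mean D w (\<lambda>t. \<Sum>i\<in>I. c i * cos (real (v i) * t))"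
proof (intro exI)
  define w where "w l = (\<Sum>i | i \<in> I \<and> v i = l. c i)" for l
  have sub: "v ` I \<subseteq> {..D}" using assms by auto
  have "(\<Sum>l\<le>D. w l) = 1"
    unfolding w_def using sum.group[OF assms(1) finite_atMost sub, of c] assms(3) by simp
  moreover have "(\<Sum>l\<le>D. w l * cos (real l * t)) = (\<Sum>i\<in>I. c i * cos (real (v i) * t))" for t
  proof -
    have "w l * cos (real l * t) = (\<Sum>i | i \<in> I \<and> v i = l. c i * cos (real (v i) * t))" for l
      by (simp add: w_def sum_distrib_right)
    thus ?thesis
      using sum.group[OF assms(1) finite_atMost sub, of "\<lambda>i. c i * cos (real (v i) * t)"] by simp
  qed
  ultimately show "cos_mean D w (\<lambda>t. \<Sum>i\<in>I. c i * cos (real (v i) * t))"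
    unfolding cos_mean_def by (auto simp: w_def intro!: sum_nonneg assms(2))
qed

lemma cos_nat_abs_diff:
  "cos (real (nat \<bar>int a - int b\<bar>) * t) = cos (real a * t - real b * t)"
proof -
  have "real (nat \<bar>int a - int b\<bar>) = \<bar>real a - real b\<bar>" by linarith
  thus ?thesis
    by (cases "real a \<ge> real b") (simp_all add: left_diff_distrib cos_diff mult.commute[of t])
qed

text \<open>Nonnegative weights of total mass 1 survive multiplication by the product-to-sum
  formula. The Boolean in the index selects the sum or the difference of the two frequencies, each
  with half the weight. Nonnegativity matters later: it turns estimates valid for each cosine into
  averages without loss.\<close>

lemma cos_mean_mult:
  assumes "cos_mean D1 w1 t1" "cos_mean D2 w2 t2"
  shows "\<exists>w. cos_mean (D1 + D2) w (\<lambda>t. t1 t * t2 t)"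
proof -
  define I where "I = ({..D1} \<times> {..D2}) \<times> (UNIV :: bool set)"
  define c where "c = (\<lambda>((a, b), e :: bool). w1 a * w2 b / 2)"
  define v where "v = (\<lambda>((a, b), e). if e then a + b else nat \<bar>int a - int b\<bar>)"
  have "\<exists>w. cos_mean (D1 + D2) w (\<lambda>t. \<Sum>i\<in>I. c i * cos (real (v i) * t))"
  proof (rule cos_meanI)
    show "finite I" by (simp add: I_def)
    show "0 \<le> c i" if "i \<in> I" for i
      using assms by (auto simp: c_def cos_mean_def split: prod.splits)
    have "sum c I = (\<Sum>a\<le>D1. \<Sum>b\<le>D2. w1 a * w2 b)"
      unfolding I_def c_def by (simp add: sum.cartesian_product[symmetric] sum.cartesian_product' UNIV_bool)
    also have "... = (\<Sum>a\<le>D1. w1 a) * (\<Sum>b\<le>D2. w2 b)" by (simp add: sum_product)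
    finally show "sum c I = 1" using assms by (simp add: cos_mean_def)
    show "v i \<le> D1 + D2" if "i \<in> I" for i
      using that by (auto simp: I_def v_def split: prod.splits if_splits)
  qed
  moreover have "(\<Sum>i\<in>I. c i * cos (real (v i) * t)) = t1 t * t2 t" for t
  proof -
    have "(\<Sum>i\<in>I. c i * cos (real (v i) * t))
       = (\<Sum>a\<le>D1. \<Sum>b\<le>D2. w1 a * w2 b * (cos (real a * t - real b * t) + cos (real a * t + real b * t)) / 2)"
      unfolding I_def c_def v_def
      by (simp add: sum.cartesian_product[symmetric] sum.cartesian_product' UNIV_bool cos_nat_abs_diff[simplified] distrib_left distrib_right add_divide_distrib add.commute)
    also have "... = (\<Sum>a\<le>D1. \<Sum>b\<le>D2. (w1 a * cos (real a * t)) * (w2 b * cos (real b * t)))"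
      by (intro sum.cong refl) (simp add: cos_add cos_diff)
    also have "... = (\<Sum>a\<le>D1. w1 a * cos (real a * t)) * (\<Sum>b\<le>D2. w2 b * cos (real b * t))"
      by (simp add: sum_product)
    also have "... = t1 t * t2 t" using assms by (simp add: cos_mean_def)
    finally show ?thesis .
  qed
  ultimately show ?thesis by simp
qed

lemma cos_mean_power:
  assumes "cos_mean D w T"
  shows "\<exists>w'. cos_mean (M * D) w' (\<lambda>t. T t ^ M)"
proof (induction M)
  case 0
  have "cos_mean 0 (\<lambda>_. 1) (\<lambda>t. T t ^ 0)" by (simp add: cos_mean_def)
  thus ?case by auto
next
  case (Suc M)
  then obtain w' where "cos_mean (M * D) w' (\<lambda>t. T t ^ M)" by blast
  from cos_mean_mult[OF assms this] show ?case by simp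
qed

text \<open>The Fejer kernel divided by its order, hence of value 1 at 0. As a squared modulus it is
  visibly nonnegative; expanding the square shows its cosine coefficients.\<close>

definition fejer :: "nat \<Rightarrow> real \<Rightarrow> real" where
  "fejer N t = ((cmod (\<Sum>a<N. cis (real a * t))) / real N)^2"

lemma fejer_cos_mean:
  assumes "N \<ge> 1"
  shows "\<exists>w. cos_mean (N - 1) w (fejer N)"
proof -
  define I where "I = {..<N} \<times> {..<N}"
  define v where "v = (\<lambda>(a, b). nat \<bar>int a - int b\<bar>)"
  have "\<exists>w. cos_mean (N - 1) w (\<lambda>t. \<Sum>i\<in>I. (1 / (real N)^2) * cos (real (v i) * t))"
    by (rule cos_meanI) (use assms in \<open>auto simp: I_def v_def power2_eq_square\<close>)
  moreover have "(\<Sum>i\<in>I. (1 / (real N)^2) * cos (real (v i) * t)) = fejer N t" for t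
  proof -
    have "(cmod (\<Sum>a<N. cis (real a * t)))^2
       = (\<Sum>a<N. cos (real a * t))^2 + (\<Sum>a<N. sin (real a * t))^2"
      by (simp add: cmod_power2)
    also have "... = (\<Sum>a<N. \<Sum>b<N. cos (real a * t - real b * t))"
      by (simp add: power2_eq_square sum_product cos_diff sum.distrib)
    also have "... = (\<Sum>i\<in>I. cos (real (v i) * t))"
      unfolding I_def v_def
      by (simp add: sum.cartesian_product' cos_nat_abs_diff[simplified])
    finally show ?thesis by (simp add: fejer_def power_divide sum_divide_distrib)
  qed
  ultimately show ?thesis by simp
qed

lemma cos_mean_le_1:
  assumes "cos_mean D w T"
  shows "T t \<le> 1"
proof -
  have "T t = (\<Sum>l\<le>D. w l * cos (real l * t))" using assms by (simp add: cos_mean_def)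
  also have "... \<le> (\<Sum>l\<le>D. w l * 1)"
    using assms by (intro sum_mono mult_left_mono) (auto simp: cos_mean_def)
  finally show ?thesis using assms by (simp add: cos_mean_def)
qed

lemma cos_mean_0: "cos_mean D w T \<Longrightarrow> T 0 = 1"
  by (simp add: cos_mean_def)

lemma cmod_cis_minus_one: "cmod (cis s - 1) = 2 * \<bar>sin (s / 2)\<bar>"
proof -
  have "(cmod (cis s - 1))^2 = (cos s - 1)^2 + (sin s)^2" by (simp add: cmod_power2)
  also have "... = 2 - 2 * cos s"
    using sin_cos_squared_add[of s] by (simp add: power2_eq_square algebra_simps)
  also have "... = (2 * \<bar>sin (s / 2)\<bar>)^2"
    using cos_double_sin[of "s / 2"] by (simp add: power_mult_distrib)
  finally show ?thesis by (rule power2_eq_imp_eq) auto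
qed

text \<open>Multiplying the geometric sum by cis t - 1 leaves cis (N t) - 1, of modulus at most 2.
  The product form needs no exception at the zeros of sin (t/2).\<close>

lemma fejer_decay: "fejer N t * (real N * sin (t / 2))^2 \<le> 1"
proof (cases "N = 0")
  case False
  have "(\<Sum>a<N. cis (real a * t)) * (cis t - 1) = cis (real N * t) - 1"
  proof -
    have "(\<Sum>a<N. cis (real a * t)) = (\<Sum>a<N. cis t ^ a)"
      by (intro sum.cong refl) (rule Complex.DeMoivre[symmetric])
    also have "(cis t - 1) * (\<Sum>a<N. cis t ^ a) = cis t ^ N - 1"
      by (rule power_diff_1_eq[symmetric])
    finally show ?thesis by (simp only: Complex.DeMoivre mult.commute)
  qed
  hence "cmod (\<Sum>a<N. cis (real a * t)) * (2 * \<bar>sin (t / 2)\<bar>) = 2 * \<bar>sin (real N * t / 2)\<bar>"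
    by (metis cmod_cis_minus_one norm_mult)
  hence *: "cmod (\<Sum>a<N. cis (real a * t)) * \<bar>sin (t / 2)\<bar> \<le> 1" by simp
  have "fejer N t * (real N * sin (t / 2))^2 = (cmod (\<Sum>a<N. cis (real a * t)) * \<bar>sin (t / 2)\<bar>)^2"
    using False by (simp add: fejer_def power_divide power_mult_distrib)
  also have "... \<le> 1" using * by (intro power_le_one) auto
  finally show ?thesis .
qed simp

text \<open>For 0 < l < m the powers of a nontrivial m-th root of unity sum to 0; take real parts.
  This orthogonality makes equispaced sums exact for low frequencies.\<close>

lemma sum_cos_nodes:
  assumes "0 < l" "l < m"
  shows "(\<Sum>j<m. cos (real l * (2 * pi * real j / real m))) = 0"
proof -
  define \<omega> where "\<omega> = cis (2 * pi * real l / real m)"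
  have "\<omega> \<noteq> 1"
  proof
    assume "\<omega> = 1"
    hence "sin (pi * real l / real m) = 0"
      using cmod_cis_minus_one[of "2 * pi * real l / real m"] by (simp add: \<omega>_def)
    moreover have "sin (pi * real l / real m) > 0"
      using assms by (intro sin_gt_zero) (auto simp: field_simps)
    ultimately show False by simp
  qed
  moreover have "\<omega> ^ m = 1"
  proof -
    have "\<omega> ^ m = cis (2 * pi * real l)" 
      using assms unfolding \<omega>_def by (subst Complex.DeMoivre) (simp add: field_simps)
    also have "... = 1" by (rule cis_multiple_2pi) simp
    finally show ?thesis .
  qed
  ultimately have "(\<Sum>j<m. \<omega> ^ j) = 0" by (simp add: geometric_sum)
  moreover have "Re (\<omega> ^ j) = cos (real l * (2 * pi * real j / real m))" for j
    by (simp add: \<omega>_def Complex.DeMoivre mult_ac)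
  ultimately show ?thesis by (metis (no_types, lifting) Re_sum sum.cong zero_complex.simps(1))
qed

text \<open>Each term is at most the increment over a unit step of a function that increases from 0
  to 4, so the sum telescopes to a bound free of a and m. Later a is the position of an angle in
  units of the node spacing.\<close>

lemma sum_inverse_square_le: "(\<Sum>j<m. 1 / (1 + \<bar>a - real j\<bar>)^2) \<le> 4"
proof -
  \<comment> \<open>The continuous primitive of 2 / (1 + |a - x|)^2 with limits 0 and 4; the factor
    2 pays for comparing a term with the integral over the unit step to its right.\<close>
  define \<phi> where "\<phi> x = (if x < a then 2 / (1 + (a - x)) else 4 - 2 / (1 + (x - a)))" for x
  have step: "1 / (1 + \<bar>a - x\<bar>)^2 \<le> \<phi> (x + 1) - \<phi> x" for x
  proof -
    consider "x + 1 < a" | "x < a" "a \<le> x + 1" | "a \<le> x" by linarith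
    thus ?thesis
    proof cases
      case 1
      define t where "t = a - x"
      have t: "t > 1" using 1 by (simp add: t_def)
      have "1 / (1 + t)^2 \<le> 2 / t - 2 / (1 + t)"
      proof -
        have "2 / t - 2 / (1 + t) = 2 / (t * (1 + t))" using t by (simp add: field_simps)
        moreover have "1 / (1 + t)^2 \<le> 2 / (t * (1 + t))"
          using t by (simp add: divide_simps power2_eq_square)
        ultimately show ?thesis by simp
      qed
      thus ?thesis using 1 by (simp add: \<phi>_def t_def algebra_simps)
    next
      case 2
      define t where "t = a - x"
      have t: "0 < t" "t \<le> 1" using 2 by (auto simp: t_def)
      have *: "(2 - t) * (1 + t) \<ge> 2" using t by (simp add: algebra_simps mult_left_le)
      moreover have "2 / (2 - t) + 2 / (1 + t) = 6 / ((2 - t) * (1 + t))"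
        using t by (simp add: field_simps)
      moreover have "6 / ((2 - t) * (1 + t)) \<le> 6 / 2" using * by (intro divide_left_mono) linarith+
      ultimately have "2 / (2 - t) + 2 / (1 + t) \<le> 3" by simp
      moreover have "1 / (1 + t)^2 \<le> 1" using t by (simp add: divide_le_eq one_le_power)
      ultimately have "1 / (1 + t)^2 \<le> 4 - 2 / (2 - t) - 2 / (1 + t)" by linarith
      thus ?thesis using 2 by (simp add: \<phi>_def t_def algebra_simps)
    next
      case 3
      define t where "t = x - a"
      have t: "t \<ge> 0" using 3 by (simp add: t_def)
      have "1 / (1 + t)^2 \<le> 2 / (1 + t) - 2 / (2 + t)"
      proof -
        have "2 / (1 + t) - 2 / (2 + t) = 2 / ((1 + t) * (2 + t))" using t by (simp add: field_simps)
        moreover have "1 / (1 + t)^2 \<le> 2 / ((1 + t) * (2 + t))"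
          using t by (simp add: divide_simps power2_eq_square)
        ultimately show ?thesis by simp
      qed
      thus ?thesis using 3 by (simp add: \<phi>_def t_def algebra_simps)
    qed
  qed
  have "(\<Sum>j<m. 1 / (1 + \<bar>a - real j\<bar>)^2) \<le> \<phi> (real m) - \<phi> 0"
  proof (induction m)
    case (Suc m)
    thus ?case using step[of "real m"] by (simp add: add.commute)
  qed simp
  moreover have "\<phi> (real m) \<le> 4" by (auto simp: \<phi>_def field_simps)
  moreover have "\<phi> 0 \<ge> 0" by (auto simp: \<phi>_def field_simps)
  ultimately show ?thesis by linarith
qed

text \<open>The exponent is 2 K because \<open>rdist\<close> is bounded by the square of 1 + n |t -
  v|, plus 2 to leave a summable factor over equispaced nodes. The number q reserves a fraction n/q
  of the degree. The symmetrisation in v is what becomes a polynomial in cos t.\<close>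

definition localized_mean :: "nat \<Rightarrow> nat \<Rightarrow> real \<Rightarrow> nat \<Rightarrow> nat
  \<Rightarrow> (nat \<Rightarrow> real) \<Rightarrow> (real \<Rightarrow> real) \<Rightarrow> bool" where
  "localized_mean q K C n D w T \<longleftrightarrow> q * D \<le> n \<and> cos_mean D w T \<and> (\<forall>s. 0 \<le> T s) \<and>
    (\<forall>t\<in>{0..pi}. \<forall>v\<in>{0..pi}. (T (t - v) + T (t + v)) / 2 * (1 + real n * \<bar>t - v\<bar>) ^ (2 * K + 2) \<le> C)"

lemma localized_meanD:
  assumes "localized_mean q K C n D w T"
  shows "q * D \<le> n" "cos_mean D w T" "0 \<le> T s"
    "t \<in> {0..pi} \<Longrightarrow> v \<in> {0..pi} \<Longrightarrow> (T (t - v) + T (t + v)) / 2 * (1 + real n * \<bar>t - v\<bar>) ^ (2 * K + 2) \<le> C"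
  using assms unfolding localized_mean_def by blast+

text \<open>A Fejer kernel decays quadratically, so its power with exponent M = K + 1 has the
  required decay; order about n/(q M) keeps the degree of the power below n/q.\<close>

lemma localized_cos_mean:
  fixes K q :: nat
  assumes "q \<ge> 1"
  shows "\<exists>C\<ge>1. \<forall>n\<ge>1. \<exists>D w T. localized_mean q K C n D w T"
proof -
  define M where "M = K + 1"
  \<comment> \<open>144 = 12^2: with d = |t - v| and N d > 1, 1 + N d <= 2 N d <= 12 N |sin (s/2)|.
    For N d <= 1 the value 4 would do.\<close>
  define B where "B = (144::real)"
  define A where "A = 1 + real (q * M)"
  have A: "A \<ge> 1" by (simp add: A_def)
  show ?thesis
  proof (intro exI[of _ "(B * A^2) ^ M"] conjI allI impI)
    have "1 * 1 \<le> B * A^2" using A by (intro mult_mono) (auto simp: B_def)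
    thus "1 \<le> (B * A^2) ^ M" by simp
    fix n :: nat assume n: "1 \<le> n"
    \<comment> \<open>Rounded so that q M (N - 1) <= n < q M N. The summand 1 keeps N positive for
      small n.\<close>
    define N where "N = n div (q * M) + 1"
    have qM: "q * M \<ge> 1" using assms by (simp add: M_def)
    have "N \<ge> 1" by (simp add: N_def)
    then obtain w0 where w0: "cos_mean (N - 1) w0 (fejer N)" using fejer_cos_mean by blast
    obtain w where w: "cos_mean (M * (N - 1)) w (\<lambda>s. fejer N s ^ M)"
      using cos_mean_power[OF w0] by blast
    have deg: "q * (M * (N - 1)) \<le> n"
      by (simp add: N_def mult.assoc[symmetric])
    have "n < (n div (q * M) + 1) * (q * M)"
      using qM dividend_less_div_times[of "q * M" n] by (simp add: algebra_simps)
    hence "real n \<le> real (N * (q * M))" unfolding N_def by (intro of_nat_mono) simp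
    hence nN: "real n \<le> A * real N" by (simp add: A_def algebra_simps)
    \<comment> \<open>Stated for a free s to serve both s = t - v and s = t + v; the half-angle sine
      of the latter is at least as large.\<close>
    have main: "fejer N s ^ M * (1 + real n * \<bar>t - v\<bar>) ^ (2 * K + 2) \<le> (B * A^2) ^ M"
      if h: "t \<in> {0..pi}" "v \<in> {0..pi}" "\<bar>t - v\<bar> / 6 \<le> \<bar>sin (s / 2)\<bar>" for t v s
    proof -
      define d where "d = \<bar>t - v\<bar>"
      have f: "0 \<le> fejer N s" "fejer N s \<le> 1"
        using cos_mean_le_1[OF w0] by (auto simp: fejer_def)
      have d: "d \<ge> 0" by (simp add: d_def)
      have b: "fejer N s * (1 + real N * d)^2 \<le> B"
      proof (cases "real N * d \<le> 1")
        case True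
        have "fejer N s * (1 + real N * d)^2 \<le> 1 * 2^2"
          using f True d by (intro mult_mono power_mono) auto
        thus ?thesis by (simp add: B_def)
      next
        case False
        have "fejer N s * (1 + real N * d)^2 \<le> fejer N s * (12 * (real N * \<bar>sin (s / 2)\<bar>))^2"
        proof (intro mult_left_mono power_mono f)
          have "real N * (d / 6) \<le> real N * \<bar>sin (s / 2)\<bar>"
            using h by (intro mult_left_mono) (auto simp: d_def)
          thus "1 + real N * d \<le> 12 * (real N * \<bar>sin (s / 2)\<bar>)" using False by simp
        qed (use d in auto)
        also have "... = 144 * (fejer N s * (real N * sin (s / 2))^2)"
          by (simp add: power_mult_distrib)
        also have "... \<le> 144 * 1" by (intro mult_left_mono fejer_decay) auto
        finally show ?thesis by (simp add: B_def)
      qed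
      have "1 + real n * d \<le> A * (1 + real N * d)"
        using mult_right_mono[OF nN d] A by (simp add: algebra_simps)
      hence "fejer N s * (1 + real n * d)^2 \<le> fejer N s * (A * (1 + real N * d))^2"
        using f d by (intro mult_left_mono power_mono) auto
      also have "... = A^2 * (fejer N s * (1 + real N * d)^2)" by (simp add: power_mult_distrib)
      also have "... \<le> A^2 * B" using b by (intro mult_left_mono) auto
      finally have "fejer N s * (1 + real n * d)^2 \<le> B * A^2" by (simp add: mult.commute)
      hence "(fejer N s * (1 + real n * d)^2) ^ M \<le> (B * A^2) ^ M"
        using f d by (intro power_mono) auto
      moreover have "(fejer N s * (1 + real n * d)^2) ^ M = fejer N s ^ M * (1 + real n * d) ^ (2 * K + 2)"
        unfolding power_mult_distrib power_mult[symmetric] by (simp add: M_def)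
      ultimately show ?thesis by (simp add: d_def)
    qed
    show "\<exists>D w T. localized_mean q K ((B * A^2) ^ M) n D w T"
      unfolding localized_mean_def
    proof (intro exI conjI ballI allI)
      show "q * (M * (N - 1)) \<le> n" by (rule deg)
      show "cos_mean (M * (N - 1)) w (\<lambda>s. fejer N s ^ M)" by (rule w)
      show "0 \<le> fejer N s ^ M" for s by (simp add: fejer_def)
      fix t v assume h: "t \<in> {0..pi}" "v \<in> {0..pi}"
      have 1: "fejer N (t - v) ^ M * (1 + real n * \<bar>t - v\<bar>) ^ (2 * K + 2) \<le> (B * A^2) ^ M"
        using abs_sin_half_diff_ge[OF h] by (intro main h)
      have 2: "fejer N (t + v) ^ M * (1 + real n * \<bar>t - v\<bar>) ^ (2 * K + 2) \<le> (B * A^2) ^ M"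
        using abs_sin_half_diff_ge[OF h] sin_half_sum_ge(1)[OF h] by (intro main h) linarith
      show "(fejer N (t - v) ^ M + fejer N (t + v) ^ M) / 2 * (1 + real n * \<bar>t - v\<bar>) ^ (2 * K + 2) \<le> (B * A^2) ^ M"
        using 1 2 by (simp only: distrib_right add_divide_distrib times_divide_eq_left)
    qed
  qed
qed

section \<open>Polynomial kernels, bumps and partitions of unity\<close>

definition cheb_kernel :: "nat \<Rightarrow> (nat \<Rightarrow> real) \<Rightarrow> real \<Rightarrow> real poly" where
  "cheb_kernel D w y = (\<Sum>l\<le>D. smult (w l * poly (cheb l) y) (cheb l))"

lemma degree_cheb_kernel: "degree (cheb_kernel D w y) \<le> D"
  unfolding cheb_kernel_def
  by (intro degree_sum_le) (use degree_cheb degree_smult_le in \<open>auto intro: order_trans\<close>)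

lemma poly_cheb_kernel_cos:
  "poly (cheb_kernel D w (cos v)) (cos t) = (\<Sum>l\<le>D. w l * cos (real l * v) * cos (real l * t))"
  by (simp add: cheb_kernel_def poly_sum poly_cheb_cos)

text \<open>cos (l v) cos (l t) is the mean of cos (l (t - v)) and cos (l (t + v)). Thus a sum of
  products of Chebyshev polynomials is a translate of T made even in t, and inherits its positivity
  and decay.\<close>

lemma poly_cheb_kernel:
  assumes "cos_mean D w T"
  shows "poly (cheb_kernel D w (cos v)) (cos t) = (T (t - v) + T (t + v)) / 2"
proof -
  have "T (t - v) + T (t + v) = (\<Sum>l\<le>D. w l * (cos (real l * (t - v)) + cos (real l * (t + v))))"
    using assms by (simp add: cos_mean_def sum.distrib[symmetric] distrib_left)
  also have "... = (\<Sum>l\<le>D. 2 * (w l * cos (real l * v) * cos (real l * t)))"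
    by (intro sum.cong refl) (simp add: distrib_left right_diff_distrib cos_add cos_diff)
  finally show ?thesis
    by (simp add: poly_cheb_kernel_cos sum_distrib_left[symmetric])
qed

lemma cos_image: "x \<in> {-1..1} \<Longrightarrow> \<exists>t\<in>{0..pi}. x = cos t"
  by (rule bexI[of _ "arccos x"]) (auto simp: arccos_lbound arccos_ubound)

text \<open>The kernel is divided by its diagonal value, which is at least 1/2 because T is
  nonnegative with T 0 = 1. The bound near z averages \<open>cheb_lipschitz\<close> over the
  weights. Of the constant 24, 12 comes from that lemma and 2 from the division.\<close>

lemma localized_polynomial:
  fixes K q :: nat
  assumes "q \<ge> 1"
  shows "\<exists>C\<ge>1. \<forall>n\<ge>1. \<forall>z\<in>{-1..1}. \<exists>L. q * degree L \<le> n \<and> poly L z = 1 \<and>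
    (\<forall>x\<in>{-1..1}. \<bar>poly L x\<bar> * rdist n x z ^ K \<le> C
      \<and> \<bar>1 - poly L x\<bar> \<le> C * (\<bar>x - z\<bar> / rho n z))"
    (is "\<exists>C\<ge>1. \<forall>n\<ge>1. \<forall>z\<in>{-1..1}. ?localized C n z")
proof -
  obtain C where C: "C \<ge> 1" and main: "\<And>n. n \<ge> 1 \<Longrightarrow> \<exists>D w T. localized_mean q K C n D w T"
    using localized_cos_mean[OF assms, of K] by blast
  show ?thesis
  proof (intro exI[of _ "24 * C"] conjI allI impI ballI)
    show "1 \<le> 24 * C" using C by simp
    fix n :: nat and z :: real assume n: "1 \<le> n" and z: "z \<in> {-1..1}"
    from main[OF n] obtain D w T where mean: "localized_mean q K C n D w T" by blast
    note D = localized_meanD(1)[OF mean] and T = localized_meanD(2)[OF mean]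
      and tpos = localized_meanD(3)[OF mean] and dec = localized_meanD(4)[OF mean]
    obtain v where v: "v \<in> {0..pi}" "z = cos v" using cos_image[OF z] by blast
    have Dn: "D \<le> n" using D assms by (metis le_trans mult_le_mono1 nat_mult_1)
    define k where "k = poly (cheb_kernel D w z) z"
    have k: "k \<ge> 1 / 2"
      unfolding k_def v(2) poly_cheb_kernel[OF T] using cos_mean_0[OF T] tpos[of "v + v"] by simp
    show "?localized (24 * C) n z"
    proof (intro exI[of _ "smult (1 / k) (cheb_kernel D w z)"] conjI ballI)
      have "degree (smult (1 / k) (cheb_kernel D w z)) \<le> D"
        using degree_cheb_kernel[of D w z] degree_smult_le order_trans by blast
      thus "q * degree (smult (1 / k) (cheb_kernel D w z)) \<le> n"
        using D by (meson le_trans mult_le_mono2)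
      show "poly (smult (1 / k) (cheb_kernel D w z)) z = 1" using k by (simp add: k_def[symmetric])
      fix x :: real assume x: "x \<in> {-1..1}"
      obtain t where t: "t \<in> {0..pi}" "x = cos t" using cos_image[OF x] by blast
      define u where "u = poly (cheb_kernel D w z) x"
      have u: "u = (T (t - v) + T (t + v)) / 2"
        unfolding u_def v(2) t(2) poly_cheb_kernel[OF T] ..
      have u0: "u \<ge> 0" using tpos by (simp add: u)
      have k1: "1 / k \<le> 2" "1 / k \<ge> 0" using k by (auto simp: field_simps)
      have ab: "\<bar>poly (smult (1 / k) (cheb_kernel D w z)) x\<bar> = (1 / k) * u"
        using u0 k by (simp add: u_def[symmetric] abs_mult)
      have R: "rdist n x z \<ge> 1" using rdist_ge_1[OF n z] .
      have "u * rdist n x z ^ K \<le> u * ((1 + real n * \<bar>t - v\<bar>)^2) ^ K"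
        using rdist_cos_le[OF n t(1) v(1)] R u0 unfolding v(2)[symmetric] t(2)[symmetric]
        by (intro mult_left_mono power_mono) auto
      also have "... \<le> u * (1 + real n * \<bar>t - v\<bar>) ^ (2 * K + 2)"
        unfolding power_mult[symmetric] using u0 by (intro mult_left_mono power_increasing) auto
      also have "... \<le> C" using dec[OF t(1) v(1)] by (simp add: u)
      finally have uR: "u * rdist n x z ^ K \<le> C" .
      have "(1 / k) * (u * rdist n x z ^ K) \<le> 2 * C"
        using k1 uR u0 R C by (intro mult_mono) auto
      thus "\<bar>poly (smult (1 / k) (cheb_kernel D w z)) x\<bar> * rdist n x z ^ K \<le> 24 * C"
        unfolding ab using C by (simp add: mult.assoc)
      define e where "e = \<bar>x - z\<bar> / rho n z"
      have e0: "e \<ge> 0" using rho_pos[OF n z] by (simp add: e_def)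
      have "k - u = (\<Sum>l\<le>D. w l * cos (real l * v) * (cos (real l * v) - cos (real l * t)))"
        unfolding k_def u_def v(2) t(2) poly_cheb_kernel_cos
        by (simp add: sum_subtractf right_diff_distrib)
      also have "\<bar>...\<bar> \<le> (\<Sum>l\<le>D. w l * (12 * e))"
      proof (rule order_trans[OF sum_abs], rule sum_mono)
        fix l assume l: "l \<in> {..D}"
        have w0: "w l \<ge> 0" using T by (simp add: cos_mean_def)
        have "\<bar>cos (real l * t) - cos (real l * v)\<bar> \<le> 12 * e"
          unfolding e_def v(2) t(2) using l Dn by (intro cheb_lipschitz n t(1) v(1)) auto
        hence "\<bar>cos (real l * v)\<bar> * \<bar>cos (real l * v) - cos (real l * t)\<bar> \<le> 1 * (12 * e)"
          by (intro mult_mono) (auto simp: abs_minus_commute)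
        thus "\<bar>w l * cos (real l * v) * (cos (real l * v) - cos (real l * t))\<bar> \<le> w l * (12 * e)"
          using w0 by (simp add: abs_mult mult.assoc mult_left_mono)
      qed
      also have "... = 12 * e" using T by (simp add: sum_distrib_right[symmetric] cos_mean_def)
      finally have ku: "\<bar>k - u\<bar> \<le> 12 * e" .
      have "1 - poly (smult (1 / k) (cheb_kernel D w z)) x = (1 / k) * (k - u)"
        using k by (simp add: u_def[symmetric] field_simps)
      also have "\<bar>...\<bar> = (1 / k) * \<bar>k - u\<bar>" using k by (simp add: abs_mult)
      also have "... \<le> 2 * (12 * e)" using k1 ku by (intro mult_mono) auto
      also have "... \<le> 24 * C * e" using C e0 by (simp add: mult_right_mono)
      finally show "\<bar>1 - poly (smult (1 / k) (cheb_kernel D w z)) x\<bar> \<le> 24 * C * (\<bar>x - z\<bar> / rho n z)"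
        by (simp add: e_def)
    qed
  qed
qed

text \<open>With more nodes than the degree only frequency 0 survives the sum over nodes, so the sum
  of the kernels does not depend on x.\<close>

lemma sum_cheb_kernel_nodes:
  assumes "D < m"
  shows "(\<Sum>j<m. poly (cheb_kernel D w (cos (2 * pi * real j / real m))) (cos t)) = real m * w 0"
proof -
  have "(\<Sum>j<m. poly (cheb_kernel D w (cos (2 * pi * real j / real m))) (cos t))
     = (\<Sum>l\<le>D. w l * cos (real l * t) * (\<Sum>j<m. cos (real l * (2 * pi * real j / real m))))"
    unfolding poly_cheb_kernel_cos by (subst sum.swap) (simp add: sum_distrib_left mult_ac)
  also have "... = (\<Sum>l\<le>D. if l = 0 then w 0 * real m else 0)"
    using assms sum_cos_nodes[of _ m] by (intro sum.cong refl) auto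
  finally show ?thesis by simp
qed

text \<open>The weighted sum is the point: it lets local errors growing like the K-th power of
  \<open>rdist\<close> be summed at no cost. The centres need not be distinct; in the construction j
  and m - j share one.\<close>

definition poly_partition :: "nat \<Rightarrow> nat \<Rightarrow> real \<Rightarrow> nat \<Rightarrow> nat
  \<Rightarrow> (nat \<Rightarrow> real poly) \<Rightarrow> (nat \<Rightarrow> real) \<Rightarrow> bool" where
  "poly_partition q K C n m h y \<longleftrightarrow>
    (\<forall>j<m. q * degree (h j) \<le> n \<and> y j \<in> {-1..1} \<and> (\<forall>x\<in>{-1..1}. 0 \<le> poly (h j) x)) \<and>
    (\<forall>x\<in>{-1..1}. (\<Sum>j<m. poly (h j) x) = 1 \<and> (\<Sum>j<m. poly (h j) x * rdist n x (y j) ^ K) \<le> C)"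

lemma poly_partitionD:
  assumes "poly_partition q K C n m h y"
  shows "j < m \<Longrightarrow> q * degree (h j) \<le> n" "j < m \<Longrightarrow> y j \<in> {-1..1}"
    "j < m \<Longrightarrow> x \<in> {-1..1} \<Longrightarrow> 0 \<le> poly (h j) x"
    "x \<in> {-1..1} \<Longrightarrow> (\<Sum>j<m. poly (h j) x) = 1"
    "x \<in> {-1..1} \<Longrightarrow> (\<Sum>j<m. poly (h j) x * rdist n x (y j) ^ K) \<le> C"
  using assms unfolding poly_partition_def by blast+

text \<open>Kernels centred at equispaced angles of the full circle have a constant sum W, and
  dividing by W gives the partition. In the weighted sum, 2 K of the decay exponents pay for
  \<open>rdist\<close>, and the remaining 2 make the series over the nodes converge
  uniformly.\<close>

lemma polynomial_partition:
  fixes K q :: nat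
  assumes "q \<ge> 1"
  shows "\<exists>C\<ge>1. \<forall>n\<ge>1. \<exists>m h y. poly_partition q K C n m h y"
proof -
  obtain C where C: "C \<ge> 1" and main: "\<And>n. n \<ge> 1 \<Longrightarrow> \<exists>D w T. localized_mean q K C n D w T"
    using localized_cos_mean[OF assms, of K] by blast
  show ?thesis
  proof (intro exI[of _ "8 * C"] conjI allI impI)
    show "1 \<le> 8 * C" using C by simp
    fix n :: nat assume n: "1 \<le> n"
    from main[OF n] obtain D w T where mean: "localized_mean q K C n D w T" by blast
    note D = localized_meanD(1)[OF mean] and T = localized_meanD(2)[OF mean]
      and tpos = localized_meanD(3)[OF mean] and dec = localized_meanD(4)[OF mean]
    have Dn: "D \<le> n" using D assms by (metis le_trans mult_le_mono1 nat_mult_1)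
    define m where "m = D + 1"
    define u where "u j = 2 * pi * real j / real m" for j
    define y where "y j = cos (u j)" for j
    define W where "W = real m * w 0"
    define h where "h j = smult (1 / W) (cheb_kernel D w (y j))" for j
    have kpos: "poly (cheb_kernel D w (y j)) x \<ge> 0" if "x \<in> {-1..1}" for j x
    proof -
      obtain t where t: "t \<in> {0..pi}" "x = cos t" using \<open>x \<in> _\<close> cos_image by blast
      show ?thesis unfolding y_def t(2) poly_cheb_kernel[OF T] using tpos by simp
    qed
    have ksum: "(\<Sum>j<m. poly (cheb_kernel D w (y j)) x) = W" if "x \<in> {-1..1}" for x
    proof -
      obtain t where t: "t \<in> {0..pi}" "x = cos t" using \<open>x \<in> _\<close> cos_image by blast
      show ?thesis unfolding y_def u_def t(2) W_def by (rule sum_cheb_kernel_nodes) (simp add: m_def)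
    qed
    \<comment> \<open>At x = 1 the kernel of node 0 alone contributes T 0 = 1.\<close>
    have W: "W \<ge> 1"
    proof -
      have "poly (cheb_kernel D w (y 0)) 1 \<le> (\<Sum>j<m. poly (cheb_kernel D w (y j)) 1)"
        by (rule member_le_sum) (auto simp: kpos m_def)
      moreover have "poly (cheb_kernel D w (cos 0)) (cos 0) = 1"
        unfolding poly_cheb_kernel[OF T] using cos_mean_0[OF T] by simp
      ultimately show ?thesis using ksum[of 1] by (simp add: y_def u_def)
    qed
    show "\<exists>m h y. poly_partition q K (8 * C) n m h y"
      unfolding poly_partition_def
    proof (intro exI[of _ m] exI[of _ h] exI[of _ y] conjI allI impI ballI)
      fix j
      have "degree (h j) \<le> D"
        unfolding h_def using degree_cheb_kernel degree_smult_le order_trans by blast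
      thus "q * degree (h j) \<le> n" using D by (meson le_trans mult_le_mono2)
      show "y j \<in> {-1..1}" by (simp add: y_def)
      show "0 \<le> poly (h j) x" if "x \<in> {-1..1}" for x
        using kpos[OF that] W by (simp add: h_def)
    next
      fix x :: real assume x: "x \<in> {-1..1}"
      show "(\<Sum>j<m. poly (h j) x) = 1"
        using ksum[OF x] W by (simp add: h_def sum_divide_distrib[symmetric])
      obtain t where t: "t \<in> {0..pi}" "x = cos t" using x cos_image by blast
      \<comment> \<open>Positions of the angle t and of its mirror image 2 pi - t in units of the
        node spacing: nodes in the upper half circle are counted from a, the reflected ones from b.
        Each family contributes at most 4.\<close>
      define a where "a = t * real m / (2 * pi)"
      define b where "b = real m - a"
      have m0: "real m > 0" by (simp add: m_def)
      have mn: "real m \<le> 2 * real n" using Dn n by (simp add: m_def)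
      have sp: "\<bar>s\<bar> \<le> real n * \<bar>2 * pi / real m * s\<bar>" for s
      proof -
        have "1 \<le> real n * (2 * pi / real m)"
          using mn m0 pi_gt3 mult_mono[of 1 pi "real m" "2 * real n"] by (simp add: field_simps)
        hence "1 * \<bar>s\<bar> \<le> (real n * (2 * pi / real m)) * \<bar>s\<bar>" by (intro mult_right_mono) auto
        also have "... = real n * \<bar>2 * pi / real m * s\<bar>" using m0 by (simp add: abs_mult)
        finally show ?thesis by simp
      qed
      have summand: "poly (h j) x * rdist n x (y j) ^ K \<le> C * (1 / (1 + \<bar>a - real j\<bar>)^2 + 1 / (1 + \<bar>b - real j\<bar>)^2)"
        if j: "j < m" for j
      proof -
        \<comment> \<open>The node angle folded into [0, pi], which leaves its cosine
          unchanged.\<close>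
        define v where "v = (if u j \<le> pi then u j else 2 * pi - u j)"
        have u0: "0 \<le> u j" "u j \<le> 2 * pi" using j by (auto simp: u_def field_simps)
        have v: "v \<in> {0..pi}" using u0 by (auto simp: v_def)
        have yv: "y j = cos v" by (simp add: v_def y_def cos_diff)
        have yj: "y j \<in> {-1..1}" by (simp add: y_def)
        define d where "d = 1 + real n * \<bar>t - v\<bar>"
        have d1: "d \<ge> 1" by (simp add: d_def)
        define k where "k = poly (cheb_kernel D w (y j)) x"
        have k: "k = (T (t - v) + T (t + v)) / 2"
          unfolding k_def yv t(2) poly_cheb_kernel[OF T] ..
        have k0: "k \<ge> 0" using tpos by (simp add: k)
        have R: "rdist n x (y j) \<ge> 1" using rdist_ge_1[OF n yj] .
        have "poly (h j) x * rdist n x (y j) ^ K \<le> k * rdist n x (y j) ^ K"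
          using W k0 R by (intro mult_right_mono) (auto simp: h_def k_def[symmetric] divide_le_eq mult_le_cancel_left1)
        also have "... \<le> k * (d^2) ^ K"
          using rdist_cos_le[OF n t(1) v] R k0 unfolding yv[symmetric] t(2)[symmetric] d_def
          by (intro mult_left_mono power_mono) auto
        also have "... = k * d ^ (2 * K + 2) / d^2"
          using d1 unfolding power_mult[symmetric] power_add by simp
        also have "... \<le> C / d^2"
          using dec[OF t(1) v] by (intro divide_right_mono) (auto simp: k d_def)
        finally have 1: "poly (h j) x * rdist n x (y j) ^ K \<le> C / d^2" .
        have inv: "C / d^2 \<le> C * (1 / (1 + s)^2)" if "0 \<le> s" "s \<le> real n * \<bar>t - v\<bar>" for s
        proof -
          have "(1 + s)^2 \<le> d^2" using that by (intro power_mono) (auto simp: d_def)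
          hence "1 / d^2 \<le> 1 / (1 + s)^2" using that d1
            by (intro divide_left_mono mult_pos_pos zero_less_power) auto
          thus ?thesis using C by (metis divide_real_def mult_left_mono mult_1 order_trans zero_le_one)
        qed
        have "C / d^2 \<le> C * (1 / (1 + \<bar>a - real j\<bar>)^2) \<or> C / d^2 \<le> C * (1 / (1 + \<bar>b - real j\<bar>)^2)"
        proof (cases "u j \<le> pi")
          case True
          have "2 * pi / real m * (a - real j) = t - v"
            using True m0 by (simp add: a_def v_def u_def field_simps)
          thus ?thesis using sp[of "a - real j"] by (intro disjI1 inv) auto
        next
          case False
          have "2 * pi / real m * (b - real j) = - (t - v)"
            using False m0 by (simp add: a_def b_def v_def u_def field_simps)
          hence "\<bar>2 * pi / real m * (b - real j)\<bar> = \<bar>t - v\<bar>" by linarith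
          thus ?thesis using sp[of "b - real j"] by (intro disjI2 inv) auto
        qed
        moreover have "C * (1 / (1 + \<bar>a - real j\<bar>)^2) \<ge> 0" "C * (1 / (1 + \<bar>b - real j\<bar>)^2) \<ge> 0"
          using C by auto
        ultimately show ?thesis using 1 unfolding distrib_left by linarith
      qed
      have "(\<Sum>j<m. poly (h j) x * rdist n x (y j) ^ K)
          \<le> (\<Sum>j<m. C * (1 / (1 + \<bar>a - real j\<bar>)^2 + 1 / (1 + \<bar>b - real j\<bar>)^2))"
        using summand by (intro sum_mono) auto
      also have "... = C * ((\<Sum>j<m. 1 / (1 + \<bar>a - real j\<bar>)^2) + (\<Sum>j<m. 1 / (1 + \<bar>b - real j\<bar>)^2))"
        by (simp only: sum_distrib_left[symmetric] sum.distrib)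
      also have "... \<le> C * (4 + 4)"
        using C by (intro mult_left_mono add_mono sum_inverse_square_le) auto
      finally show "(\<Sum>j<m. poly (h j) x * rdist n x (y j) ^ K) \<le> 8 * C" by simp
    qed
  qed
qed

section \<open>Finite differences, moduli of smoothness and Whitney's inequality\<close>

lemma fdiff_0 [simp]: "fdiff 0 h g x = g x"
  by (simp add: fdiff_def)

lemma fdiff_Suc: "fdiff (Suc k) h g x = fdiff k h g (x + h) - fdiff k h g x"
proof -
  define G where "G i = g (x + real i * h)" for i
  have G: "g (x + h + real i * h) = G (Suc i)" for i by (simp add: G_def algebra_simps)
  have "fdiff (Suc k) h g x = (-1) ^ Suc k * G 0 +
      (\<Sum>i=0..k. (-1) ^ (k - i) * real (k choose i) * G (Suc i)) +
      (\<Sum>i=0..k. (-1) ^ (k - i) * real (k choose Suc i) * G (Suc i))"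
    unfolding fdiff_def G_def[symmetric]
    by (simp only: sum.atLeast0_atMost_Suc_shift) (simp add: sum.distrib[symmetric] algebra_simps)
  also have "(\<Sum>i=0..k. (-1) ^ (k - i) * real (k choose Suc i) * G (Suc i))
      = (\<Sum>i<k. - ((-1) ^ (k - Suc i) * real (k choose Suc i) * G (Suc i)))"
  proof -
    have "(\<Sum>i=0..k. (-1) ^ (k - i) * real (k choose Suc i) * G (Suc i))
      = (\<Sum>i<k. (-1) ^ (k - i) * real (k choose Suc i) * G (Suc i))"
      by (simp add: atLeast0AtMost lessThan_Suc_atMost[symmetric])
    also have "... = (\<Sum>i<k. - ((-1) ^ (k - Suc i) * real (k choose Suc i) * G (Suc i)))"
    proof (intro sum.cong refl)
      fix i assume "i \<in> {..<k}"
      hence "k - i = Suc (k - Suc i)" by auto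
      thus "(-1) ^ (k - i) * real (k choose Suc i) * G (Suc i)
        = - ((-1) ^ (k - Suc i) * real (k choose Suc i) * G (Suc i))" by simp
    qed
    finally show ?thesis .
  qed
  also have "(\<Sum>i=0..k. (-1) ^ (k - i) * real (k choose i) * G (Suc i)) = fdiff k h g (x + h)"
    by (simp add: fdiff_def G)
  also have "(-1) ^ Suc k * G 0 + fdiff k h g (x + h) + (\<Sum>i<k. - ((-1) ^ (k - Suc i) * real (k choose Suc i) * G (Suc i)))
    = fdiff k h g (x + h) - fdiff k h g x"
  proof -
    have "fdiff k h g x = (-1) ^ k * G 0 + (\<Sum>i<k. (-1) ^ (k - Suc i) * real (k choose Suc i) * G (Suc i))"
      unfolding fdiff_def G_def[symmetric]
      by (simp only: atLeast0AtMost sum.atMost_shift) simp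
    thus ?thesis by (simp add: sum_negf)
  qed
  finally show ?thesis .
qed

lemma fdiff_shift: "fdiff k h (\<lambda>x. g (x + d)) x = fdiff k h g (x + d)"
  unfolding fdiff_def by (simp add: add_ac)

lemma fdiff_diff: "fdiff k h (\<lambda>x. g x - g' x) x = fdiff k h g x - fdiff k h g' x"
  unfolding fdiff_def by (simp add: right_diff_distrib sum_subtractf)

lemma fdiff_sum: "fdiff k h (\<lambda>x. \<Sum>i\<in>I. c i * g i x) x = (\<Sum>i\<in>I. c i * fdiff k h (g i) x)"
  unfolding fdiff_def sum_distrib_left by (subst sum.swap) (simp add: mult_ac)

lemma fdiff_Suc_inner: "fdiff (Suc k) h g x = fdiff k h (\<lambda>x. g (x + h) - g x) x"
  by (simp add: fdiff_Suc fdiff_diff fdiff_shift)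

lemma fdiff_minus: "fdiff k (- h) g (x + real k * h) = (-1) ^ k * fdiff k h g x"
proof (induction k arbitrary: x)
  case (Suc k)
  have "fdiff (Suc k) (- h) g (x + real (Suc k) * h)
     = fdiff k (- h) g (x + real k * h) - fdiff k (- h) g ((x + h) + real k * h)"
    by (simp add: fdiff_Suc algebra_simps)
  also have "... = (-1) ^ k * (fdiff k h g x - fdiff k h g (x + h))"
    by (simp only: Suc right_diff_distrib)
  finally show ?case by (simp add: fdiff_Suc algebra_simps)
qed simp

lemma fdiff_scale_arg: "fdiff k h (\<lambda>s. g (c + e * s)) x = fdiff k (e * h) g (c + e * x)"
  unfolding fdiff_def by (simp add: algebra_simps)

lemma fdiff_zero_step: "k \<ge> 1 \<Longrightarrow> fdiff k 0 g x = 0"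
  by (cases k) (auto simp: fdiff_Suc)

lemma fdiff_poly:
  assumes "q = 0 \<or> degree q < k"
  shows "fdiff k h (poly q) x = 0"
  using assms
proof (induction k arbitrary: q x)
  case (Suc k)
  define p where "p = pcompose q [:h, 1:] - q"
  have pp: "poly q (x + h) - poly q x = poly p x" for x
    by (simp add: p_def poly_pcompose add.commute)
  have "p = 0 \<or> degree p < k"
  proof (cases "q = 0 \<or> degree q = 0")
    case True
    then obtain c where "q = [:c:]" by (metis degree_0 degree_eq_zeroE)
    thus ?thesis by (simp add: p_def)
  next
    case False
    have d: "degree p \<le> degree q" unfolding p_def
      by (intro degree_diff_le) (auto simp: degree_pcompose)
    have "coeff p (degree q) = 0"
      using lead_coeff_comp[of "[:h, 1:]" q] by (simp add: p_def degree_pcompose)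
    hence "p = 0 \<or> degree p < degree q"
      using d by (metis le_neq_implies_less leading_coeff_0_iff)
    thus ?thesis using Suc.prems False by auto
  qed
  thus ?case using Suc.IH by (simp add: fdiff_Suc_inner pp)
qed auto

lemma fdiff_node:
  fixes a b h x :: real
  assumes "i \<le> k" "x \<in> {a..b}" "x + real k * h \<in> {a..b}"
  shows "x + real i * h \<in> {a..b}"
proof (cases "h \<ge> 0")
  case True
  hence "0 \<le> real i * h" "real i * h \<le> real k * h" using assms(1) by (auto intro: mult_right_mono)
  thus ?thesis using assms(2,3) unfolding atLeastAtMost_iff by linarith
next
  case False
  hence "real i * h \<le> 0" "real k * h \<le> real i * h"
    using assms(1) by (auto intro: mult_right_mono_neg mult_nonneg_nonpos)
  thus ?thesis using assms(2,3) unfolding atLeastAtMost_iff by linarith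
qed

lemma fdiff_bound:
  assumes "\<And>i. i \<le> k \<Longrightarrow> \<bar>g (x + real i * h)\<bar> \<le> B"
  shows "\<bar>fdiff k h g x\<bar> \<le> 2 ^ k * B"
  using assms
proof (induction k arbitrary: x)
  case (Suc k)
  have "\<bar>fdiff k h g (x + h)\<bar> \<le> 2 ^ k * B"
    using Suc.prems[of "Suc i" for i] by (intro Suc.IH) (simp add: algebra_simps)
  moreover have "\<bar>fdiff k h g x\<bar> \<le> 2 ^ k * B"
    using Suc.prems by (intro Suc.IH) simp
  ultimately show ?case by (simp add: fdiff_Suc)
next
  case 0
  thus ?case using 0[of 0] by simp
qed

text \<open>A difference of step 2 h is the sum of two adjacent differences of step h. Doing this in
  each of the k factors produces 2^k differences of order k with step h.\<close>

lemma fdiff_double_bound: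
  assumes "\<And>i. i \<le> k \<Longrightarrow> \<bar>fdiff k h g (x + real i * h)\<bar> \<le> M"
  shows "\<bar>fdiff k (2 * h) g x\<bar> \<le> 2 ^ k * M"
  using assms
proof (induction k arbitrary: g M)
  case (Suc k)
  define G where "G x = g (x + h) - g x" for x
  have GG: "(\<lambda>x. g (x + 2 * h) - g x) = (\<lambda>x. G (x + h) - (- G x))"
    by (auto simp: G_def algebra_simps)
  have m: "fdiff k h (\<lambda>x. - G x) y = - fdiff k h G y" for y
    unfolding fdiff_def by (simp add: sum_negf)
  have "\<bar>fdiff k (2 * h) (\<lambda>x. G (x + h) - (- G x)) x\<bar> \<le> 2 ^ k * (2 * M)"
  proof (rule Suc.IH)
    fix i assume i: "i \<le> k"
    have "fdiff k h (\<lambda>x. G (x + h) - (- G x)) (x + real i * h)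
       = fdiff (Suc k) h g (x + real (Suc i) * h) + fdiff (Suc k) h g (x + real i * h)"
      unfolding fdiff_diff fdiff_shift m fdiff_Suc_inner G_def[symmetric] by (simp add: algebra_simps)
    thus "\<bar>fdiff k h (\<lambda>x. G (x + h) - (- G x)) (x + real i * h)\<bar> \<le> 2 * M"
      using Suc.prems[of i] Suc.prems[of "Suc i"] i by simp
  qed
  thus ?case unfolding fdiff_Suc_inner GG by simp
next
  case 0
  thus ?case using 0[of 0] by simp
qed

text \<open>Solve the difference for its last value, whose coefficient is 1; the other binomial
  coefficients sum to less than 2^k. This is how a function is extrapolated from its
  differences.\<close>

lemma fdiff_last_bound:
  assumes "k \<ge> 1" "\<And>i. i < k \<Longrightarrow> \<bar>g (x + real i * h)\<bar> \<le> B"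
  shows "\<bar>g (x + real k * h)\<bar> \<le> \<bar>fdiff k h g x\<bar> + 2 ^ k * B"
proof -
  have B: "B \<ge> 0" using assms(2)[of 0] assms(1) by simp
  define S where "S = (\<Sum>i<k. (-1) ^ (k - i) * real (k choose i) * g (x + real i * h))"
  have "fdiff k h g x = S + g (x + real k * h)"
    unfolding fdiff_def S_def by (simp add: atLeast0AtMost lessThan_Suc_atMost[symmetric])
  moreover have "\<bar>S\<bar> \<le> (\<Sum>i<k. real (k choose i) * B)"
    unfolding S_def by (rule order_trans[OF sum_abs], rule sum_mono)
      (auto simp: abs_mult intro!: mult_left_mono assms)
  moreover have "(\<Sum>i<k. real (k choose i) * B) \<le> (\<Sum>i\<le>k. real (k choose i) * B)"
    using B by (intro sum_mono2) auto
  moreover have "(\<Sum>i\<le>k. real (k choose i) * B) = 2 ^ k * B"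
    unfolding sum_distrib_right[symmetric] using choose_row_sum[of k] by (metis of_nat_numeral of_nat_power of_nat_sum)
  ultimately show ?thesis by linarith
qed

section \<open>Moduli of smoothness\<close>

lemma bounded_on_interval:
  fixes g :: "real \<Rightarrow> real"
  assumes "continuous_on {a..b} g"
  shows "\<exists>B. \<forall>x\<in>{a..b}. \<bar>g x\<bar> \<le> B"
  using compact_imp_bounded[OF compact_continuous_image[OF assms compact_Icc]]
  by (auto simp: bounded_iff)

lemma modsm_bdd:
  assumes "continuous_on {-1..1} g"
  shows "bdd_above {\<bar>fdiff k h g x\<bar> | h x. 0 < h \<and> h \<le> t \<and> x \<in> {-1..1} \<and> x + real k * h \<in> {-1..1}}"
proof -
  obtain B where B: "\<And>x. x \<in> {-1..1} \<Longrightarrow> \<bar>g x\<bar> \<le> B" using bounded_on_interval[OF assms] by blast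
  have "\<bar>fdiff k h g x\<bar> \<le> 2 ^ k * B" if "0 < h" "x \<in> {-1..1}" "x + real k * h \<in> {-1..1}" for h x
  proof (rule fdiff_bound)
    fix i assume "i \<le> k"
    thus "\<bar>g (x + real i * h)\<bar> \<le> B" using that by (intro B fdiff_node[of i k])
  qed
  thus ?thesis by (intro bdd_aboveI[of _ "2 ^ k * B"]) blast
qed

lemma modsm_upper:
  assumes "continuous_on {-1..1} g" "k \<ge> 1" "t > 0" "\<bar>h\<bar> \<le> t" "x \<in> {-1..1}" "x + real k * h \<in> {-1..1}"
  shows "\<bar>fdiff k h g x\<bar> \<le> modsm k g t {-1..1}"
proof -
  have pos: "\<bar>fdiff k h g x\<bar> \<le> modsm k g t {-1..1}"
    if "0 < h" "h \<le> t" "x \<in> {-1..1}" "x + real k * h \<in> {-1..1}" for h x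
    unfolding modsm_def by (rule cSup_upper[OF _ modsm_bdd[OF assms(1)]]) (use that in blast)
  consider "h > 0" | "h = 0" | "h < 0" by linarith
  thus ?thesis
  proof cases
    case 1
    thus ?thesis using assms by (intro pos) auto
  next
    case 2
    \<comment> \<open>For h = 0 the claim is that the supremum is nonnegative; this step is
      admissible at x = -1 and witnesses it.\<close>
    have "-1 + real k * (min t (1 / real k)) \<le> 1"
      using assms(2) mult_left_mono[OF min.cobounded2[of t "1 / real k"], of "real k"] by simp
    hence "\<bar>fdiff k (min t (1 / real k)) g (-1)\<bar> \<le> modsm k g t {-1..1}"
      using assms(2,3) by (intro pos) auto
    thus ?thesis using 2 assms(2) by (simp add: fdiff_zero_step)
  next
    case 3
    have "\<bar>fdiff k (- h) g (x + real k * h)\<bar> = \<bar>fdiff k h g x\<bar>"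
      by (simp add: fdiff_minus abs_mult)
    moreover have "\<bar>fdiff k (- h) g (x + real k * h)\<bar> \<le> modsm k g t {-1..1}"
      using 3 assms by (intro pos) auto
    ultimately show ?thesis by simp
  qed
qed

lemma modsm_least:
  assumes "t > 0" "\<And>h x. 0 < h \<Longrightarrow> h \<le> t \<Longrightarrow> x \<in> {-1..1}
    \<Longrightarrow> x + real k * h \<in> {-1..1} \<Longrightarrow> \<bar>fdiff k h g x\<bar> \<le> B"
  shows "modsm k g t {-1..1} \<le> B"
  unfolding modsm_def
proof (rule cSup_least)
  \<comment> \<open>The supremum must range over a nonempty set. This step fits at x = -1, and k + 1
    in the denominator also covers k = 0.\<close>
  have "real k * min t (1 / (real k + 1)) \<le> real k * (1 / (real k + 1))" by (intro mult_left_mono) auto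
  also have "... \<le> 1" by (simp add: field_simps)
  finally have "-1 + real k * min t (1 / (real k + 1)) \<in> {-1..1}" using assms(1) by auto
  moreover have "0 < min t (1 / (real k + 1))" "min t (1 / (real k + 1)) \<le> t" using assms(1) by auto
  ultimately have "\<bar>fdiff k (min t (1 / (real k + 1))) g (-1)\<bar>
     \<in> {\<bar>fdiff k h g x\<bar> | h x. 0 < h \<and> h \<le> t \<and> x \<in> {-1..1} \<and> x + real k * h \<in> {-1..1}}"
    by (intro CollectI exI[of _ "min t (1 / (real k + 1))"] exI[of _ "-1"]) auto
  thus "{\<bar>fdiff k h g x\<bar> | h x. 0 < h \<and> h \<le> t \<and> x \<in> {-1..1}
    \<and> x + real k * h \<in> {-1..1}} \<noteq> {}" by blast
qed (use assms(2) in blast)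

lemma modsm_nonneg:
  assumes "continuous_on {-1..1} g" "k \<ge> 1" "t > 0"
  shows "0 \<le> modsm k g t {-1..1}"
  using modsm_upper[OF assms, of 0 0] assms by simp

lemma modsm_mono:
  assumes "continuous_on {-1..1} g" "k \<ge> 1" "0 < s" "s \<le> t"
  shows "modsm k g s {-1..1} \<le> modsm k g t {-1..1}"
  using assms by (intro modsm_least modsm_upper) auto

lemma modsm_double:
  assumes "continuous_on {-1..1} g" "k \<ge> 1" "0 < t"
  shows "modsm k g (2 * t) {-1..1} \<le> 2 ^ k * modsm k g t {-1..1}"
proof (rule modsm_least)
  fix h x :: real assume h: "0 < h" "h \<le> 2 * t" "x \<in> {-1..1}" "x + real k * h \<in> {-1..1}"
  have "\<bar>fdiff k (2 * (h / 2)) g x\<bar> \<le> 2 ^ k * modsm k g t {-1..1}"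
  proof (rule fdiff_double_bound)
    fix i assume i: "i \<le> k"
    have mid: "x + real (2 * k) * (h / 2) \<in> {-1..1}" using h by simp
    have "x + real i * (h / 2) \<in> {-1..1}" "x + real (i + k) * (h / 2) \<in> {-1..1}"
      using i by (intro fdiff_node[OF _ h(3) mid]; simp)+
    thus "\<bar>fdiff k (h / 2) g (x + real i * (h / 2))\<bar> \<le> modsm k g t {-1..1}"
      using h assms by (intro modsm_upper) (auto simp: algebra_simps add_divide_distrib)
  qed
  thus "\<bar>fdiff k h g x\<bar> \<le> 2 ^ k * modsm k g t {-1..1}" by simp
qed (use assms in simp)

text \<open>Rounding c up to a power of 2 and doubling repeatedly costs at most (2 c)^k; the 2 is
  the price of the rounding.\<close>

lemma modsm_scale:
  assumes "continuous_on {-1..1} g" "k \<ge> 1" "0 < t" "c \<ge> 1"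
  shows "modsm k g (c * t) {-1..1} \<le> (2 * c) ^ k * modsm k g t {-1..1}"
proof -
  have iter: "modsm k g (2 ^ j * t) {-1..1} \<le> (2 ^ j) ^ k * modsm k g t {-1..1}" for j :: nat
  proof (induction j)
    case (Suc j)
    have "modsm k g (2 * (2 ^ j * t)) {-1..1} \<le> 2 ^ k * modsm k g (2 ^ j * t) {-1..1}"
      using assms by (intro modsm_double) auto
    also have "... \<le> 2 ^ k * ((2 ^ j) ^ k * modsm k g t {-1..1})"
      using Suc by (intro mult_left_mono) auto
    finally show ?case by (simp add: power_mult_distrib mult_ac)
  qed simp
  obtain j where j: "c \<le> 2 ^ j" "2 ^ j \<le> 2 * c"
  proof -
    define j where "j = nat \<lceil>log 2 c\<rceil>"
    have l0: "0 \<le> log 2 c" using assms(4) by simp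
    have "log 2 c \<le> real j" "real j \<le> log 2 c + 1"
      using l0 unfolding j_def by linarith+
    hence "2 powr log 2 c \<le> 2 powr real j" "2 powr real j \<le> 2 powr (log 2 c + 1)"
      by (auto intro!: powr_mono)
    thus ?thesis using assms(4) by (intro that[of j]) (auto simp: powr_realpow powr_add)
  qed
  have "modsm k g (c * t) {-1..1} \<le> modsm k g (2 ^ j * t) {-1..1}"
    using assms j by (intro modsm_mono mult_right_mono) auto
  also have "... \<le> (2 ^ j) ^ k * modsm k g t {-1..1}" by (rule iter)
  also have "... \<le> (2 * c) ^ k * modsm k g t {-1..1}"
    using j modsm_nonneg[OF assms(1-3)] by (intro mult_right_mono power_mono) auto
  finally show ?thesis .
qed

text \<open>An extrapolation property along a ray: v is an approximation error, under control up to
  the length l, and beyond l only the difference spanning [0, s] is known. The exponent K has to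
  serve all v, l, S and B at once, which keeps the later constants uniform.\<close>

definition growth_exponent :: "nat \<Rightarrow> nat \<Rightarrow> bool" where
  "growth_exponent k K \<longleftrightarrow> (\<forall>v l S B. 0 < l \<and> 0 \<le> S \<and> continuous_on {0..S} v \<and>
    (\<forall>s\<in>{0..S}. s \<le> l \<longrightarrow> \<bar>v s\<bar> \<le> B) \<and>
    (\<forall>s\<in>{0..S}. l \<le> s \<longrightarrow> \<bar>fdiff k (s / real k) v 0\<bar> \<le> B * (1 + s / l) ^ k) \<longrightarrow>
    (\<forall>s\<in>{0..S}. \<bar>v s\<bar> \<le> 2 * B * (1 + s / l) ^ K))"

lemma growth_exponentD:
  assumes "growth_exponent k K" "0 < l" "0 \<le> S" "continuous_on {0..S} v"
    "\<And>s. s \<in> {0..S} \<Longrightarrow> s \<le> l \<Longrightarrow> \<bar>v s\<bar> \<le> B"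
    "\<And>s. s \<in> {0..S} \<Longrightarrow> l \<le> s \<Longrightarrow> \<bar>fdiff k (s / real k) v 0\<bar>
      \<le> B * (1 + s / l) ^ k" "s \<in> {0..S}"
  shows "\<bar>v s\<bar> \<le> 2 * B * (1 + s / l) ^ K"
  using assms unfolding growth_exponent_def by blast

text \<open>For \<open>K\<close> large, at a maximum \<open>s > l\<close> of \<open>|v s| / (1 + s/l)^K\<close> the difference formula bounds
  \<open>v s\<close> by the values of \<open>v\<close> at the points \<open>i s/k\<close> with \<open>i < k\<close>, which contribute at most half of
  the maximum.\<close>

lemma growth_extension:
  fixes k :: nat
  assumes k: "k \<ge> 1"
  shows "\<exists>K. growth_exponent k K"
proof -
  \<comment> \<open>Chosen so that 1 + (1 - 1/k) t <= \<gamma> (1 + t) for t >= 1, which covers all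
    nodes but the last. K is then so large that 2^k \<gamma>^K <= 1/2, and at least k to dominate
    the growth of the differences.\<close>
  define \<gamma> where "\<gamma> = 1 - 1 / (2 * real k)"
  have \<gamma>: "0 < \<gamma>" "\<gamma> < 1" using k by (auto simp: \<gamma>_def field_simps)
  obtain K0 where K0: "\<gamma> ^ K0 < 1 / (2 * 2 ^ k)"
    using real_arch_pow_inv[of "1 / (2 * 2 ^ k)" \<gamma>] \<gamma> by auto
  define K where "K = K0 + k"
  have "\<gamma> ^ K \<le> \<gamma> ^ K0" using \<gamma> by (intro power_decreasing) (auto simp: K_def)
  hence "2 ^ k * \<gamma> ^ K \<le> 2 ^ k * (1 / (2 * 2 ^ k))" using K0 by (intro mult_left_mono) auto
  hence K: "2 ^ k * \<gamma> ^ K \<le> 1 / 2" by simp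
  show ?thesis
    unfolding growth_exponent_def
  proof (intro exI[of _ K] allI impI ballI, elim conjE)
    fix v :: "real \<Rightarrow> real" and l S B s0 :: real
    assume l: "0 < l" and S: "0 \<le> S" and cont: "continuous_on {0..S} v"
      and b1: "\<forall>s\<in>{0..S}. s \<le> l \<longrightarrow> \<bar>v s\<bar> \<le> B"
      and b2: "\<forall>s\<in>{0..S}. l \<le> s \<longrightarrow> \<bar>fdiff k (s / real k) v 0\<bar> \<le> B * (1 + s / l) ^ k"
      and s0: "s0 \<in> {0..S}"
    have B: "B \<ge> 0" using b1 l S by (metis abs_ge_zero atLeastAtMost_iff less_eq_real_def order_trans)
    define \<phi> where "\<phi> s = \<bar>v s\<bar> / (1 + s / l) ^ K" for s
    have p1: "1 + s / l \<ge> 1" if "s \<in> {0..S}" for s using that l by simp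
    have pp: "(1 + s / l) ^ K > 0" if "s \<in> {0..S}" for s using p1[OF that] by simp
    have "continuous_on {0..S} \<phi>"
      unfolding \<phi>_def
    proof (intro continuous_intros cont ballI)
      show "(1 + s / l) ^ K \<noteq> 0" if "s \<in> {0..S}" for s using pp[OF that] by linarith
      show "l \<noteq> 0" using l by simp
    qed
    then obtain s where s: "s \<in> {0..S}" and smax: "\<And>s'. s' \<in> {0..S} \<Longrightarrow> \<phi> s' \<le> \<phi> s"
      using continuous_attains_sup[of "{0..S}" \<phi>] S by auto
    have m0: "\<phi> s \<ge> 0" using pp[OF s] by (simp add: \<phi>_def)
    have "\<phi> s \<le> 2 * B"
    proof (cases "s \<le> l")
      case True
      have "\<phi> s \<le> \<bar>v s\<bar> / 1" unfolding \<phi>_def using p1[OF s] by (intro divide_left_mono) auto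
      also have "... \<le> B" using b1 s True by simp
      finally show ?thesis using B by simp
    next
      case False
      define t where "t = s / l"
      have t: "t \<ge> 1" using False l by (simp add: t_def)
      have "\<bar>v (0 + real k * (s / real k))\<bar> \<le> \<bar>fdiff k (s / real k) v 0\<bar> + 2 ^ k * (\<phi> s * (\<gamma> * (1 + t)) ^ K)"
      proof (rule fdiff_last_bound[OF k])
        fix i assume i: "i < k"
        define s' where "s' = 0 + real i * (s / real k)"
        have ik: "real i \<le> real k - 1" using i by linarith
        have s'1: "s' \<le> (1 - 1 / real k) * s"
        proof -
          have "real i * (s / real k) \<le> (real k - 1) * (s / real k)"
            using ik s by (intro mult_right_mono) auto
          also have "... = (1 - 1 / real k) * s" using k by (simp add: field_simps)
          finally show ?thesis by (simp add: s'_def)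
        qed
        have s'2: "s' \<in> {0..S}"
        proof -
          have "(1 - 1 / real k) * s \<le> 1 * s" using s k by (intro mult_right_mono) auto
          thus ?thesis using s'1 s by (auto simp: s'_def)
        qed
        have "s' / l \<le> (1 - 1 / real k) * t"
          using divide_right_mono[OF s'1, of l] l by (simp add: t_def)
        also have "1 + (1 - 1 / real k) * t \<le> \<gamma> * (1 + t)"
          using t k by (simp add: \<gamma>_def field_simps)
        finally have c: "1 + s' / l \<le> \<gamma> * (1 + t)" by simp
        have "\<bar>v s'\<bar> = \<phi> s' * (1 + s' / l) ^ K" using less_imp_neq[OF pp[OF s'2]] unfolding \<phi>_def by simp
        also have "... \<le> \<phi> s * (\<gamma> * (1 + t)) ^ K"
          using smax[OF s'2] m0 c p1[OF s'2] by (intro mult_mono power_mono) auto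
        finally show "\<bar>v (0 + real i * (s / real k))\<bar> \<le> \<phi> s * (\<gamma> * (1 + t)) ^ K"
          by (simp add: s'_def)
      qed
      moreover have "\<bar>fdiff k (s / real k) v 0\<bar> \<le> B * (1 + t) ^ k"
        using b2 s False by (auto simp: t_def)
      moreover have "0 + real k * (s / real k) = s" using k by simp
      ultimately have "\<bar>v s\<bar> \<le> B * (1 + t) ^ k + 2 ^ k * (\<phi> s * (\<gamma> * (1 + t)) ^ K)"
        by simp
      also have "B * (1 + t) ^ k \<le> B * (1 + t) ^ K"
        using t B by (intro mult_left_mono power_increasing) (auto simp: K_def)
      also have "2 ^ k * (\<phi> s * (\<gamma> * (1 + t)) ^ K) = (2 ^ k * \<gamma> ^ K) * (\<phi> s * (1 + t) ^ K)"
        by (simp add: power_mult_distrib)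
      also have "... \<le> (1 / 2) * (\<phi> s * (1 + t) ^ K)"
        using K m0 t by (intro mult_right_mono) auto
      finally have "\<bar>v s\<bar> \<le> (B + \<phi> s / 2) * (1 + t) ^ K" by (simp add: algebra_simps)
      hence "\<phi> s \<le> B + \<phi> s / 2"
        using pp[OF s] unfolding \<phi>_def t_def[symmetric] by (simp add: pos_divide_le_eq)
      thus ?thesis by simp
    qed
    hence "\<phi> s0 \<le> 2 * B" using smax[OF s0] by linarith
    thus "\<bar>v s0\<bar> \<le> 2 * B * (1 + s0 / l) ^ K"
      using pp[OF s0] by (simp add: \<phi>_def pos_divide_le_eq)
  qed
qed

section \<open>Mixed differences and Whitney's inequality\<close>

primrec mdiff :: "real list \<Rightarrow> (real \<Rightarrow> real) \<Rightarrow> real \<Rightarrow> real" where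
  "mdiff [] g x = g x"
| "mdiff (h # hs) g x = mdiff hs g (x + h) - mdiff hs g x"

lemma mdiff_zero_step: "0 \<in> set hs \<Longrightarrow> mdiff hs g x = 0"
  by (induction hs arbitrary: x) auto

lemma mdiff_replicate: "mdiff (replicate k h) g x = fdiff k h g x"
  by (induction k arbitrary: x) (simp_all add: fdiff_Suc)

text \<open>Each pair is a step h with a velocity d: at index i the step is h + i d, while the base
  point moves by i e. Expanding one mixed step splits the sum into two of the same kind, one of them
  with x + h and e + d. After all steps 2^length pure differences of order K remain.\<close>

lemma mdiff_moving_bound:
  assumes "\<And>x e. \<bar>x - m\<bar> \<le> R \<Longrightarrow> \<bar>e\<bar> \<le> R \<Longrightarrow> \<bar>fdiff K e g x\<bar> \<le> M"
    and "\<bar>x - m\<bar> + (\<Sum>(h, d)\<leftarrow>hds. \<bar>h\<bar>)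
      \<le> R" "\<bar>e\<bar> + (\<Sum>(h, d)\<leftarrow>hds. \<bar>d\<bar>) \<le> R"
  shows "\<bar>\<Sum>i=0..K. (-1) ^ (K - i) * real (K choose i) * mdiff (map (\<lambda>(h, d). h + real i * d) hds) g (x + real i * e)\<bar>
    \<le> 2 ^ length hds * M"
  using assms(2,3)
proof (induction hds arbitrary: x e)
  case Nil
  thus ?case using assms(1)[of x e] by (simp add: fdiff_def)
next
  case (Cons hd hds)
  obtain h d where hd: "hd = (h, d)" by fastforce
  define T where "T x e = (\<Sum>i=0..K. (-1) ^ (K - i) * real (K choose i) * mdiff (map (\<lambda>(h, d). h + real i * d) hds) g (x + real i * e))" for x e
  have "(\<Sum>i=0..K. (-1) ^ (K - i) * real (K choose i) * mdiff (map (\<lambda>(h, d). h + real i * d) (hd # hds)) g (x + real i * e))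
     = T (x + h) (e + d) - T x e"
    unfolding T_def sum_subtractf[symmetric] hd by (intro sum.cong refl) (simp add: algebra_simps)
  moreover have "\<bar>T (x + h) (e + d)\<bar> \<le> 2 ^ length hds * M"
    unfolding T_def using Cons.prems by (intro Cons.IH) (auto simp: hd)
  moreover have "\<bar>T x e\<bar> \<le> 2 ^ length hds * M"
    unfolding T_def using Cons.prems by (intro Cons.IH) (auto simp: hd)
  ultimately show ?case by simp
qed

text \<open>Kemperman's device: in the alternating sum over \<open>i\<close> of mixed differences with the steps
  \<open>h\<^sub>j (1 - i/j)\<close> all terms except \<open>i = 0\<close> contain a zero step.\<close>

lemma mdiff_bound:
  assumes "\<And>x e. \<bar>x - m\<bar> \<le> R \<Longrightarrow> \<bar>e\<bar> \<le> R
    \<Longrightarrow> \<bar>fdiff (length hs) e g x\<bar> \<le> M"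
    and "\<bar>x - m\<bar> + (\<Sum>h\<leftarrow>hs. \<bar>h\<bar>) \<le> R"
  shows "\<bar>mdiff hs g x\<bar> \<le> 2 ^ length hs * M"
proof -
  define K where "K = length hs"
  define hds where "hds = map (\<lambda>j. (hs ! j, - (hs ! j) / real (Suc j))) [0..<K]"
  have fst_hds: "map fst hds = hs" by (simp add: hds_def K_def comp_def map_nth)
  have len: "length hds = K" by (simp add: hds_def)
  have s1: "(\<Sum>(h, d)\<leftarrow>hds. \<bar>h\<bar>) = (\<Sum>h\<leftarrow>hs. \<bar>h\<bar>)"
    unfolding fst_hds[symmetric] map_map by (intro arg_cong[of _ _ sum_list] map_cong) auto
  have s2: "(\<Sum>(h, d)\<leftarrow>hds. \<bar>d\<bar>) \<le> (\<Sum>(h, d)\<leftarrow>hds. \<bar>h\<bar>)"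
  proof (rule sum_list_mono)
    fix p assume "p \<in> set hds"
    thus "(case p of (h, d) \<Rightarrow> \<bar>d\<bar>) \<le> (case p of (h, d) \<Rightarrow> \<bar>h\<bar>)"
      by (auto simp: hds_def field_simps mult_le_cancel_left1)
  qed
  have "\<bar>\<Sum>i=0..K. (-1) ^ (K - i) * real (K choose i) * mdiff (map (\<lambda>(h, d). h + real i * d) hds) g (x + real i * 0)\<bar>
    \<le> 2 ^ length hds * M"
  proof (rule mdiff_moving_bound)
    show "\<bar>fdiff K e g x\<bar> \<le> M" if "\<bar>x - m\<bar> \<le> R" "\<bar>e\<bar> \<le> R" for x e
      using assms(1)[OF that] by (simp add: K_def)
    show "\<bar>x - m\<bar> + (\<Sum>(h, d)\<leftarrow>hds. \<bar>h\<bar>) \<le> R" using assms(2) s1 by simp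
    show "\<bar>0\<bar> + (\<Sum>(h, d)\<leftarrow>hds. \<bar>d\<bar>) \<le> R"
      using assms(2) s1 s2 by (smt (verit))
  qed
  moreover have "(\<Sum>i=0..K. (-1) ^ (K - i) * real (K choose i) * mdiff (map (\<lambda>(h, d). h + real i * d) hds) g (x + real i * 0))
     = (\<Sum>i=0..K. if i = 0 then (-1) ^ K * mdiff hs g x else 0)"
  proof (intro sum.cong refl)
    fix i assume i: "i \<in> {0..K}"
    show "(-1) ^ (K - i) * real (K choose i) * mdiff (map (\<lambda>(h, d). h + real i * d) hds) g (x + real i * 0)
      = (if i = 0 then (-1) ^ K * mdiff hs g x else 0)"
    proof (cases i)
      case 0
      have "map (\<lambda>(h, d). h + real i * d) hds = hs"
        unfolding fst_hds[symmetric] by (intro map_cong) (auto simp: 0)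
      thus ?thesis using 0 by simp
    next
      case (Suc j)
      have "(hs ! j, - (hs ! j) / real (Suc j)) \<in> set hds" using Suc i by (auto simp: hds_def)
      moreover have "(case (hs ! j, - (hs ! j) / real (Suc j)) of (h, d) \<Rightarrow> h + real i * d) = 0"
        using Suc by (simp add: field_simps)
      ultimately have "0 \<in> set (map (\<lambda>(h, d). h + real i * d) hds)"
        unfolding set_map by (metis image_eqI)
      thus ?thesis using Suc by (simp add: mdiff_zero_step)
    qed
  qed
  ultimately show ?thesis by (simp add: len K_def[symmetric] abs_mult)
qed

text \<open>The last conjunct serves the first step of Whitney's induction: there q = 0 and the
  primitive must be constant, while the degree bound alone would allow 1.\<close>

lemma poly_antiderivative:
  fixes q :: "real poly"
  shows "\<exists>Q. pderiv Q = q \<and> poly Q z = c \<and> degree Q \<le> Suc (degree q) \<and> (q = 0 \<longrightarrow> degree Q = 0)"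
proof -
  define Q0 where "Q0 = (\<Sum>i\<le>degree q. monom (coeff q i / real (Suc i)) (Suc i))"
  have pd: "pderiv Q0 = q"
  proof -
    have "pderiv Q0 = (\<Sum>i\<le>degree q. monom (coeff q i) i)"
      unfolding Q0_def higher_pderiv_sum[of 1, simplified]
      by (intro sum.cong refl) (simp add: pderiv_monom field_simps del: of_nat_Suc)
    thus ?thesis by (simp add: poly_as_sum_of_monoms)
  qed
  have dQ: "degree Q0 \<le> Suc (degree q)"
    unfolding Q0_def by (intro degree_sum_le) (auto intro: order_trans[OF degree_monom_le])
  define Q where "Q = Q0 + [:c - poly Q0 z:]"
  have "degree Q \<le> Suc (degree q)"
    unfolding Q_def by (intro degree_add_le dQ) auto
  moreover have "q = 0 \<longrightarrow> degree Q = 0" by (simp add: Q_def Q0_def)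
  ultimately show ?thesis
    by (intro exI[of _ Q]) (simp add: Q_def pderiv_add pd)
qed

text \<open>Differences of order k annihilate q, so the error has the same differences as g;
  extrapolate the error along the ray from y with direction e.\<close>

lemma poly_error_growth:
  assumes "growth_exponent k E" "0 < l" "q = 0 \<or> degree q < k" "continuous_on I g" "s \<in> {0..S}"
    and mem: "\<And>s. s \<in> {0..S} \<Longrightarrow> y + e * s \<in> I"
    and near: "\<And>s. s \<in> {0..S} \<Longrightarrow> s \<le> l \<Longrightarrow> \<bar>g (y + e * s) - poly q (y + e * s)\<bar> \<le> B"
    and far: "\<And>s. s \<in> {0..S} \<Longrightarrow> l \<le> s
      \<Longrightarrow> \<bar>fdiff k (e * (s / real k)) g y\<bar> \<le> B * (1 + s / l) ^ k"
  shows "\<bar>g (y + e * s) - poly q (y + e * s)\<bar> \<le> 2 * B * (1 + s / l) ^ E"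
proof -
  have "fdiff k h (\<lambda>s. g (y + e * s) - poly q (y + e * s)) 0 = fdiff k (e * h) g y" for h
    using fdiff_scale_arg[of k h "\<lambda>x. g x - poly q x" y e 0] assms(3) by (simp add: fdiff_diff fdiff_poly)
  moreover have "continuous_on {0..S} (\<lambda>s. g (y + e * s) - poly q (y + e * s))"
    by (intro continuous_intros continuous_on_compose2[OF assms(4)]) (use mem in auto)
  ultimately show ?thesis
    using growth_exponentD[OF assms(1,2), of S "\<lambda>s. g (y + e * s) - poly q (y + e * s)"] assms(5) near far
    by simp
qed

text \<open>The disjunct q = 0 gives "degree below k" a meaning for k = 0, where the induction
  starts. The length of the interval does not enter, so one C serves windows of every size.\<close>

definition whitney_constant :: "nat \<Rightarrow> real \<Rightarrow> bool" where
  "whitney_constant k C \<longleftrightarrow> (\<forall>g a b M. a < b \<and> continuous_on {a..b} g \<and>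
     (\<forall>x h. x \<in> {a..b} \<and> x + real k * h \<in> {a..b} \<longrightarrow> \<bar>fdiff k h g x\<bar> \<le> M) \<longrightarrow>
     (\<exists>q. (q = 0 \<or> degree q < k) \<and> (\<forall>x\<in>{a..b}. \<bar>g x - poly q x\<bar> \<le> C * M)))"

lemma whitney_constantD:
  assumes "whitney_constant k C" "a < b" "continuous_on {a..b} g"
    "\<And>x h. x \<in> {a..b} \<Longrightarrow> x + real k * h \<in> {a..b} \<Longrightarrow> \<bar>fdiff k h g x\<bar> \<le> M"
  shows "\<exists>q. (q = 0 \<or> degree q < k) \<and> (\<forall>x\<in>{a..b}. \<bar>g x - poly q x\<bar> \<le> C * M)"
  using assms unfolding whitney_constant_def by blast

text \<open>Induction on the order. On a middle piece J replace g by a combination \<open>g1\<close>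
  of averages of g; their difference is an average of K-th differences of g, hence at most M. The
  derivative of \<open>g1\<close> is a combination of increments of g, so its differences of order K
  - 1 are mixed K-th differences, controlled by \<open>mdiff_bound\<close>. The induction hypothesis
  approximates this derivative; integrating gives the polynomial on J, and extrapolation carries it
  to the whole interval.\<close>

lemma whitney: "\<exists>C\<ge>1. whitney_constant k C"
proof (induction k)
  case 0
  show ?case
    unfolding whitney_constant_def by (rule exI[of _ 1]) (auto intro!: exI[of _ "0 :: real poly"])
next
  case (Suc k)
  then obtain C where C: "C \<ge> 1" and IH: "whitney_constant k C" by blast
  define K where "K = Suc k"
  have K1: "K \<ge> 1" by (simp add: K_def)
  obtain E where E: "growth_exponent K E" using growth_extension[OF K1] by blast
  \<comment> \<open>On J: 1 for g - g1; then 4^K M / d bounds the differences of the derivative, C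
    is inherited, and integration over a length u = K d supplies K. \<open>C2\<close> adds the
    extrapolation, where s / u <= 4 (K + 1).\<close>
  define C1 where "C1 = 1 + real K * C * 4 ^ K"
  define C2 where "C2 = 2 * C1 * (1 + 4 * (real K + 1)) ^ E"
  have C1: "C1 \<ge> 1" using C by (simp add: C1_def)
  have "1 * 1 \<le> 2 * C1 * (1 + 4 * (real K + 1)) ^ E" using C1 by (intro mult_mono one_le_power) auto
  hence C2: "C2 \<ge> 1" by (simp add: C2_def)
  have "\<exists>q. (q = 0 \<or> degree q < K) \<and> (\<forall>x\<in>{a..b}. \<bar>g x - poly q x\<bar> \<le> C2 * M)"
    if ab: "a < b" and cont: "continuous_on {a..b} g"
      and diff: "\<And>x h. x \<in> {a..b} \<Longrightarrow> x + real K * h \<in> {a..b}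
        \<Longrightarrow> \<bar>fdiff K h g x\<bar> \<le> M"
    for g :: "real \<Rightarrow> real" and a b M
  proof -
    have M: "M \<ge> 0" using diff[of a 0] ab by (simp add: order_trans[OF abs_ge_zero])
    define m where "m = (a + b) / 2"
    define L where "L = b - a"
    \<comment> \<open>The shift x - m (at most u), the step i d (at most u) and the k steps h
      (together at most 2 u) total R = 4 u; K further steps of size R still stay in the interval,
      since R + K R = L/2.\<close>
    define u where "u = L / (8 * (real K + 1))"
    define d where "d = u / real K"
    define R where "R = 4 * u"
    have L: "L > 0" using ab by (simp add: L_def)
    have u: "u > 0" using L by (simp add: u_def)
    have d: "d > 0" "real K * d = u" using u K1 by (auto simp: d_def)
    have R: "R + real K * R = L / 2"
    proof -
      have "R + real K * R = 4 * ((real K + 1) * u)" by (simp add: R_def algebra_simps)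
      also have "(real K + 1) * u = L / 8"
      proof -
        define w where "w = real K + 1"
        have "w > 0" by (simp add: w_def)
        thus ?thesis unfolding u_def w_def[symmetric] by (simp add: field_simps)
      qed
      finally show ?thesis by simp
    qed
    have KR: "real K * R \<ge> R" using u K1 by (simp add: R_def)
    have abm: "a = m - L / 2" "b = m + L / 2" by (auto simp: m_def L_def field_simps)
    have inR: "\<bar>fdiff K e g x\<bar> \<le> M" if "\<bar>x - m\<bar> \<le> R" "\<bar>e\<bar> \<le> R" for x e
    proof (rule diff)
      have "\<bar>real K * e\<bar> \<le> real K * R" using that by (simp add: abs_mult mult_left_mono)
      moreover have "R \<ge> 0" using u by (simp add: R_def)
      ultimately show "x + real K * e \<in> {a..b}" "x \<in> {a..b}"
        using that R KR unfolding abm atLeastAtMost_iff by linarith+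
    qed
    obtain H where H: "\<And>x. x \<in> {a..b} \<Longrightarrow> (H has_vector_derivative g x) (at x within {a..b})"
      using antiderivative_continuous[OF cont] by blast
    have H': "(H has_real_derivative g x) (at x)" if "a < x" "x < b" for x
      using H[of x] that by (simp add: has_real_derivative_iff_has_vector_derivative at_within_Icc_at)
    define c where "c i = (-1) ^ i * real (K choose i)" for i
    \<comment> \<open>With H a primitive of g, each quotient is the mean of g (x + i h) over h in
      [0, d]. So \<open>g1\<close> is what remains when the term i = 0 is removed from the averaged
      K-th difference, up to sign.\<close>
    define g1 where "g1 x = (\<Sum>i=1..K. - c i / (real i * d) * (H (x + real i * d) - H x))" for x
    define g1' where "g1' x = (\<Sum>i=1..K. - c i / (real i * d) * (g (x + real i * d) - g x))" for x
    define J where "J = {m - u..m + u}"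
    have inside: "a < x + real i * h \<and> x + real i * h < b" if "x \<in> J" "i \<le> K" "0 \<le> h" "h \<le> d" for x i h
    proof -
      have "real i * h \<le> real K * d" using that by (intro mult_mono) auto
      hence "0 \<le> real i * h" "real i * h \<le> u" using that d by auto
      moreover have "4 * u < L / 2" using R u KR unfolding R_def by linarith
      ultimately show ?thesis using that u unfolding abm J_def atLeastAtMost_iff by linarith
    qed
    have g1_close: "\<bar>g x - g1 x\<bar> \<le> M" if x: "x \<in> J" for x
    proof -
      \<comment> \<open>A primitive in h of the signed K-th difference: \<Psi> d - \<Psi> 0 equals d
        (g x - g1 x), and a mean value bound replaces the estimate of an integral.\<close>
      define \<Psi> where "\<Psi> h = h * g x + (\<Sum>i=1..K. c i / real i * (H (x + real i * h) - H x))" for h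
      define \<Psi>' where "\<Psi>' h = (-1) ^ K * fdiff K h g x" for h
      have \<Psi>'eq: "\<Psi>' h = g x + (\<Sum>i=1..K. c i * g (x + real i * h))" for h
      proof -
        have "(-1) ^ K * fdiff K h g x = (\<Sum>i=0..K. c i * g (x + real i * h))"
          unfolding fdiff_def sum_distrib_left c_def
        proof (intro sum.cong refl)
          fix i assume "i \<in> {0..K}"
          hence "K + (K - i) = i + 2 * (K - i)" by simp
          hence "(-1 :: real) ^ K * (-1) ^ (K - i) = (-1) ^ (i + 2 * (K - i))"
            by (metis power_add)
          also have "... = (-1) ^ i" by (simp add: power_add power_mult)
          finally show "(-1) ^ K * ((-1) ^ (K - i) * real (K choose i) * g (x + real i * h))
            = (-1) ^ i * real (K choose i) * g (x + real i * h)" by (metis mult.assoc)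
        qed
        also have "... = c 0 * g x + (\<Sum>i=1..K. c i * g (x + real i * h))"
          by (simp add: sum.atLeast_Suc_atMost)
        finally show ?thesis by (simp add: \<Psi>'_def c_def)
      qed
      have "\<bar>\<Psi> d - \<Psi> 0\<bar> \<le> M * \<bar>d - 0\<bar>"
      proof (rule field_differentiable_bound[where S = "{0..d}" and f' = \<Psi>', unfolded real_norm_def])
        fix h assume h: "h \<in> {0..d}"
        have "(\<Psi> has_real_derivative (1 * g x + (\<Sum>i=1..K. c i / real i * (g (x + real i * h) * real i)))) (at h)"
          unfolding \<Psi>_def
        proof (intro DERIV_add DERIV_sum DERIV_cmult)
          show "((\<lambda>h. h * g x) has_real_derivative 1 * g x) (at h)"
            by (auto intro!: derivative_eq_intros)
          fix i assume i: "i \<in> {1..K}"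
          have "((\<lambda>h. H (x + real i * h)) has_real_derivative g (x + real i * h) * real i) (at h)"
            by (rule DERIV_chain2[where f = H, OF H']) (use inside[OF x, of i h] i h in \<open>auto intro!: derivative_eq_intros\<close>)
          thus "((\<lambda>h. H (x + real i * h) - H x) has_real_derivative g (x + real i * h) * real i) (at h)"
            by (auto intro!: derivative_eq_intros)
        qed
        moreover have "1 * g x + (\<Sum>i=1..K. c i / real i * (g (x + real i * h) * real i)) = \<Psi>' h"
          unfolding \<Psi>'eq by (simp add: field_simps)
        ultimately show "(\<Psi> has_real_derivative \<Psi>' h) (at h within {0..d})"
          by (simp add: has_field_derivative_at_within)
        have "\<bar>fdiff K h g x\<bar> \<le> M"
          using inside[OF x, of 0 h] inside[OF x, of K h] h by (intro diff) auto
        thus "\<bar>\<Psi>' h\<bar> \<le> M" by (simp add: \<Psi>'_def abs_mult)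
      qed (use d in auto)
      moreover have "\<Psi> d - \<Psi> 0 = d * (g x - g1 x)"
      proof -
        have "d * g1 x = (\<Sum>i=1..K. - (c i / real i * (H (x + real i * d) - H x)))"
          unfolding g1_def sum_distrib_left using d by (intro sum.cong refl) (auto simp: field_simps)
        moreover have "\<Psi> d - \<Psi> 0 = d * g x + (\<Sum>i=1..K. c i / real i * (H (x + real i * d) - H x))"
          by (simp add: \<Psi>_def)
        ultimately show ?thesis unfolding sum_negf right_diff_distrib by linarith
      qed
      ultimately show ?thesis using d by (simp add: abs_mult mult.commute)
    qed
    have g1_deriv: "(g1 has_real_derivative g1' x) (at x)" if x: "x \<in> J" for x
      unfolding g1_def g1'_def
    proof (intro DERIV_sum DERIV_cmult)
      fix i assume i: "i \<in> {1..K}"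
      have "((\<lambda>x. H (x + real i * d)) has_real_derivative g (x + real i * d) * 1) (at x)"
        by (rule DERIV_chain2[where f = H, OF H']) (use inside[OF x, of i d] i d in \<open>auto intro!: derivative_eq_intros\<close>)
      moreover have "(H has_real_derivative g x) (at x)"
        using inside[OF x, of 0 0] d by (intro H') auto
      ultimately show "((\<lambda>x. H (x + real i * d) - H x) has_real_derivative g (x + real i * d) - g x) (at x)"
        by (auto intro!: derivative_eq_intros)
    qed
    have contJ: "continuous_on J g1'"
      unfolding g1'_def
    proof (intro continuous_intros)
      fix i assume i: "i \<in> {1..K}"
      show "continuous_on J (\<lambda>x. g (x + real i * d))"
        by (rule continuous_on_compose2[OF cont])
          (use inside[of _ i d] i d in \<open>fastforce intro!: continuous_intros\<close>)+
      show "continuous_on J g"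
        by (rule continuous_on_subset[OF cont]) (use inside[of _ 0 0] d in fastforce)
    qed
    have diff1: "\<bar>fdiff k h g1' x\<bar> \<le> 4 ^ K * M / d" if x: "x \<in> J" "x + real k * h \<in> J" for x h
    proof -
      \<comment> \<open>One step i d comes from the derivative of \<open>g1\<close>, the other k
        steps from the difference being estimated: K steps in all.\<close>
      have mb: "\<bar>mdiff ((real i * d) # replicate k h) g x\<bar> \<le> 2 ^ K * M" if i: "i \<in> {1..K}" for i
      proof -
        have len: "length ((real i * d) # replicate k h) = K" by (simp add: K_def)
        have "real i * d \<le> real K * d" using i d by (intro mult_right_mono) auto
        moreover have "\<bar>real k * h\<bar> \<le> 2 * u" using x unfolding J_def atLeastAtMost_iff by linarith
        moreover have "\<bar>x - m\<bar> \<le> u" using x(1) unfolding J_def atLeastAtMost_iff by linarith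
        ultimately have "\<bar>x - m\<bar> + (\<Sum>h\<leftarrow>(real i * d) # replicate k h. \<bar>h\<bar>) \<le> R"
          using d unfolding R_def by (simp add: sum_list_replicate abs_mult)
        thus ?thesis using mdiff_bound[of m R "(real i * d) # replicate k h" g M x] inR
          unfolding len by blast
      qed
      have "fdiff k h g1' x = (\<Sum>i=1..K. - c i / (real i * d) * mdiff ((real i * d) # replicate k h) g x)"
        unfolding g1'_def fdiff_sum
        by (intro sum.cong refl) (simp add: fdiff_diff fdiff_shift mdiff_replicate)
      also have "\<bar>...\<bar> \<le> (\<Sum>i=1..K. real (K choose i) * (2 ^ K * M / d))"
      proof (rule order_trans[OF sum_abs], rule sum_mono)
        fix i assume i: "i \<in> {1..K}"
        have "\<bar>- c i / (real i * d)\<bar> = real (K choose i) / (real i * d)"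
          using d by (simp add: c_def abs_mult)
        also have "... \<le> real (K choose i) / d"
          using i d by (intro divide_left_mono) auto
        finally have "\<bar>- c i / (real i * d)\<bar> \<le> real (K choose i) / d" .
        hence "\<bar>- c i / (real i * d)\<bar> * \<bar>mdiff ((real i * d) # replicate k h) g x\<bar>
           \<le> real (K choose i) / d * (2 ^ K * M)"
          using mb[OF i] d by (intro mult_mono) auto
        thus "\<bar>- c i / (real i * d) * mdiff ((real i * d) # replicate k h) g x\<bar>
          \<le> real (K choose i) * (2 ^ K * M / d)" by (simp only: abs_mult) simp
      qed
      also have "... \<le> 2 ^ K * (2 ^ K * M / d)"
      proof -
        have "(\<Sum>i=1..K. real (K choose i)) \<le> (\<Sum>i\<le>K. real (K choose i))"
          by (intro sum_mono2) auto
        also have "... = 2 ^ K" using choose_row_sum[of K] by (metis of_nat_numeral of_nat_power of_nat_sum)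
        finally show ?thesis unfolding sum_distrib_right[symmetric] using M d by (intro mult_right_mono) auto
      qed
      also have "... = 4 ^ K * M / d" by (simp add: power_mult_distrib[symmetric])
      finally show ?thesis .
    qed
    have "m - u < m + u" using u by simp
    from whitney_constantD[OF IH this contJ[unfolded J_def] diff1[unfolded J_def]]
    obtain q where q: "q = 0 \<or> degree q < k" and qb: "\<And>x. x \<in> J
      \<Longrightarrow> \<bar>g1' x - poly q x\<bar> \<le> C * (4 ^ K * M / d)"
      unfolding J_def[symmetric] by blast
    obtain Q where Q: "pderiv Q = q" "poly Q m = g1 m" "degree Q \<le> Suc (degree q)" "q = 0 \<longrightarrow> degree Q = 0"
      using poly_antiderivative by blast
    have degQ: "degree Q < K" using Q q by (auto simp: K_def)
    have mJ: "m \<in> J" using u by (simp add: J_def)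
    have gQ: "\<bar>g x - poly Q x\<bar> \<le> C1 * M" if x: "x \<in> J" for x
    proof -
      have "\<bar>(g1 x - poly Q x) - (g1 m - poly Q m)\<bar> \<le> C * (4 ^ K * M / d) * \<bar>x - m\<bar>"
      proof (rule field_differentiable_bound[where S = J and f' = "\<lambda>x. g1' x - poly q x", unfolded real_norm_def])
        fix y assume y: "y \<in> J"
        show "((\<lambda>x. g1 x - poly Q x) has_real_derivative g1' y - poly q y) (at y within J)"
          unfolding Q(1)[symmetric]
          by (intro derivative_intros has_field_derivative_at_within[OF g1_deriv[OF y]] has_field_derivative_at_within[OF poly_DERIV])
        show "\<bar>g1' y - poly q y\<bar> \<le> C * (4 ^ K * M / d)" by (rule qb[OF y])
      qed (use x mJ in \<open>auto simp: J_def\<close>)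
      also have "... \<le> C * (4 ^ K * M / d) * u"
        using x C M d by (intro mult_left_mono) (auto simp: J_def abs_le_iff)
      also have "... = real K * C * 4 ^ K * M" using d by (simp add: d(2)[symmetric])
      finally have "\<bar>g1 x - poly Q x\<bar> \<le> real K * C * 4 ^ K * M" using Q(2) by simp
      moreover have "C1 * M = M + real K * C * 4 ^ K * M" by (simp add: C1_def algebra_simps)
      ultimately show ?thesis using g1_close[OF x] by linarith
    qed
    have side: "\<bar>g (m + e * s) - poly Q (m + e * s)\<bar> \<le> C2 * M" if e: "e = 1 \<or> e = -1" and s: "s \<in> {0..L / 2}" for e s
    proof -
      have mem: "m + e * s \<in> {a..b}" if "s \<in> {0..L / 2}" for s
        using e that unfolding abm by auto
      have "\<bar>g (m + e * s) - poly Q (m + e * s)\<bar> \<le> 2 * (C1 * M) * (1 + s / u) ^ E"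
      proof (rule poly_error_growth[OF E u disjI2[OF degQ] cont s mem])
        show "\<bar>g (m + e * s) - poly Q (m + e * s)\<bar> \<le> C1 * M" if "s \<in> {0..L / 2}" "s \<le> u" for s
          using that e by (intro gQ) (auto simp: J_def)
        show "\<bar>fdiff K (e * (s / real K)) g m\<bar> \<le> C1 * M * (1 + s / u) ^ K" if s: "s \<in> {0..L / 2}" "u \<le> s" for s
        proof -
          have "\<bar>fdiff K (e * (s / real K)) g m\<bar> \<le> 1 * M * 1"
            using mem[of 0] mem[OF s(1)] L K1 by (auto intro!: diff)
          also have "... \<le> C1 * M * (1 + s / u) ^ K"
            using C1 M s u by (intro mult_mono one_le_power) auto
          finally show ?thesis .
        qed
      qed
      also have "... \<le> 2 * (C1 * M) * (1 + 4 * (real K + 1)) ^ E"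
      proof -
        have "s / u \<le> (L / 2) / u" using s u by (intro divide_right_mono) auto
        also have "... = 4 * (real K + 1)" using L by (simp add: u_def field_simps)
        finally show ?thesis using C1 M s u by (intro mult_left_mono power_mono) auto
      qed
      also have "... = C2 * M" by (simp add: C2_def)
      finally show ?thesis .
    qed
    have "\<bar>g x - poly Q x\<bar> \<le> C2 * M" if x: "x \<in> {a..b}" for x
    proof (cases "x \<ge> m")
      case True
      thus ?thesis using side[of 1 "x - m"] x by (simp add: abm)
    next
      case False
      thus ?thesis using side[of "-1" "m - x"] x by (simp add: abm)
    qed
    thus ?thesis using degQ by blast
  qed
  thus ?case
    unfolding K_def[symmetric] whitney_constant_def using C2 by (intro exI[of _ C2]) auto
qed

lemma poly_prescribed_derivatives:
  fixes q :: "real poly"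
  shows "\<exists>p. (pderiv ^^ r) p = q \<and> (\<forall>i<r. poly ((pderiv ^^ i) p) z = c i) \<and> degree p \<le> degree q + r"
proof (induction r arbitrary: c)
  case (Suc r)
  obtain p' where p': "(pderiv ^^ r) p' = q" "\<forall>i<r. poly ((pderiv ^^ i) p') z = c (Suc i)"
    "degree p' \<le> degree q + r" using Suc[of "\<lambda>i. c (Suc i)"] by blast
  obtain p where p: "pderiv p = p'" "poly p z = c 0" "degree p \<le> Suc (degree p')"
    using poly_antiderivative by blast
  have e: "(pderiv ^^ Suc i) p = (pderiv ^^ i) p'" for i
    using p(1) by (simp add: funpow_swap1)
  have "poly ((pderiv ^^ i) p) z = c i" if "i < Suc r" for i
    using that p p' e by (cases i) auto
  thus ?case using p p' e by (intro exI[of _ p]) auto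
qed simp

section \<open>Whitney approximation at the scale rho\<close>

lemma rho_le: "n \<ge> 1 \<Longrightarrow> rho n x \<le> 2 / real n"
proof -
  assume n: "n \<ge> 1"
  have "sqrt (1 - x^2) \<le> 1" by (simp add: real_sqrt_le_1_iff)
  hence "sqrt (1 - x^2) / real n \<le> 1 / real n" by (intro divide_right_mono) auto
  moreover have "1 / (real n)^2 \<le> 1 / real n"
    using n by (intro divide_left_mono) (auto simp: power2_eq_square)
  ultimately show ?thesis unfolding rho_def by (simp add: add_divide_distrib[symmetric] field_simps)
qed

lemma rdist_nonneg: "n \<ge> 1 \<Longrightarrow> z \<in> {-1..1} \<Longrightarrow> rdist n x z \<ge> 0"
  using rdist_ge_1[of n z x] by linarith

text \<open>Whitney's inequality on a window of length rho n z containing z, followed by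
  extrapolation. The differences beyond the window are bounded by moduli at a larger argument s, and
  \<open>modsm_scale\<close> makes these grow only polynomially in s / rho n z.\<close>

lemma local_whitney:
  fixes k :: nat
  assumes k: "k \<ge> 1"
  shows "\<exists>C\<ge>1. \<exists>K::nat. \<forall>g n z. continuous_on {-1..1} g \<and> n \<ge> 4
    \<and> z \<in> {-1..1} \<longrightarrow>
    (\<exists>q. degree q \<le> k \<and> (\<forall>x\<in>{-1..1}. \<bar>g x - poly q x\<bar>
      \<le> C * modsm k g (rho n z) {-1..1} * rdist n x z ^ K))"
proof -
  obtain C where C: "C \<ge> 1" and W: "whitney_constant k C" using whitney[of k] by blast
  obtain E where E: "growth_exponent k E" using growth_extension[OF k] by blast
  define C3 where "C3 = 2 * (2 ^ k * C) * 2 ^ E"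
  have "1 * 1 * 1 \<le> 2 * (2 ^ k * C) * 2 ^ E"
    using C mult_mono[of 1 "2 ^ k" 1 C] by (intro mult_mono) auto
  hence C3: "C3 \<ge> 1" by (simp add: C3_def)
  show ?thesis
  proof (rule exI[of _ C3], rule conjI[OF C3], rule exI[of _ E], intro allI impI, elim conjE)
    fix g :: "real \<Rightarrow> real" and n :: nat and z :: real
    assume cont: "continuous_on {-1..1} g" and n: "4 \<le> n" and z: "z \<in> {-1..1}"
    define t where "t = rho n z"
    define M where "M = modsm k g t {-1..1}"
    have t: "t > 0" using rho_pos[of n z] n z by (simp add: t_def)
    have "2 / real n \<le> 2 / 4" using n by (intro divide_left_mono) auto
    hence t1: "t \<le> 1" using rho_le[of n z] n unfolding t_def by linarith
    \<comment> \<open>The window extends from z towards 0, so it fits into [-1, 1] because its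
      length is at most 1.\<close>
    define a where "a = (if z \<le> 0 then z else z - t)"
    have a: "-1 \<le> a" "a + t \<le> 1" "a \<le> z" "z \<le> a + t" using z t t1 by (auto simp: a_def)
    have M: "M \<ge> 0" unfolding M_def by (intro modsm_nonneg cont k t)
    have cont': "continuous_on {a..a + t} g" by (rule continuous_on_subset[OF cont]) (use a in auto)
    have sm: "\<bar>fdiff k h g x\<bar> \<le> M" if "x \<in> {a..a + t}" "x + real k * h \<in> {a..a + t}" for x h
    proof -
      have "\<bar>h\<bar> \<le> real k * \<bar>h\<bar>" using k by (simp add: mult_le_cancel_right1)
      also have "... = \<bar>real k * h\<bar>" by (simp add: abs_mult)
      also have "... \<le> t" using that unfolding atLeastAtMost_iff by linarith
      finally show ?thesis unfolding M_def using that a by (intro modsm_upper cont k t) auto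
    qed
    obtain q where q: "q = 0 \<or> degree q < k" and qb: "\<And>x. x \<in> {a..a + t}
      \<Longrightarrow> \<bar>g x - poly q x\<bar> \<le> C * M"
      using whitney_constantD[OF W _ cont' sm] t by (metis less_add_same_cancel1)
    \<comment> \<open>Each ray starts at one end of the window and crosses it first, so the error is
      already under control on its initial length t.\<close>
    have side: "\<bar>g (y + e * s) - poly q (y + e * s)\<bar> \<le> 2 * (2 ^ k * C * M) * (1 + s / t) ^ E"
      if e: "(e = 1 \<and> y = a) \<or> (e = -1 \<and> y = a + t)" and s: "s \<ge> 0" "y + e * s \<in> {-1..1}" for e s y
    proof -
      define S where "S = s"
      have mem: "y + e * s \<in> {-1..1}" if "s \<in> {0..S}" for s
        using e that s a t unfolding S_def by auto
      show ?thesis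
      proof (rule poly_error_growth[OF E t q cont _ mem])
        show "s \<in> {0..S}" using s by (simp add: S_def)
        show "\<bar>g (y + e * s) - poly q (y + e * s)\<bar> \<le> 2 ^ k * C * M" if "s \<in> {0..S}" "s \<le> t" for s
        proof -
          have "\<bar>g (y + e * s) - poly q (y + e * s)\<bar> \<le> 1 * (C * M)" using qb[of "y + e * s"] that e by auto
          also have "... \<le> 2 ^ k * (C * M)" using C M by (intro mult_right_mono) auto
          finally show ?thesis by (simp add: mult.assoc)
        qed
        show "\<bar>fdiff k (e * (s / real k)) g y\<bar> \<le> 2 ^ k * C * M * (1 + s / t) ^ k" if s: "s \<in> {0..S}" "t \<le> s" for s
        proof -
          have "\<bar>fdiff k (e * (s / real k)) g y\<bar> \<le> modsm k g ((s / t) * t) {-1..1}"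
          proof (rule modsm_upper[OF cont k])
            have "s / real k \<le> s / 1" using s t k by (intro divide_left_mono) auto
            thus "\<bar>e * (s / real k)\<bar> \<le> (s / t) * t" using e s t k by (auto simp: abs_mult)
            show "y \<in> {-1..1}" using e a t by auto
            show "y + real k * (e * (s / real k)) \<in> {-1..1}" using mem[OF s(1)] k by simp
          qed (use s t in auto)
          also have "... \<le> (2 * (s / t)) ^ k * M"
            unfolding M_def using s t by (intro modsm_scale cont k) auto
          also have "... = 2 ^ k * 1 * M * (s / t) ^ k" by (simp add: power_mult_distrib power_divide)
          also have "... \<le> 2 ^ k * C * M * (1 + s / t) ^ k"
            using C M s t by (intro mult_mono power_mono) auto
          finally show ?thesis .
        qed
      qed
    qed
    have "\<bar>g x - poly q x\<bar> \<le> C3 * M * rdist n x z ^ E" if x: "x \<in> {-1..1}" for x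
    proof -
      have "\<exists>s\<ge>0. s \<le> \<bar>x - z\<bar> + t \<and> \<bar>g x - poly q x\<bar> \<le> 2 * (2 ^ k * C * M) * (1 + s / t) ^ E"
      proof (cases "a \<le> x")
        case True
        thus ?thesis using side[of 1 a "x - a"] x a by (intro exI[of _ "x - a"]) auto
      next
        case False
        thus ?thesis using side[of "-1" "a + t" "a + t - x"] x a t by (intro exI[of _ "a + t - x"]) auto
      qed
      then obtain s where s: "s \<ge> 0" "s \<le> \<bar>x - z\<bar> + t"
        and b: "\<bar>g x - poly q x\<bar> \<le> 2 * (2 ^ k * C * M) * (1 + s / t) ^ E" by blast
      have "1 + s / t \<le> 1 + (\<bar>x - z\<bar> + t) / t" using s t by (intro add_mono divide_right_mono) auto
      also have "... \<le> 2 * rdist n x z"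
        using t unfolding rdist_def t_def[symmetric]
        by (simp add: add_divide_distrib) (simp add: divide_right_mono)
      finally have "1 + s / t \<le> 2 * rdist n x z" .
      hence "(1 + s / t) ^ E \<le> (2 * rdist n x z) ^ E" using s t by (intro power_mono) auto
      hence "2 * (2 ^ k * C * M) * (1 + s / t) ^ E \<le> 2 * (2 ^ k * C * M) * (2 * rdist n x z) ^ E"
        using C M by (intro mult_left_mono) auto
      also have "... = C3 * M * rdist n x z ^ E" by (simp add: C3_def power_mult_distrib)
      finally show ?thesis using b by linarith
    qed
    thus "\<exists>q. degree q \<le> k \<and> (\<forall>x\<in>{-1..1}. \<bar>g x - poly q x\<bar>
      \<le> C3 * modsm k g (rho n z) {-1..1} * rdist n x z ^ E)"
      using q unfolding M_def t_def by (intro exI[of _ q]) auto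
  qed
qed

lemma rdist_mono:
  assumes "n \<ge> 1" "z \<in> {-1..1}" "\<bar>y - z\<bar> \<le> \<bar>x - z\<bar>"
  shows "rdist n y z \<le> rdist n x z"
  using assms rho_pos[OF assms(1,2)] by (simp add: rdist_def divide_right_mono)

section \<open>The scale rho and weighted polynomial sums\<close>

text \<open>Squaring removes the root: 1 - x^2 changes by at most 2 |x - y|, and the factor n^(-2)
  in front of that change is bounded by rho n y.\<close>

lemma rho_square_le:
  assumes "n \<ge> 1" "x \<in> {-1..1}" "y \<in> {-1..1}"
  shows "(rho n x)^2 \<le> 4 * rho n y * (rho n y + \<bar>x - y\<bar>)"
proof -
  define a where "a = sqrt (1 - x^2) / real n"
  define b where "b = 1 / (real n)^2"
  define c where "c = sqrt (1 - y^2) / real n"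
  have n: "real n > 0" using assms by simp
  have sq: "x^2 \<le> 1" "y^2 \<le> 1" using assms by (auto simp: abs_square_le_1 abs_le_iff)
  have pos: "a \<ge> 0" "b \<ge> 0" "c \<ge> 0" using sq by (auto simp: a_def b_def c_def)
  have rx: "rho n x = a + b" and ry: "rho n y = c + b" by (auto simp: rho_def a_def b_def c_def)
  have "x^2 - y^2 = (x - y) * (x + y)" by (simp add: power2_eq_square algebra_simps)
  hence "\<bar>x^2 - y^2\<bar> \<le> \<bar>x - y\<bar> * 2"
    using assms by (auto simp: abs_mult abs_le_iff intro!: mult_left_mono)
  hence "1 - x^2 \<le> (1 - y^2) + 2 * \<bar>x - y\<bar>" by linarith
  hence "(1 - x^2) / (real n)^2 \<le> ((1 - y^2) + 2 * \<bar>x - y\<bar>) / (real n)^2" by (intro divide_right_mono) auto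
  hence 1: "a^2 \<le> c^2 + 2 * \<bar>x - y\<bar> * b"
    using sq by (simp add: a_def b_def c_def power_divide add_divide_distrib)
  have "(a + b)^2 \<le> 2 * a^2 + 2 * b^2" using sum_squares_bound[of a b] by (simp add: power2_sum)
  also have "... \<le> 2 * c^2 + 2 * b^2 + 4 * (\<bar>x - y\<bar> * b)" using 1 by simp
  also have "2 * c^2 + 2 * b^2 \<le> 4 * (c + b)^2"
  proof -
    have "0 \<le> c * b" using pos by simp
    thus ?thesis using zero_le_power2[of c] zero_le_power2[of b] by (simp add: power2_sum)
  qed
  also have "4 * (\<bar>x - y\<bar> * b) \<le> 4 * (\<bar>x - y\<bar> * (c + b))" using pos by (intro mult_left_mono) auto
  also have "4 * (c + b)^2 + 4 * (\<bar>x - y\<bar> * (c + b)) = 4 * (c + b) * (c + b + \<bar>x - y\<bar>)"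
    by (simp add: power2_eq_square algebra_simps)
  finally show ?thesis by (simp add: rx ry)
qed

lemma rdist_mult_rho:
  assumes "n \<ge> 1" "z \<in> {-1..1}"
  shows "rdist n x z * rho n z = \<bar>x - z\<bar> + rho n z"
  using rho_pos[OF assms] by (simp add: rdist_def field_simps)

text \<open>Both bounds use the distance centred at y. The first follows from
  \<open>rho_square_le\<close>. For the second, exchange x and y there: if 8 E u < v, each of the
  two resulting terms is below v^2/2, a contradiction.\<close>

lemma rho_le_rdist:
  assumes "n \<ge> 1" "x \<in> {-1..1}" "y \<in> {-1..1}"
  shows "rho n x \<le> 8 * rdist n x y * rho n y" and "rho n y \<le> 8 * rdist n x y * rho n x"
proof -
  define E where "E = rdist n x y"
  define u where "u = rho n x"
  define v where "v = rho n y"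
  have E: "E \<ge> 1" unfolding E_def by (intro rdist_ge_1 assms)
  have uv: "u > 0" "v > 0" unfolding u_def v_def by (intro rho_pos assms)+
  have Ev: "E * v = \<bar>x - y\<bar> + v" unfolding E_def v_def by (rule rdist_mult_rho[OF assms(1,3)])
  have "u^2 \<le> 4 * v * (E * v)"
    using rho_square_le[OF assms] Ev by (simp add: u_def v_def add.commute)
  also have "... \<le> (8 * E * v)^2"
  proof -
    have "4 * v * (E * v) = 4 * (E * 1) * v^2" by (simp add: power2_eq_square)
    also have "... \<le> 64 * (E * E) * v^2" using E by (intro mult_right_mono mult_mono) auto
    finally show ?thesis by (simp add: power2_eq_square mult_ac)
  qed
  finally have "u \<le> 8 * E * v" by (rule power2_le_imp_le) (use E uv in simp)
  thus "rho n x \<le> 8 * rdist n x y * rho n y" by (simp add: E_def u_def v_def)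
  show "rho n y \<le> 8 * rdist n x y * rho n x"
  proof (rule ccontr)
    assume "\<not> rho n y \<le> 8 * rdist n x y * rho n x"
    hence c: "8 * E * u < v" by (simp add: E_def u_def v_def)
    have "8 * 1 * u \<le> 8 * E * u" using E uv by (intro mult_right_mono) auto
    hence u8: "8 * u < v" using c by simp
    have "v^2 \<le> 4 * u * (u + \<bar>x - y\<bar>)"
      using rho_square_le[OF assms(1,3,2)] by (simp add: u_def v_def abs_minus_commute)
    also have "... \<le> 4 * u * (u + E * v)" using Ev uv by (intro mult_left_mono) auto
    also have "... = u * (4 * u) + (4 * E * u) * v" by (simp add: algebra_simps)
    also have "... < v * (v / 2) + (v / 2) * v"
      using c u8 uv by (intro add_less_le_mono mult_strict_mono mult_right_mono) auto
    also have "... = v^2" by (simp add: power2_eq_square)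
    finally show False by simp
  qed
qed

text \<open>The size of the error aimed at, with g in the role of the r-th derivative.\<close>

definition jscale :: "nat \<Rightarrow> nat \<Rightarrow> (real \<Rightarrow> real) \<Rightarrow> nat
  \<Rightarrow> real \<Rightarrow> real" where
  "jscale k r g n x = rho n x ^ r * modsm k g (rho n x) {-1..1}"

lemma jscale_nonneg:
  assumes "continuous_on {-1..1} g" "k \<ge> 1" "n \<ge> 1" "x \<in> {-1..1}"
  shows "0 \<le> jscale k r g n x"
  unfolding jscale_def using rho_pos[OF assms(3,4)] modsm_nonneg[OF assms(1,2)] by simp

lemma jscale_le:
  assumes "continuous_on {-1..1} g" "k \<ge> 1" "n \<ge> 1" "x \<in> {-1..1}" "y \<in> {-1..1}"
    and "c \<ge> 1" "rho n y \<le> c * rho n x"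
  shows "jscale k r g n y \<le> (2 * c) ^ (r + k) * jscale k r g n x"
proof -
  have p: "rho n x > 0" "rho n y > 0" using rho_pos assms by auto
  have m: "0 \<le> modsm k g (rho n x) {-1..1}" "0 \<le> modsm k g (rho n y) {-1..1}"
    by (intro modsm_nonneg assms p)+
  have "modsm k g (rho n y) {-1..1} \<le> modsm k g (c * rho n x) {-1..1}"
    by (intro modsm_mono assms p)
  also have "... \<le> (2 * c) ^ k * modsm k g (rho n x) {-1..1}" by (intro modsm_scale assms p)
  finally have 1: "modsm k g (rho n y) {-1..1} \<le> (2 * c) ^ k * modsm k g (rho n x) {-1..1}" .
  have "rho n y \<le> (2 * c) * rho n x" using assms(6,7) p by (simp add: mult_ac)
  hence "rho n y ^ r \<le> ((2 * c) * rho n x) ^ r" using p by (intro power_mono) auto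
  hence "jscale k r g n y \<le> ((2 * c) * rho n x) ^ r * ((2 * c) ^ k * modsm k g (rho n x) {-1..1})"
    unfolding jscale_def using 1 p m assms(6) by (intro mult_mono) auto
  thus ?thesis by (simp add: jscale_def power_mult_distrib power_add mult_ac)
qed

text \<open>The target size varies so slowly that evaluating it at another point costs only a power
  of \<open>rdist\<close>. Both directions are needed, as the weight of the correction is bounded
  above and below.\<close>

lemma jscale_slow:
  assumes "continuous_on {-1..1} g" "k \<ge> 1" "n \<ge> 1" "x \<in> {-1..1}" "y \<in> {-1..1}"
  shows "jscale k r g n y \<le> (16 * rdist n x y) ^ (r + k) * jscale k r g n x"
    and "jscale k r g n x \<le> (16 * rdist n x y) ^ (r + k) * jscale k r g n y"
proof -
  have E: "8 * rdist n x y \<ge> 1" using rdist_ge_1[OF assms(3,5), of x] by simp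
  show "jscale k r g n y \<le> (16 * rdist n x y) ^ (r + k) * jscale k r g n x"
    using jscale_le[OF assms E rho_le_rdist(2)[OF assms(3-5)]] by simp
  show "jscale k r g n x \<le> (16 * rdist n x y) ^ (r + k) * jscale k r g n y"
    using jscale_le[OF assms(1-3,5,4) E rho_le_rdist(1)[OF assms(3-5)]] by simp
qed

text \<open>Within a factor 2 this is min (1, |x - z| / rho n z). The quotient form makes a product
  of such factors exactly the modulus of a product of x - z divided by a positive, slowly varying
  function.\<close>

definition cdist :: "nat \<Rightarrow> real \<Rightarrow> real \<Rightarrow> real" where
  "cdist n x z = \<bar>x - z\<bar> / (\<bar>x - z\<bar> + rho n z)"

lemma cdist_bounds:
  assumes "n \<ge> 1" "z \<in> {-1..1}"
  shows "0 \<le> cdist n x z" "cdist n x z \<le> 1"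
  using rho_pos[OF assms] by (auto simp: cdist_def divide_le_eq)

lemma cdist_mult:
  assumes "n \<ge> 1" "z \<in> {-1..1}"
  shows "\<bar>x - z\<bar> = cdist n x z * (rdist n x z * rho n z)"
  unfolding rdist_mult_rho[OF assms] cdist_def using rho_pos[OF assms]
  by (simp add: add_nonneg_eq_0_iff)

text \<open>Integrate the approximation of the r-th derivative r times with the derivatives of f at
  z as constants. Taylor's formula at z then has no polynomial part, which leaves a factor |x -
  z|^r; by \<open>cdist_mult\<close> it yields both \<open>cdist\<close> to the power r and the
  missing rho^r.\<close>

lemma local_polynomial:
  fixes k r :: nat
  assumes k: "k \<ge> 1" and r: "r \<ge> 1"
  shows "\<exists>C\<ge>1. \<exists>K::nat. \<forall>f F n z. Cr_derivs r f F \<and> n \<ge> 4 \<and> z \<in> {-1..1} \<longrightarrow>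
    (\<exists>p. degree p \<le> k + r \<and> (\<forall>x\<in>{-1..1}. \<bar>f x - poly p x\<bar>
       \<le> C * rdist n x z ^ K * cdist n x z ^ r * jscale k r (F r) n x))"
    (is "\<exists>C\<ge>1. \<exists>K. \<forall>f F n z. ?hyp f F n z \<longrightarrow> ?approx C K f F n z")
proof -
  obtain C K where C: "C \<ge> 1" and W: "\<And>g n z. \<lbrakk>continuous_on {-1..1} g; n \<ge> 4; z \<in> {-1..1}\<rbrakk> \<Longrightarrow>
    \<exists>q. degree q \<le> k \<and> (\<forall>x\<in>{-1..1}. \<bar>g x - poly q x\<bar>
      \<le> C * modsm k g (rho n z) {-1..1} * rdist n x z ^ K)"
    using local_whitney[OF k] by metis
  have "1 * 1 \<le> C * 16 ^ (r + k)" using C by (intro mult_mono) auto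
  hence C': "C * 16 ^ (r + k) \<ge> 1" by simp
  show ?thesis
  \<comment> \<open>Exponents: K from the r-th derivative, r from |x - z|^r, and r + k for moving
    the target size from z to x.\<close>
  proof (rule exI[of _ "C * 16 ^ (r + k)"], rule conjI[OF C'], rule exI[of _ "K + r + (r + k)"], intro allI impI, elim conjE)
    fix f F and n :: nat and z :: real
    assume F: "Cr_derivs r f F" and n: "4 \<le> n" and z: "z \<in> {-1..1}"
    have n1: "n \<ge> 1" using n by simp
    have cont: "continuous_on {-1..1} (F r)" using F by (simp add: Cr_derivs_def)
    define M where "M = modsm k (F r) (rho n z) {-1..1}"
    have M: "M \<ge> 0" unfolding M_def by (intro modsm_nonneg cont k rho_pos n1 z)
    obtain q where q: "degree q \<le> k" "\<And>x. x \<in> {-1..1}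
      \<Longrightarrow> \<bar>F r x - poly q x\<bar> \<le> C * M * rdist n x z ^ K"
      using W[OF cont n z] unfolding M_def by blast
    obtain p where p: "(pderiv ^^ r) p = q" "\<And>i. i < r \<Longrightarrow> poly ((pderiv ^^ i) p) z = F i z" "degree p
      \<le> degree q + r"
      using poly_prescribed_derivatives[of r q z "\<lambda>i. F i z"] by blast
    have "\<bar>f x - poly p x\<bar>
      \<le> C * 16 ^ (r + k) * rdist n x z ^ (K + r + (r + k)) * cdist n x z ^ r * jscale k r (F r) n x"
      if x: "x \<in> {-1..1}" for x
    proof -
      define S where "S = closed_segment z x"
      have SI: "S \<subseteq> {-1..1}"
        unfolding S_def using z x by (intro closed_segment_subset) auto
      define G where "G i y = F i y - poly ((pderiv ^^ i) p) y" for i y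
      define B where "B = C * M * rdist n x z ^ K"
      have B: "B \<ge> 0" unfolding B_def using C M rdist_nonneg[OF n1 z] by simp
      have r': "Suc (r - 1) = r" using r by simp
      have "norm (G 0 x - (\<Sum>i\<le>r - 1. G i z * (x - z) ^ i / fact i)) \<le> B * norm (x - z) ^ Suc (r - 1) / fact (r - 1)"
      proof (rule field_Taylor)
        show "convex S" by (simp add: S_def)
        show "z \<in> S" "x \<in> S" by (auto simp: S_def)
        fix y assume y: "y \<in> S"
        show "(G i has_real_derivative G (Suc i) y) (at y within S)" if "i \<le> r - 1" for i
        proof -
          have "i < r" using that r by simp
          hence "(F i has_real_derivative F (Suc i) y) (at y within {-1..1})"
            using F y SI by (auto simp: Cr_derivs_def)
          hence "(F i has_real_derivative F (Suc i) y) (at y within S)"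
            by (rule DERIV_subset) (rule SI)
          moreover have "(poly ((pderiv ^^ i) p) has_real_derivative poly ((pderiv ^^ Suc i) p) y) (at y within S)"
            using has_field_derivative_at_within[OF poly_DERIV] by simp
          ultimately show ?thesis unfolding G_def by (intro derivative_intros)
        qed
        have "\<bar>y - z\<bar> \<le> \<bar>x - z\<bar>" using y unfolding S_def by (auto simp: closed_segment_eq_real_ivl split: if_splits)
        hence "rdist n y z ^ K \<le> rdist n x z ^ K"
          by (intro power_mono rdist_mono n1 z rdist_nonneg)
        hence "C * M * rdist n y z ^ K \<le> B"
          unfolding B_def using C M by (intro mult_left_mono) auto
        thus "norm (G (Suc (r - 1)) y) \<le> B"
          using q(2)[of y] y SI unfolding r' G_def p(1) by auto
      qed
      moreover have "(\<Sum>i\<le>r - 1. G i z * (x - z) ^ i / fact i) = 0"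
        using p(2) r by (intro sum.neutral) (auto simp: G_def)
      moreover have "B * \<bar>x - z\<bar> ^ r / fact (r - 1) \<le> B * \<bar>x - z\<bar> ^ r / 1"
        using B by (intro divide_left_mono) auto
      ultimately have "\<bar>G 0 x\<bar> \<le> B * \<bar>x - z\<bar> ^ r" unfolding r' by simp
      moreover have "F 0 x = f x" using F x by (simp add: Cr_derivs_def)
      ultimately have b: "\<bar>f x - poly p x\<bar> \<le> B * \<bar>x - z\<bar> ^ r" by (simp add: G_def)
      define E where "E = rdist n x z"
      have E: "E \<ge> 1" unfolding E_def by (intro rdist_ge_1 n1 z)
      have "B * \<bar>x - z\<bar> ^ r = C * E ^ (K + r) * cdist n x z ^ r * jscale k r (F r) n z"
        unfolding cdist_mult[OF n1 z, of x] jscale_def E_def B_def M_def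
        by (simp add: power_mult_distrib power_add mult_ac)
      also have "... \<le> C * E ^ (K + r) * cdist n x z ^ r * ((16 * E) ^ (r + k) * jscale k r (F r) n x)"
        using jscale_slow(1)[OF cont k n1 x z, of r] C E cdist_bounds[OF n1 z, of x]
        by (intro mult_left_mono) (auto simp: E_def)
      also have "... = C * 16 ^ (r + k) * E ^ (K + r + (r + k)) * cdist n x z ^ r * jscale k r (F r) n x"
        by (simp only: power_mult_distrib power_add mult_ac)
      finally show ?thesis using b unfolding E_def by linarith
    qed
    thus "?approx (C * 16 ^ (r + k)) (K + r + (r + k)) f F n z"
      using p(3) q(1) by (intro exI[of _ p]) auto
  qed
qed

text \<open>A weight that varies slowly is comparable with its average over the partition. The upper
  bound is the weighted sum itself. The lower one averages 2 <= e/C + C/e, which shows that the mean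
  of 1/e is at least 1/C, a form of Jensen's inequality.\<close>

lemma partition_weight_bounds:
  fixes m :: nat
  assumes "\<And>j. j < m \<Longrightarrow> 0 \<le> \<tau> j" "\<And>j. j < m \<Longrightarrow> (0::real) < e j"
    and "(\<Sum>j<m. \<tau> j) = 1" "(\<Sum>j<m. \<tau> j * e j) \<le> C" "C > 0" "A > 0" "u \<ge> 0"
    and "\<And>j. j < m \<Longrightarrow> w j \<le> A * e j * u" "\<And>j. j < m \<Longrightarrow> u \<le> A * e j * w j"
  shows "(\<Sum>j<m. \<tau> j * w j) \<le> A * C * u" "u \<le> A * C * (\<Sum>j<m. \<tau> j * w j)"
proof -
  have "(\<Sum>j<m. \<tau> j * w j) \<le> (\<Sum>j<m. \<tau> j * (A * e j * u))"
    using assms by (intro sum_mono mult_left_mono) auto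
  also have "... = A * u * (\<Sum>j<m. \<tau> j * e j)" by (simp add: sum_distrib_left mult_ac)
  also have "... \<le> A * u * C" using assms by (intro mult_left_mono) auto
  finally show "(\<Sum>j<m. \<tau> j * w j) \<le> A * C * u" by (simp add: mult_ac)
  have "\<tau> j * 2 \<le> \<tau> j * (e j / C + C / e j)" if "j < m" for j
  proof (intro mult_left_mono assms(1)[OF that])
    have e: "e j > 0" using assms(2)[OF that] .
    have "0 \<le> (e j - C)^2" by simp
    hence "2 * (e j * C) \<le> e j * e j + C * C" by (simp add: power2_eq_square algebra_simps)
    thus "2 \<le> e j / C + C / e j" using e assms(5) by (simp add: field_simps)
  qed
  hence "(\<Sum>j<m. \<tau> j * 2) \<le> (\<Sum>j<m. \<tau> j * (e j / C + C / e j))" by (intro sum_mono) auto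
  also have "... = (\<Sum>j<m. \<tau> j * e j) / C + C * (\<Sum>j<m. \<tau> j / e j)"
    by (simp add: sum_divide_distrib sum_distrib_left sum.distrib[symmetric] distrib_left mult_ac)
  also have "(\<Sum>j<m. \<tau> j * e j) / C \<le> 1" using assms(4,5) by simp
  finally have 1: "1 \<le> C * (\<Sum>j<m. \<tau> j / e j)"
    using assms(3) by (simp add: sum_distrib_right[symmetric])
  have "u = 1 * u" by simp
  also have "... \<le> C * (\<Sum>j<m. \<tau> j / e j) * u" using 1 assms by (intro mult_right_mono) auto
  also have "... = C * (\<Sum>j<m. \<tau> j * (u / e j))" by (simp add: sum_distrib_left sum_distrib_right mult_ac)
  also have "... \<le> C * (\<Sum>j<m. \<tau> j * (A * w j))"
  proof (intro mult_left_mono sum_mono)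
    fix j assume "j \<in> {..<m}"
    hence j: "j < m" by simp
    show "u / e j \<le> A * w j" using assms(9)[OF j] assms(2)[OF j] by (simp add: pos_divide_le_eq mult_ac)
  qed (use assms in auto)
  also have "... = A * C * (\<Sum>j<m. \<tau> j * w j)" by (simp add: sum_distrib_left mult_ac)
  finally show "u \<le> A * C * (\<Sum>j<m. \<tau> j * w j)" .
qed

lemma power_prod_le:
  fixes c :: real
  assumes "finite Z" "c \<ge> 1" "card Z \<le> S" "\<And>z. z \<in> Z \<Longrightarrow> e z \<le> r"
    and "\<And>z. z \<in> Z \<Longrightarrow> 0 \<le> a z" "\<And>z. z \<in> Z
      \<Longrightarrow> 0 \<le> b z" "\<And>z. z \<in> Z \<Longrightarrow> a z \<le> c * b z"
  shows "(\<Prod>z\<in>Z. a z ^ e z) \<le> c ^ (r * S) * (\<Prod>z\<in>Z. b z ^ e z)"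
proof -
  have "(\<Prod>z\<in>Z. a z ^ e z) \<le> (\<Prod>z\<in>Z. c ^ r * b z ^ e z)"
  proof (intro prod_mono conjI)
    fix z assume z: "z \<in> Z"
    show "0 \<le> a z ^ e z" using assms(5)[OF z] by simp
    have "a z ^ e z \<le> (c * b z) ^ e z" using assms z by (intro power_mono) auto
    also have "... = c ^ e z * b z ^ e z" by (simp add: power_mult_distrib)
    also have "... \<le> c ^ r * b z ^ e z"
      using assms z by (intro mult_right_mono power_increasing) auto
    finally show "a z ^ e z \<le> c ^ r * b z ^ e z" .
  qed
  also have "... = c ^ (r * card Z) * (\<Prod>z\<in>Z. b z ^ e z)"
    by (simp add: prod.distrib power_mult)
  also have "... \<le> c ^ (r * S) * (\<Prod>z\<in>Z. b z ^ e z)"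
    using assms by (intro mult_right_mono power_increasing prod_nonneg) auto
  finally show ?thesis .
qed

text \<open>The product of the \<open>cdist\<close> powers is |product of (x - z)^(e z)| divided by
  T, so the target is met if B imitates w = \<psi> / T. As w varies slowly, the combination of the
  partition with coefficients w (y j) is comparable with w on both sides, and its positivity is
  automatic.\<close>

lemma correction_polynomial:
  fixes k r S :: nat
  assumes k: "k \<ge> 1"
  shows "\<exists>C\<ge>1. \<exists>n0. \<forall>g n Z e. continuous_on {-1..1} g \<and> n \<ge> n0 \<and> finite Z
    \<and> Z \<subseteq> {-1..1} \<and>
    card Z \<le> S \<and> (\<forall>z\<in>Z. e z \<le> r) \<longrightarrow>
    (\<exists>B. degree ((\<Prod>z\<in>Z. [:-z, 1:] ^ e z) * B) \<le> n \<and> (\<forall>x\<in>{-1..1}. 0 \<le> poly B x \<and>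
       \<bar>\<Prod>z\<in>Z. (x - z) ^ e z\<bar> * poly B x \<le> C * ((\<Prod>z\<in>Z. cdist n x z ^ e z) * jscale k r g n x) \<and>
       (\<Prod>z\<in>Z. cdist n x z ^ e z) * jscale k r g n x \<le> C * (\<bar>\<Prod>z\<in>Z. (x - z) ^ e z\<bar> * poly B x)))"
    (is "\<exists>C\<ge>1. \<exists>n0. \<forall>g n Z e. ?hyp n0 g n Z e \<longrightarrow> ?approx C g n Z e")
proof -
  \<comment> \<open>r + k pays for the variation of \<psi>, and 2 r S for at most S factors of T
    with exponents at most r, each varying by 65 \<open>rdist\<close>^2.\<close>
  define K where "K = r + k + 2 * (r * S)"
  define A where "A = (16::real) ^ (r + k) * 65 ^ (r * S)"
  have "1 * 1 \<le> A" unfolding A_def by (intro mult_mono) auto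
  hence A: "A \<ge> 1" by simp
  obtain C where C: "C \<ge> 1" and P: "\<And>n. n \<ge> 1 \<Longrightarrow> \<exists>m \<tau> y. poly_partition 2 K C n m \<tau> y"
    using polynomial_partition[of 2 K] by auto
  have "1 * 1 \<le> A * C" using A C by (intro mult_mono) auto
  hence AC: "A * C \<ge> 1" by simp
  show ?thesis
  proof (rule exI[of _ "A * C"], rule conjI[OF AC], rule exI[of _ "2 * (r * S) + 1"], intro allI impI, elim conjE)
    fix g :: "real \<Rightarrow> real" and n :: nat and Z :: "real set" and e :: "real \<Rightarrow> nat"
    assume cont: "continuous_on {-1..1} g" and n: "2 * (r * S) + 1 \<le> n" and fin: "finite Z" and Z: "Z \<subseteq> {-1..1}"
      and card: "card Z \<le> S" and e: "\<forall>z\<in>Z. e z \<le> r"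
    have n1: "n \<ge> 1" using n by simp
    obtain m \<tau> y where pp: "poly_partition 2 K C n m \<tau> y" using P[OF n1] by blast
    note \<tau> = poly_partitionD(1-3)[OF pp] and sum1 = poly_partitionD(4)[OF pp] and sumK = poly_partitionD(5)[OF pp]
    define \<psi> where "\<psi> = jscale k r g n"
    define T where "T x = (\<Prod>z\<in>Z. (\<bar>x - z\<bar> + rho n z) ^ e z)" for x
    define w where "w x = \<psi> x / T x" for x
    have rp: "rho n z > 0" if "z \<in> Z" for z using rho_pos[OF n1] that Z by auto
    have T: "T x > 0" for x unfolding T_def using rp by (intro prod_pos ballI zero_less_power add_nonneg_pos) auto
    have \<psi>: "\<psi> x \<ge> 0" if "x \<in> {-1..1}" for x unfolding \<psi>_def by (intro jscale_nonneg cont k n1 that)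
    have Tle: "T x \<le> (65 * (rdist n x y)^2) ^ (r * S) * T y \<and> T y \<le> (65 * (rdist n x y)^2) ^ (r * S) * T x"
      if xy: "x \<in> {-1..1}" "y \<in> {-1..1}" for x y
    proof -
      define E where "E = rdist n x y"
      have E: "E \<ge> 1" unfolding E_def by (intro rdist_ge_1 n1 xy)
      have E2: "E \<le> E^2" "E^2 \<ge> 1" using E self_le_power[of E 2] one_le_power[of E 2] by auto
      \<comment> \<open>65 covers 1 + 8 E in one direction and 1 + 64 E^2 in the other; the latter
        applies \<open>rho_le_rdist\<close> twice, as the scale at y must first be compared with the
        one at x.\<close>
      have z1: "\<bar>x - z\<bar> + rho n z \<le> (65 * E^2) * (\<bar>y - z\<bar> + rho n z)
           \<and> \<bar>y - z\<bar> + rho n z \<le> (65 * E^2) * (\<bar>x - z\<bar> + rho n z)" if z: "z \<in> Z" for z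
      proof -
        have zI: "z \<in> {-1..1}" using z Z by auto
        define a where "a = \<bar>x - z\<bar> + rho n z"
        define b where "b = \<bar>y - z\<bar> + rho n z"
        have ab: "a > 0" "b > 0" using rp[OF z] by (auto simp: a_def b_def)
        have ea: "a = rdist n x z * rho n z" and eb: "b = rdist n y z * rho n z"
          using rdist_mult_rho[OF n1 zI] by (auto simp: a_def b_def)
        have ry: "rho n y \<le> 8 * b" using rho_le_rdist(1)[OF n1 xy(2) zI] by (simp add: eb mult_ac)
        have rx: "rho n x \<le> 8 * a" using rho_le_rdist(1)[OF n1 xy(1) zI] by (simp add: ea mult_ac)
        have d: "\<bar>x - y\<bar> \<le> E * rho n y"
          using rdist_mult_rho[OF n1 xy(2), of x] rho_pos[OF n1 xy(2)] by (simp add: E_def)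
        have "a \<le> b + \<bar>x - y\<bar>" by (simp add: a_def b_def)
        also have "... \<le> 1 * b + E * (8 * b)" using d ry E by (smt (verit) mult_left_mono)
        also have "... = (1 + 8 * E) * b" by (simp add: algebra_simps)
        also have "... \<le> (65 * E^2) * b" using E E2 ab by (intro mult_right_mono) auto
        finally have 1: "a \<le> (65 * E^2) * b" .
        have "rho n y \<le> 8 * E * rho n x"
          using rho_le_rdist(2)[OF n1 xy] by (simp add: E_def)
        also have "... \<le> 8 * E * (8 * a)" using rx E by (intro mult_left_mono) auto
        finally have "E * rho n y \<le> E * (64 * E * a)" using E by (intro mult_left_mono) auto
        hence "b \<le> a + 64 * E^2 * a" using d unfolding a_def b_def by (simp add: power2_eq_square mult_ac)
        also have "... = (1 + 64 * E^2) * a" by (simp add: algebra_simps)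
        also have "... \<le> (65 * E^2) * a" using E2 ab by (intro mult_right_mono) auto
        finally show ?thesis using 1 by (simp add: a_def b_def)
      qed
      have c1: "65 * E^2 \<ge> 1" using E2 by simp
      have nn: "0 \<le> \<bar>a - z\<bar> + rho n z" if "z \<in> Z" for a z using rp[OF that] by simp
      show ?thesis
        unfolding T_def E_def[symmetric] using z1 e
        by (intro conjI power_prod_le fin c1 card nn) auto
    qed
    have wslow: "w y \<le> A * rdist n x y ^ K * w x \<and> w x \<le> A * rdist n x y ^ K * w y"
      if xy: "x \<in> {-1..1}" "y \<in> {-1..1}" for x y
    proof -
      define E where "E = rdist n x y"
      define Q where "Q = (65 * E^2) ^ (r * S)"
      have AQ: "(16 * E) ^ (r + k) * Q = A * E ^ K"
        by (simp add: Q_def A_def K_def power_mult_distrib power_add power_mult)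
      have w: "\<psi> a / T a \<le> A * E ^ K * (\<psi> b / T b)"
        if h: "\<psi> a \<le> (16 * E) ^ (r + k) * \<psi> b" "T b \<le> Q * T a" "0 \<le> \<psi> a" for a b
      proof -
        have "\<psi> a * T b \<le> ((16 * E) ^ (r + k) * \<psi> b) * (Q * T a)"
          using h T[of b] by (intro mult_mono) auto
        also have "... = (A * E ^ K * \<psi> b) * T a" by (simp add: AQ[symmetric] mult_ac)
        finally show ?thesis using T[of a] T[of b] by (simp add: field_simps)
      qed
      show ?thesis
        unfolding w_def E_def[symmetric]
        using jscale_slow[OF cont k n1 xy, of r] Tle[OF xy] \<psi> xy
        by (intro conjI w) (auto simp: \<psi>_def E_def Q_def)
    qed
    define B where "B = (\<Sum>j<m. smult (w (y j)) (\<tau> j))"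
    have pB: "poly B x = (\<Sum>j<m. poly (\<tau> j) x * w (y j))" for x
      by (simp add: B_def poly_sum mult.commute)
    have wnn: "w x \<ge> 0" if "x \<in> {-1..1}" for x using \<psi>[OF that] T[of x] by (simp add: w_def)
    have degB: "2 * degree B \<le> n"
    proof -
      have "degree B \<le> n div 2"
        unfolding B_def
      proof (intro degree_sum_le finite_lessThan)
        fix j assume "j \<in> {..<m}"
        hence "2 * degree (\<tau> j) \<le> n" using \<tau>(1) by simp
        thus "degree (smult (w (y j)) (\<tau> j)) \<le> n div 2"
          using degree_smult_le[of "w (y j)" "\<tau> j"] by linarith
      qed
      thus ?thesis by simp
    qed
    have degP: "degree (\<Prod>z\<in>Z. [:-z, 1:] ^ e z) \<le> r * S"
    proof -
      have "degree (\<Prod>z\<in>Z. [:-z, 1:] ^ e z) \<le> (\<Sum>z\<in>Z. degree ([:-z, 1:] ^ e z))"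
        by (rule degree_prod_sum_le[OF fin, unfolded comp_def])
      also have "... \<le> (\<Sum>z\<in>Z. r)"
        using e by (intro sum_mono) (auto simp: degree_linear_power)
      also have "... \<le> r * S" using card by simp
      finally show ?thesis .
    qed
    show "?approx (A * C) g n Z e"
    proof (intro exI[of _ B] conjI ballI)
      show "degree ((\<Prod>z\<in>Z. [:-z, 1:] ^ e z) * B) \<le> n"
        using degree_mult_le[of "\<Prod>z\<in>Z. [:-z, 1:] ^ e z" B] degP degB n by linarith
      fix x :: real assume x: "x \<in> {-1..1}"
      show "0 \<le> poly B x" unfolding pB using \<tau>(2,3) wnn x by (intro sum_nonneg) auto
      have Epos: "0 < rdist n x (y j) ^ K" if "j < m" for j
        using rdist_ge_1[OF n1 \<tau>(2)[OF that], of x] by simp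
      have B1: "poly B x \<le> A * C * w x" and B2: "w x \<le> A * C * poly B x"
        unfolding pB
        by (rule partition_weight_bounds[where e = "\<lambda>j. rdist n x (y j) ^ K"];
            use \<tau>(2,3) x sum1[OF x] sumK[OF x] C A wnn[OF x] wslow[OF x] Epos in auto)+
      define Q where "Q = \<bar>\<Prod>z\<in>Z. (x - z) ^ e z\<bar>"
      have near_eq: "(\<Prod>z\<in>Z. cdist n x z ^ e z) * jscale k r g n x = Q * w x"
      proof -
        have "(\<Prod>z\<in>Z. cdist n x z ^ e z) = Q / T x"
          unfolding cdist_def Q_def T_def
          by (simp add: power_divide prod_dividef power_abs abs_prod)
        thus ?thesis by (simp add: w_def \<psi>_def)
      qed
      have Q: "Q \<ge> 0" by (simp add: Q_def)
      show "\<bar>\<Prod>z\<in>Z. (x - z) ^ e z\<bar> * poly B x \<le> A * C * ((\<Prod>z\<in>Z. cdist n x z ^ e z) * jscale k r g n x)"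
        using mult_left_mono[OF B1 Q] unfolding near_eq Q_def[symmetric] by (simp add: mult_ac)
      show "(\<Prod>z\<in>Z. cdist n x z ^ e z) * jscale k r g n x \<le> A * C * (\<bar>\<Prod>z\<in>Z. (x - z) ^ e z\<bar> * poly B x)"
        using mult_left_mono[OF B2 Q] unfolding near_eq Q_def[symmetric] by (simp add: mult_ac)
    qed
  qed
qed

section \<open>Localised Hermite interpolation\<close>

lemma one_plus_power_diff_le:
  fixes t :: real
  assumes "t \<ge> 0"
  shows "(1 + t) ^ S - 1 \<le> real S * t * (1 + t) ^ S"
proof (induction S)
  case (Suc S)
  have "(1 + t) ^ Suc S - 1 = (1 + t) * ((1 + t) ^ S - 1) + t * 1" by (simp add: algebra_simps)
  also have "... \<le> (1 + t) * (real S * t * (1 + t) ^ S) + t * (1 + t) ^ Suc S"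
    using Suc assms by (intro add_mono mult_left_mono one_le_power) auto
  also have "... = real (Suc S) * t * (1 + t) ^ Suc S" by (simp add: algebra_simps)
  finally show ?case .
qed simp

lemma abs_prod_diff_one_le:
  fixes a :: "'a \<Rightarrow> real"
  assumes "finite A" "\<And>z. z \<in> A \<Longrightarrow> \<bar>a z - 1\<bar> \<le> t" "t \<ge> 0"
  shows "\<bar>prod a A - 1\<bar> \<le> (1 + t) ^ card A - 1"
  using assms(1,2)
proof (induction A rule: finite_induct)
  case (insert z A)
  define P where "P = prod a A"
  have IH: "\<bar>P - 1\<bar> \<le> (1 + t) ^ card A - 1" unfolding P_def using insert by auto
  have "\<bar>a z * P - 1\<bar> = \<bar>(a z - 1) * P + (P - 1)\<bar>" by (simp add: algebra_simps)
  also have "... \<le> \<bar>a z - 1\<bar> * \<bar>P\<bar> + \<bar>P - 1\<bar>" by (metis abs_mult abs_triangle_ineq)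
  also have "... \<le> t * (1 + t) ^ card A + ((1 + t) ^ card A - 1)"
    using insert.prems IH assms(3) by (intro add_mono mult_mono) auto
  finally show ?case using insert.hyps by (simp add: P_def algebra_simps)
qed simp

lemma abs_one_minus_power_le:
  fixes w B :: real
  assumes "\<bar>w\<bar> \<le> B" "B \<ge> 1"
  shows "\<bar>1 - w ^ r\<bar> \<le> \<bar>1 - w\<bar> * (real r * B ^ r)"
proof -
  have "\<bar>\<Sum>i<r. w ^ i\<bar> \<le> (\<Sum>i<r. B ^ r)"
  proof (rule order_trans[OF sum_abs], rule sum_mono)
    fix i assume "i \<in> {..<r}"
    hence "B ^ i \<le> B ^ r" using assms by (intro power_increasing) auto
    moreover have "\<bar>w\<bar> ^ i \<le> B ^ i" using assms by (intro power_mono) auto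
    ultimately show "\<bar>w ^ i\<bar> \<le> B ^ r" by (simp add: power_abs)
  qed
  thus ?thesis unfolding one_diff_power_eq abs_mult by (intro mult_left_mono) auto
qed

text \<open>Since rho is at most 2/n, the distance 4/n makes the scale at each point at most half of
  the gap to any other.\<close>

definition separated :: "nat \<Rightarrow> nat \<Rightarrow> real set \<Rightarrow> bool" where
  "separated n S Z \<longleftrightarrow> finite Z \<and> Z \<subseteq> {-1..1} \<and> card Z \<le> S \<and>
    (\<forall>z\<in>Z. \<forall>z'\<in>Z. z \<noteq> z' \<longrightarrow> 4 / real n \<le> \<bar>z - z'\<bar>)"

lemma separatedD:
  assumes "separated n S Z"
  shows "finite Z" "Z \<subseteq> {-1..1}" "card Z \<le> S"
    "z \<in> Z \<Longrightarrow> z' \<in> Z \<Longrightarrow> z \<noteq> z' \<Longrightarrow> 4 / real n \<le> \<bar>z - z'\<bar>"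
  using assms unfolding separated_def by blast+

text \<open>A bump at z is multiplied by the Lagrange factor G, which is 1 at z and 0 at the other
  points. Separation bounds G by \<open>rdist\<close>^S, absorbed by S extra powers of decay of the
  bump; one more power is spent on exhibiting the zero at z'.\<close>

lemma cutoff_polynomial:
  fixes K q S :: nat
  assumes q: "q \<ge> 1"
  shows "\<exists>C\<ge>1. \<forall>n Z z. n \<ge> 1 \<and> separated n S Z \<and> z \<in> Z \<longrightarrow>
    (\<exists>L. q * degree L \<le> n + q * S \<and> (\<forall>x\<in>{-1..1}. \<bar>poly L x\<bar> * rdist n x z ^ K \<le> C \<and>
      \<bar>1 - poly L x\<bar> \<le> C * cdist n x z \<and>
      (\<forall>z'\<in>Z. z' \<noteq> z \<longrightarrow> \<bar>poly L x\<bar> * rdist n x z ^ K \<le> C * cdist n x z')))"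
    (is "\<exists>C\<ge>1. \<forall>n Z z. ?hyp n Z z \<longrightarrow> (\<exists>L. ?cutoff C n Z z L)")
proof -
  obtain C where C: "C \<ge> 1" and L0: "\<And>n z. \<lbrakk>n \<ge> 1; z \<in> {-1..1}\<rbrakk>
    \<Longrightarrow> \<exists>L. q * degree L \<le> n \<and> poly L z = 1 \<and>
    (\<forall>x\<in>{-1..1}. \<bar>poly L x\<bar> * rdist n x z ^ (K + S + 1) \<le> C
      \<and> \<bar>1 - poly L x\<bar> \<le> C * (\<bar>x - z\<bar> / rho n z))"
    using localized_polynomial[OF q, of "K + S + 1"] by metis
  define D where "D = 2 * (C + real S + 1) * 2 ^ S"
  have DC: "2 * (C + real S + 1) * 1 \<le> D" unfolding D_def using C by (intro mult_left_mono) auto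
  hence D: "D \<ge> 1" "C \<le> D" "2 * C \<le> D" "2 * (1 + C) \<le> D" using C by auto
  show ?thesis
  proof (rule exI[of _ D], rule conjI[OF D(1)], intro allI impI, elim conjE)
    fix n :: nat and Z :: "real set" and z :: real
    assume n: "1 \<le> n" and sep: "separated n S Z" and z: "z \<in> Z"
    note fin = separatedD(1)[OF sep] and Z = separatedD(2)[OF sep] and card = separatedD(3)[OF sep]
    have zI: "z \<in> {-1..1}" using z Z by auto
    obtain L where L: "q * degree L \<le> n" "\<And>x. x \<in> {-1..1}
      \<Longrightarrow> \<bar>poly L x\<bar> * rdist n x z ^ (K + S + 1) \<le> C"
      "\<And>x. x \<in> {-1..1} \<Longrightarrow> \<bar>1 - poly L x\<bar> \<le> C * (\<bar>x - z\<bar> / rho n z)"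
      using L0[OF n zI] by blast
    define a where "a x z' = (x - z') / (z - z')" for x z'
    define G where "G = (\<Prod>z'\<in>Z - {z}. smult (1 / (z - z')) [:-z', 1:])"
    have pG: "poly G x = (\<Prod>z'\<in>Z - {z}. a x z')" for x
      unfolding G_def a_def poly_prod by (intro prod.cong) (auto simp: diff_divide_distrib)
    have degG: "degree G \<le> S"
    proof -
      have "degree G \<le> (\<Sum>z'\<in>Z - {z}. degree (smult (1 / (z - z')) [:-z', 1:]))"
        unfolding G_def by (rule degree_prod_sum_le[unfolded comp_def]) (use fin in simp)
      also have "... \<le> (\<Sum>z'\<in>Z - {z}. 1)" by (intro sum_mono) (auto intro: order_trans[OF degree_smult_le])
      also have "... \<le> card Z" using fin by (simp add: card_Diff_subset_Int)
      finally show ?thesis using card by simp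
    qed
    have dist: "rho n z \<le> \<bar>z - z'\<bar>" "rho n z' \<le> \<bar>z - z'\<bar>" "\<bar>z - z'\<bar> > 0" if "z' \<in> Z - {z}" for z'
    proof -
      have "4 / real n \<le> \<bar>z - z'\<bar>" using separatedD(4)[OF sep z, of z'] that by auto
      moreover have "2 / real n \<le> 4 / real n" by (intro divide_right_mono) auto
      ultimately show "rho n z \<le> \<bar>z - z'\<bar>" "rho n z' \<le> \<bar>z - z'\<bar>"
        using rho_le[OF n, of z] rho_le[OF n, of z'] by linarith+
      show "\<bar>z - z'\<bar> > 0" using that by auto
    qed
    have cardZ: "card (Z - A) \<le> S" for A using card_mono[OF fin, of "Z - A"] card by auto
    have degLG: "q * degree (L * G) \<le> n + q * S"
    proof -
      have "q * degree (L * G) \<le> q * (degree L + S)"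
        using degree_mult_le[of L G] degG by (intro mult_left_mono) auto
      thus ?thesis using L(1) by (simp add: distrib_left)
    qed
    have "\<bar>poly (L * G) x\<bar> * rdist n x z ^ K \<le> D \<and> \<bar>1 - poly (L * G) x\<bar> \<le> D * cdist n x z \<and>
      (\<forall>z'\<in>Z. z' \<noteq> z \<longrightarrow> \<bar>poly (L * G) x\<bar> * rdist n x z ^ K
        \<le> D * cdist n x z')" if x: "x \<in> {-1..1}" for x
    proof -
      define E where "E = rdist n x z"
      define u where "u = \<bar>x - z\<bar> / rho n z"
      have r0: "rho n z > 0" by (intro rho_pos n zI)
      have u: "u \<ge> 0" using r0 by (simp add: u_def)
      have E: "E = 1 + u" by (simp add: E_def rdist_def u_def)
      have nearE: "cdist n x z * E = u"
        using cdist_mult[OF n zI, of x] r0 by (simp add: E_def u_def field_simps)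
      have a1: "\<bar>a x z' - 1\<bar> \<le> u" if z': "z' \<in> Z - {z}" for z'
      proof -
        have "a x z' - 1 = (x - z) / (z - z')" using dist(3)[OF z'] by (simp add: a_def field_simps)
        hence "\<bar>a x z' - 1\<bar> = \<bar>x - z\<bar> / \<bar>z - z'\<bar>" by simp
        also have "... \<le> u" unfolding u_def using dist[OF z'] r0 by (intro divide_left_mono) auto
        finally show ?thesis .
      qed
      have prod_le: "\<bar>\<Prod>z'\<in>A. a x z'\<bar> \<le> E ^ S" if A: "A \<subseteq> Z - {z}" for A
      proof -
        have "\<bar>\<Prod>z'\<in>A. a x z'\<bar> \<le> (\<Prod>z'\<in>A. E)"
          unfolding abs_prod using a1 A by (intro prod_mono) (force simp: E)
        also have "... = E ^ card A" by simp
        also have "... \<le> E ^ S"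
        proof (rule power_increasing)
          have "card A \<le> card Z" using A by (intro card_mono fin) auto
          thus "card A \<le> S" using card by simp
        qed (use u E in simp)
        finally show ?thesis .
      qed
      have G_le: "\<bar>poly G x\<bar> \<le> E ^ S" unfolding pG by (rule prod_le) simp
      have E1: "E \<ge> 1" using u by (simp add: E)
      have EK: "E ^ K \<ge> 0" using E1 by simp
      have 1: "\<bar>poly (L * G) x\<bar> * E ^ K \<le> C"
      proof -
        have "\<bar>poly (L * G) x\<bar> * E ^ K = \<bar>poly L x\<bar> * (\<bar>poly G x\<bar> * E ^ K)" by (simp add: abs_mult)
        also have "... \<le> \<bar>poly L x\<bar> * (E ^ S * E ^ K)"
          using G_le EK by (intro mult_left_mono mult_right_mono) auto
        also have "... \<le> \<bar>poly L x\<bar> * E ^ (K + S + 1)"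
          unfolding power_add[symmetric] using E1 by (intro mult_left_mono power_increasing) auto
        finally show ?thesis using L(2)[OF x] by (simp add: E_def)
      qed
      have "\<bar>poly (L * G) x\<bar> * E ^ K \<le> 2 * C * cdist n x z'" if z': "z' \<in> Z" "z' \<noteq> z" for z'
      proof -
        have z'2: "z' \<in> Z - {z}" and z'I: "z' \<in> {-1..1}" using z' Z by auto
        note d = dist[OF z'2]
        have nz: "cdist n x z' \<ge> 0" by (intro cdist_bounds n z'I)
        \<comment> \<open>The factor with the zero at z' yields \<open>cdist n x z'\<close> times at
          most 2 E, because |x - z'| + rho n z' <= |x - z| + 2 |z - z'| and |z - z'| >= rho n
          z.\<close>
        have "\<bar>a x z'\<bar> = \<bar>x - z'\<bar> / \<bar>z - z'\<bar>" by (simp add: a_def)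
        also have "\<bar>x - z'\<bar> = cdist n x z' * (\<bar>x - z'\<bar> + rho n z')"
          using cdist_mult[OF n z'I, of x] rdist_mult_rho[OF n z'I, of x] by simp
        also have "cdist n x z' * (\<bar>x - z'\<bar> + rho n z') / \<bar>z - z'\<bar>
            \<le> cdist n x z' * (\<bar>x - z\<bar> + 2 * \<bar>z - z'\<bar>) / \<bar>z - z'\<bar>"
          using nz d(2) abs_triangle_ineq[of "x - z" "z - z'"]
          by (intro divide_right_mono mult_left_mono) auto
        also have "... = cdist n x z' * (\<bar>x - z\<bar> / \<bar>z - z'\<bar> + 2)"
          using d(3) by (simp add: field_simps)
        also have "... \<le> cdist n x z' * (u + 2)"
          unfolding u_def using nz d r0 by (intro mult_left_mono add_right_mono divide_left_mono) auto
        also have "... \<le> cdist n x z' * (2 * E)" using nz u by (intro mult_left_mono) (auto simp: E)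
        finally have ax: "\<bar>a x z'\<bar> \<le> cdist n x z' * (2 * E)" .
        have "poly G x = a x z' * (\<Prod>z'\<in>Z - {z} - {z'}. a x z')"
          unfolding pG using fin z'2 by (intro prod.remove) auto
        hence "\<bar>poly G x\<bar> \<le> cdist n x z' * (2 * E) * E ^ S"
          unfolding abs_mult using ax prod_le[of "Z - {z} - {z'}"] nz E1 by (auto intro!: mult_mono simp: abs_mult)
        hence "\<bar>poly (L * G) x\<bar> * E ^ K \<le> \<bar>poly L x\<bar> * (cdist n x z' * (2 * E) * E ^ S) * E ^ K"
          using EK by (auto simp: abs_mult intro!: mult_left_mono mult_right_mono)
        also have "... = 2 * cdist n x z' * (\<bar>poly L x\<bar> * E ^ (K + S + 1))"
          by (simp add: power_add mult_ac)
        also have "... \<le> 2 * cdist n x z' * C"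
          using L(2)[OF x] nz by (intro mult_left_mono) (auto simp: E_def)
        finally show ?thesis by (simp add: mult_ac)
      qed
      moreover have "2 * C * cdist n x z' \<le> D * cdist n x z'" if "z' \<in> Z" for z'
        using D cdist_bounds(1)[OF n] that Z by (intro mult_right_mono) auto
      ultimately have 2: "\<forall>z'\<in>Z. z' \<noteq> z \<longrightarrow> \<bar>poly (L * G) x\<bar> * E ^ K \<le> D * cdist n x z'"
        by (meson order_trans)
      have nz: "cdist n x z \<ge> 0" by (intro cdist_bounds n zI)
      have 3: "\<bar>1 - poly (L * G) x\<bar> \<le> D * cdist n x z"
      \<comment> \<open>Near z both the bump and G differ from 1 by a multiple of |x - z| / rho n z.
        Far from z, \<open>cdist n x z\<close> is at least 1/2 and boundedness of the cutoff is
        enough.\<close>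
      proof (cases "E \<le> 2")
        case True
        have ES: "E ^ S \<le> 2 ^ S" using True E1 by (intro power_mono) auto
        have "\<bar>poly G x - 1\<bar> \<le> (1 + u) ^ card (Z - {z}) - 1"
          unfolding pG using fin a1 u by (intro abs_prod_diff_one_le) auto
        also have "... \<le> (1 + u) ^ S - 1" using u cardZ by (auto intro: power_increasing)
        also have "... \<le> real S * u * (1 + u) ^ S" by (rule one_plus_power_diff_le[OF u])
        also have "... \<le> real S * u * 2 ^ S" using ES u by (intro mult_left_mono) (auto simp: E)
        finally have g: "\<bar>poly G x - 1\<bar> \<le> real S * u * 2 ^ S" .
        have l: "\<bar>1 - poly L x\<bar> * \<bar>poly G x\<bar> \<le> (C * u) * 2 ^ S"
          using L(3)[OF x] order_trans[OF G_le ES] C u by (intro mult_mono) (auto simp: u_def)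
        have "1 - poly (L * G) x = (1 - poly L x) * poly G x - (poly G x - 1)" by (simp add: algebra_simps)
        hence "\<bar>1 - poly (L * G) x\<bar> \<le> \<bar>1 - poly L x\<bar> * \<bar>poly G x\<bar> + \<bar>poly G x - 1\<bar>"
          by (metis abs_mult abs_triangle_ineq4)
        also have "... \<le> (C + real S) * 2 ^ S * u" using g l by (simp add: algebra_simps)
        also have "... = (C + real S) * 2 ^ S * (cdist n x z * E)" by (simp only: nearE)
        also have "... \<le> (C + real S) * 2 ^ S * (cdist n x z * 2)"
          using True nz C by (intro mult_left_mono) auto
        also have "... = (2 * (C + real S) * 2 ^ S) * cdist n x z" by simp
        also have "... \<le> D * cdist n x z" unfolding D_def using nz by (intro mult_right_mono) auto
        finally show ?thesis .
      next
        case False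
        have "1 / 2 \<le> cdist n x z"
        proof (rule ccontr)
          assume "\<not> 1 / 2 \<le> cdist n x z"
          hence "cdist n x z * E \<le> 1 / 2 * E" using E1 by (intro mult_right_mono) auto
          thus False using nearE E False by linarith
        qed
        have "\<bar>poly (L * G) x\<bar> * 1 \<le> \<bar>poly (L * G) x\<bar> * E ^ K"
          using E1 by (intro mult_left_mono one_le_power) auto
        hence LG: "\<bar>poly (L * G) x\<bar> \<le> C" using 1 by (simp only: mult_1_right)
        have "\<bar>1 - poly (L * G) x\<bar> \<le> \<bar>1\<bar> + \<bar>poly (L * G) x\<bar>" by (rule abs_triangle_ineq4)
        also have "... \<le> (1 + C) * 1" using LG by (simp only: mult_1_right abs_one add_left_mono)
        also have "... \<le> (1 + C) * (2 * cdist n x z)"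
          using \<open>1 / 2 \<le> _\<close> C by (intro mult_left_mono) auto
        also have "... = (2 * (1 + C)) * cdist n x z" by simp
        also have "... \<le> D * cdist n x z" using D nz by (intro mult_right_mono) auto
        finally show ?thesis .
      qed
      show ?thesis using 1 2 3 D(2) by (simp add: E_def)
    qed
    thus "\<exists>L. ?cutoff D n Z z L"
      using degLG by blast
  qed
qed

text \<open>f - P = (1 - sum of V) (f - Q) + sum of V z' (f - p z'). Fix any z. The first factor has
  order r at z since V z is close to 1 and the other cutoffs are small there. In the sum, the term
  z' = z owes its order to p z, the other terms to V z'. Hence one P satisfies the bound for every z
  simultaneously.\<close>

lemma hermite_approximation:
  fixes k r S :: nat
  assumes k: "k \<ge> 1" and r: "r \<ge> 1"
  shows "\<exists>C\<ge>1. \<exists>n0. \<forall>f F n Z. Cr_derivs r f F \<and> n \<ge> n0 \<and> separated n S Z \<longrightarrow>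
    (\<exists>P. degree P \<le> n \<and> (\<forall>x\<in>{-1..1}. \<forall>z\<in>Z. \<bar>f x - poly P x\<bar>
      \<le> C * cdist n x z ^ r * jscale k r (F r) n x))"
    (is "\<exists>C\<ge>1. \<exists>n0. \<forall>f F n Z. ?hyp n0 f F n Z \<longrightarrow> ?approx C f F n Z")
proof -
  obtain C2 K where C2: "C2 \<ge> 1" and loc: "\<And>f F n z. \<lbrakk>Cr_derivs r f F; n \<ge> 4; z \<in> {-1..1}\<rbrakk> \<Longrightarrow>
    \<exists>p. degree p \<le> k + r \<and> (\<forall>x\<in>{-1..1}. \<bar>f x - poly p x\<bar>
       \<le> C2 * rdist n x z ^ K * cdist n x z ^ r * jscale k r (F r) n x)"
    using local_polynomial[OF k r] by metis
  obtain C3 where C3: "C3 \<ge> 1" and part: "\<And>n. n \<ge> 1 \<Longrightarrow> \<exists>m h y. poly_partition 2 K C3 n m h y"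
    using polynomial_partition[of 2 K] by auto
  \<comment> \<open>V z has degree at most r^2 times that of L z, so this keeps V within a quarter
    of the degree budget, besides the half used by Q.\<close>
  define q where "q = 4 * (r * r)"
  have q: "q \<ge> 1" using r by (simp add: q_def)
  obtain C4 where C4: "C4 \<ge> 1" and cut: "\<And>n Z z. \<lbrakk>n \<ge> 1; separated n S Z; z \<in> Z\<rbrakk> \<Longrightarrow>
    \<exists>L. q * degree L \<le> n + q * S \<and> (\<forall>x\<in>{-1..1}. \<bar>poly L x\<bar> * rdist n x z ^ K \<le> C4 \<and>
      \<bar>1 - poly L x\<bar> \<le> C4 * cdist n x z \<and>
      (\<forall>z'\<in>Z. z' \<noteq> z \<longrightarrow> \<bar>poly L x\<bar> * rdist n x z ^ K \<le> C4 * cdist n x z'))"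
    using cutoff_polynomial[OF q, of S K] by metis
  define Cv where "Cv = real r * (1 + C4 ^ r) ^ r"
  define Cw where "Cw = (real r * C4 ^ r * C4) ^ r"
  define C where "C = (Cw + real S * (Cv * C4 ^ r)) * (C2 * C3) + real S * (Cv * C4 ^ r * C2) + 1"
  have C4r: "C4 ^ r \<ge> 1" using C4 by simp
  have Cv: "Cv \<ge> 0" "Cw \<ge> 0" using C4 by (auto simp: Cv_def Cw_def)
  have C: "C \<ge> 1" using Cv C2 C3 C4 by (simp add: C_def)
  show ?thesis
  proof (rule exI[of _ C], rule conjI[OF C], rule exI[of _ "4 * (r * r * S + k + r + 4)"], intro allI impI, elim conjE)
    fix f F and n :: nat and Z :: "real set"
    assume F: "Cr_derivs r f F" and n: "4 * (r * r * S + k + r + 4) \<le> n"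
      and sep: "separated n S Z"
    note fin = separatedD(1)[OF sep] and Z = separatedD(2)[OF sep] and card = separatedD(3)[OF sep]
    have n1: "n \<ge> 1" and n4: "n \<ge> 4" using n by auto
    define T where "T = r * r * S"
    have "4 * (T + k + r + 4) \<le> n" using n by (simp add: T_def)
    hence nT: "T + k + r \<le> n div 4" by presburger
    have n24: "n div 2 + n div 4 + n div 4 \<le> n" by presburger
    have cont: "continuous_on {-1..1} (F r)" using F by (simp add: Cr_derivs_def)
    define w where "w = jscale k r (F r) n"
    have w: "w x \<ge> 0" if "x \<in> {-1..1}" for x unfolding w_def by (intro jscale_nonneg cont k n1 that)
    obtain p where p: "\<And>z. z \<in> {-1..1} \<Longrightarrow> degree (p z) \<le> k + r"
      "\<And>z x. z \<in> {-1..1} \<Longrightarrow> x \<in> {-1..1}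
        \<Longrightarrow> \<bar>f x - poly (p z) x\<bar> \<le> C2 * rdist n x z ^ K * cdist n x z ^ r * w x"
      using loc[OF F n4] unfolding w_def by metis
    obtain m h y where pp: "poly_partition 2 K C3 n m h y" using part[OF n1] by blast
    note h = poly_partitionD(1-3)[OF pp] and sum1 = poly_partitionD(4)[OF pp] and sumK = poly_partitionD(5)[OF pp]
    have "\<forall>z\<in>Z. \<exists>L. q * degree L \<le> n + q * S
      \<and> (\<forall>x\<in>{-1..1}. \<bar>poly L x\<bar> * rdist n x z ^ K \<le> C4 \<and>
      \<bar>1 - poly L x\<bar> \<le> C4 * cdist n x z \<and>
      (\<forall>z'\<in>Z. z' \<noteq> z \<longrightarrow> \<bar>poly L x\<bar> * rdist n x z ^ K \<le> C4 * cdist n x z'))"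
      using cut[OF n1 sep] by blast
    from bchoice[OF this] obtain L where L0: "\<forall>z\<in>Z. q * degree (L z) \<le> n + q * S
      \<and> (\<forall>x\<in>{-1..1}. \<bar>poly (L z) x\<bar> * rdist n x z ^ K \<le> C4 \<and>
      \<bar>1 - poly (L z) x\<bar> \<le> C4 * cdist n x z \<and>
      (\<forall>z'\<in>Z. z' \<noteq> z \<longrightarrow> \<bar>poly (L z) x\<bar> * rdist n x z ^ K \<le> C4 * cdist n x z'))" ..
    have L: "\<And>z. z \<in> Z \<Longrightarrow> q * degree (L z) \<le> n + q * S"
      "\<And>z x. z \<in> Z \<Longrightarrow> x \<in> {-1..1} \<Longrightarrow> \<bar>poly (L z) x\<bar> * rdist n x z ^ K \<le> C4"
      "\<And>z x. z \<in> Z \<Longrightarrow> x \<in> {-1..1} \<Longrightarrow> \<bar>1 - poly (L z) x\<bar> \<le> C4 * cdist n x z"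
      "\<And>z x z'. z \<in> Z \<Longrightarrow> x \<in> {-1..1} \<Longrightarrow> z' \<in> Z
        \<Longrightarrow> z' \<noteq> z \<Longrightarrow> \<bar>poly (L z) x\<bar> * rdist n x z ^ K \<le> C4 * cdist n x z'"
      using L0 by blast+
    define Q where "Q = (\<Sum>j<m. p (y j) * h j)"
    define V where "V z = 1 - (1 - L z ^ r) ^ r" for z
      \<comment> \<open>raises the contact of \<open>L z\<close> with 1 at \<open>z\<close> and with 0 on the rest of \<open>Z\<close> to order \<open>r\<close>\<close>
    define P where "P = Q + (\<Sum>z\<in>Z. V z * (p z - Q))"
    have degQ: "degree Q \<le> n div 2 + k + r"
      unfolding Q_def
    proof (intro degree_sum_le finite_lessThan)
      fix j assume "j \<in> {..<m}"
      thus "degree (p (y j) * h j) \<le> n div 2 + k + r"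
        using degree_mult_le[of "p (y j)" "h j"] p(1)[OF h(2), of j] h(1)[of j] by auto
    qed
    have degV: "degree (V z) \<le> n div 4 + r * r * S" if z: "z \<in> Z" for z
    proof -
      have "degree (L z ^ r) \<le> degree (L z) * r" by (rule degree_power_le)
      hence "degree (1 - L z ^ r) \<le> degree (L z) * r" by (intro degree_diff_le) auto
      hence "degree ((1 - L z ^ r) ^ r) \<le> (degree (L z) * r) * r"
        using degree_power_le[of "1 - L z ^ r" r] by (meson mult_le_mono1 order_trans)
      hence "degree (V z) \<le> (degree (L z) * r) * r" unfolding V_def by (intro degree_diff_le) auto
      moreover have "4 * ((degree (L z) * r) * r) \<le> n + 4 * (r * r * S)"
        using L(1)[OF z] by (simp add: q_def mult_ac)
      ultimately show ?thesis by linarith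
    qed
    have degP: "degree P \<le> n"
      unfolding P_def
    proof (intro degree_add_le degree_sum_le fin)
      show "degree Q \<le> n" using degQ nT n24 by linarith
      fix z assume z: "z \<in> Z"
      have "degree (p z - Q) \<le> n div 2 + k + r"
        using p(1)[of z] z Z degQ by (intro degree_diff_le) auto
      thus "degree (V z * (p z - Q)) \<le> n"
        using degree_mult_le[of "V z" "p z - Q"] degV[OF z] nT n24
        unfolding T_def by linarith
    qed
    have "\<bar>f x - poly P x\<bar> \<le> C * cdist n x z ^ r * w x" if x: "x \<in> {-1..1}" and z: "z \<in> Z" for x z
    proof -
      define ll where "ll = cdist n x z"
      have zI: "z \<in> {-1..1}" using z Z by auto
      have ll: "ll \<ge> 0" "ll \<le> 1" unfolding ll_def using cdist_bounds[OF n1 zI] by auto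
      have E1: "rdist n x z' ^ K \<ge> 1" if "z' \<in> {-1..1}" for z'
        using rdist_ge_1[OF n1 that] by simp
      have fQ: "\<bar>f x - poly Q x\<bar> \<le> C2 * C3 * w x"
      proof -
        have "f x - poly Q x = (\<Sum>j<m. (f x - poly (p (y j)) x) * poly (h j) x)"
          by (simp add: Q_def poly_sum left_diff_distrib sum_subtractf sum_distrib_left[symmetric] sum1[OF x])
        also have "\<bar>...\<bar> \<le> (\<Sum>j<m. C2 * w x * (poly (h j) x * rdist n x (y j) ^ K))"
        proof (rule order_trans[OF sum_abs], rule sum_mono)
          fix j assume "j \<in> {..<m}"
          hence j: "j < m" by simp
          note y = h(2)[OF j]
          have "\<bar>f x - poly (p (y j)) x\<bar> \<le> C2 * rdist n x (y j) ^ K * cdist n x (y j) ^ r * w x"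
            by (rule p(2)[OF y x])
          also have "... \<le> C2 * rdist n x (y j) ^ K * 1 * w x"
            using C2 E1[OF y] w[OF x] cdist_bounds[OF n1 y]
            by (intro mult_left_mono mult_right_mono power_le_one) auto
          finally have "\<bar>f x - poly (p (y j)) x\<bar> * poly (h j) x \<le> C2 * rdist n x (y j) ^ K * 1 * w x * poly (h j) x"
            using h(3)[OF j x] by (intro mult_right_mono) auto
          thus "\<bar>(f x - poly (p (y j)) x) * poly (h j) x\<bar> \<le> C2 * w x * (poly (h j) x * rdist n x (y j) ^ K)"
            using h(3)[OF j x] by (simp add: abs_mult mult_ac)
        qed
        also have "... = C2 * w x * (\<Sum>j<m. poly (h j) x * rdist n x (y j) ^ K)" by (simp add: sum_distrib_left)
        also have "... \<le> C2 * w x * C3" using sumK[OF x] C2 w[OF x] by (intro mult_left_mono) auto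
        finally show ?thesis by (simp add: mult_ac)
      qed
      have Labs: "\<bar>poly (L z') x\<bar> \<le> C4" if "z' \<in> Z" for z'
      proof -
        have "\<bar>poly (L z') x\<bar> * 1 \<le> \<bar>poly (L z') x\<bar> * rdist n x z' ^ K"
          using E1[of z'] that Z by (intro mult_left_mono) auto
        thus ?thesis using L(2)[OF that x] by simp
      qed
      have Vabs: "\<bar>poly (V z') x\<bar> \<le> Cv * \<bar>poly (L z') x\<bar> ^ r" if z': "z' \<in> Z" for z'
      proof -
        define u where "u = poly (L z') x ^ r"
        have "\<bar>u\<bar> \<le> C4 ^ r" unfolding u_def power_abs[symmetric] using Labs[OF z'] by (simp add: power_abs power_mono)
        hence "\<bar>1 - u\<bar> \<le> 1 + C4 ^ r" by linarith
        hence "\<bar>1 - (1 - u) ^ r\<bar> \<le> \<bar>1 - (1 - u)\<bar> * (real r * (1 + C4 ^ r) ^ r)"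
          using C4r by (intro abs_one_minus_power_le) auto
        thus ?thesis by (simp add: V_def u_def Cv_def power_abs mult.commute)
      qed
      have V1: "\<bar>1 - poly (V z) x\<bar> \<le> Cw * ll ^ r"
      proof -
        have "\<bar>1 - poly (L z) x ^ r\<bar> \<le> \<bar>1 - poly (L z) x\<bar> * (real r * C4 ^ r)"
          using Labs[OF z] C4 by (intro abs_one_minus_power_le)
        also have "... \<le> (C4 * ll) * (real r * C4 ^ r)"
          using L(3)[OF z x] C4 unfolding ll_def by (intro mult_right_mono) auto
        finally have "\<bar>1 - poly (L z) x ^ r\<bar> ^ r \<le> ((C4 * ll) * (real r * C4 ^ r)) ^ r"
          by (intro power_mono) auto
        thus ?thesis by (simp add: V_def Cw_def power_abs power_mult_distrib mult_ac)
      qed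
      have V2: "\<bar>poly (V z') x\<bar> * rdist n x z' ^ K \<le> Cv * C4 ^ r * ll ^ r" if z': "z' \<in> Z" "z' \<noteq> z" for z'
      proof -
        have z'I: "z' \<in> {-1..1}" using z' Z by auto
        \<comment> \<open>V z' is bounded by the r-th power of L z'. Raising the weight, which is at
          least 1, to the power r as well allows the weighted bound for L z' to be used r
          times.\<close>
        have "\<bar>poly (V z') x\<bar> * rdist n x z' ^ K \<le> Cv * \<bar>poly (L z') x\<bar> ^ r * (rdist n x z' ^ K) ^ r"
          using Vabs[OF z'(1)] E1[OF z'I] Cv r by (intro mult_mono self_le_power) auto
        also have "... = Cv * (\<bar>poly (L z') x\<bar> * rdist n x z' ^ K) ^ r" by (simp add: power_mult_distrib)
        also have "... \<le> Cv * (C4 * ll) ^ r"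
          unfolding ll_def using L(4)[OF z'(1) x z] z'(2) E1[OF z'I] Cv
          by (intro mult_left_mono power_mono) auto
        finally show ?thesis by (simp add: power_mult_distrib)
      qed
      have V3: "\<bar>poly (V z) x\<bar> * rdist n x z ^ K \<le> Cv * C4 ^ r"
      proof -
        have "\<bar>poly (V z) x\<bar> * rdist n x z ^ K \<le> Cv * \<bar>poly (L z) x\<bar> ^ r * (rdist n x z ^ K) ^ r"
          using Vabs[OF z] E1[OF zI] Cv r by (intro mult_mono self_le_power) auto
        also have "... = Cv * (\<bar>poly (L z) x\<bar> * rdist n x z ^ K) ^ r" by (simp add: power_mult_distrib)
        also have "... \<le> Cv * C4 ^ r"
          using L(2)[OF z x] E1[OF zI] Cv by (intro mult_left_mono power_mono) auto
        finally show ?thesis .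
      qed
      have Vp: "\<bar>poly (V z') x * (f x - poly (p z') x)\<bar> \<le> Cv * C4 ^ r * C2 * (ll ^ r * w x)" if z': "z' \<in> Z" for z'
      proof -
        have z'I: "z' \<in> {-1..1}" using z' Z by auto
        have "\<bar>poly (V z') x * (f x - poly (p z') x)\<bar>
          \<le> \<bar>poly (V z') x\<bar> * (C2 * rdist n x z' ^ K * cdist n x z' ^ r * w x)"
          unfolding abs_mult using p(2)[OF z'I x] by (intro mult_left_mono) auto
        also have "... = (\<bar>poly (V z') x\<bar> * rdist n x z' ^ K * cdist n x z' ^ r) * (C2 * w x)"
          by (simp add: mult_ac)
        also have "... \<le> (Cv * C4 ^ r * ll ^ r) * (C2 * w x)"
        proof (intro mult_right_mono)
          show "\<bar>poly (V z') x\<bar> * rdist n x z' ^ K * cdist n x z' ^ r \<le> Cv * C4 ^ r * ll ^ r"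
          proof (cases "z' = z")
            case True
            thus ?thesis using V3 ll by (auto simp: ll_def intro!: mult_right_mono)
          next
            case False
            have "\<bar>poly (V z') x\<bar> * rdist n x z' ^ K * cdist n x z' ^ r \<le> \<bar>poly (V z') x\<bar> * rdist n x z' ^ K * 1"
              using cdist_bounds[OF n1 z'I, of x] E1[OF z'I] by (intro mult_left_mono power_le_one) auto
            thus ?thesis using V2[OF z' False] by simp
          qed
        qed (use C2 w[OF x] in auto)
        finally show ?thesis by (simp add: mult_ac)
      qed
      have W: "\<bar>1 - (\<Sum>z'\<in>Z. poly (V z') x)\<bar> \<le> (Cw + real S * (Cv * C4 ^ r)) * ll ^ r"
      proof -
        have "(\<Sum>z'\<in>Z. poly (V z') x) = poly (V z) x + (\<Sum>z'\<in>Z - {z}. poly (V z') x)"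
          using fin z by (rule sum.remove)
        moreover have "\<bar>\<Sum>z'\<in>Z - {z}. poly (V z') x\<bar> \<le> (\<Sum>z'\<in>Z - {z}. Cv * C4 ^ r * ll ^ r)"
        proof (rule order_trans[OF sum_abs], rule sum_mono)
          fix z' assume z': "z' \<in> Z - {z}"
          have "\<bar>poly (V z') x\<bar> * 1 \<le> \<bar>poly (V z') x\<bar> * rdist n x z' ^ K"
            using E1[of z'] z' Z by (intro mult_left_mono) auto
          thus "\<bar>poly (V z') x\<bar> \<le> Cv * C4 ^ r * ll ^ r" using V2[of z'] z' by auto
        qed
        moreover have "(\<Sum>z'\<in>Z - {z}. Cv * C4 ^ r * ll ^ r) \<le> real S * (Cv * C4 ^ r * ll ^ r)"
        proof -
          have "card (Z - {z}) \<le> S" using card_mono[OF fin, of "Z - {z}"] card by auto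
          hence "real (card (Z - {z})) \<le> real S" by simp
          thus ?thesis using Cv C4 ll by (auto intro!: mult_right_mono)
        qed
        ultimately have "\<bar>1 - (\<Sum>z'\<in>Z. poly (V z') x)\<bar> \<le> Cw * ll ^ r + real S * (Cv * C4 ^ r * ll ^ r)"
          using V1 by linarith
        thus ?thesis by (simp add: algebra_simps)
      qed
      have "f x - poly P x = (1 - (\<Sum>z'\<in>Z. poly (V z') x)) * (f x - poly Q x) + (\<Sum>z'\<in>Z. poly (V z') x * (f x - poly (p z') x))"
        by (simp add: P_def poly_sum algebra_simps sum_distrib_left sum.distrib sum_subtractf)
      also have "\<bar>...\<bar> \<le> (Cw + real S * (Cv * C4 ^ r)) * ll ^ r * (C2 * C3 * w x) + real S * (Cv * C4 ^ r * C2 * (ll ^ r * w x))"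
      proof (rule order_trans[OF abs_triangle_ineq], rule add_mono)
        show "\<bar>(1 - (\<Sum>z'\<in>Z. poly (V z') x)) * (f x - poly Q x)\<bar>
          \<le> (Cw + real S * (Cv * C4 ^ r)) * ll ^ r * (C2 * C3 * w x)"
          unfolding abs_mult using W fQ by (intro mult_mono) (auto intro: order_trans[OF abs_ge_zero])
        have "\<bar>\<Sum>z'\<in>Z. poly (V z') x * (f x - poly (p z') x)\<bar> \<le> (\<Sum>z'\<in>Z. Cv * C4 ^ r * C2 * (ll ^ r * w x))"
          by (rule order_trans[OF sum_abs], rule sum_mono) (rule Vp)
        also have "... = real (card Z) * (Cv * C4 ^ r * C2 * (ll ^ r * w x))" by simp
        also have "... \<le> real S * (Cv * C4 ^ r * C2 * (ll ^ r * w x))"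
          using card Cv C4 C2 ll w[OF x] by (intro mult_right_mono) auto
        finally show "\<bar>\<Sum>z'\<in>Z. poly (V z') x * (f x - poly (p z') x)\<bar>
          \<le> real S * (Cv * C4 ^ r * C2 * (ll ^ r * w x))" .
      qed
      also have "... = (C - 1) * (ll ^ r * w x)" by (simp add: C_def algebra_simps)
      also have "... \<le> C * (ll ^ r * w x)" using ll w[OF x] by (intro mult_right_mono) auto
      finally show ?thesis by (simp add: ll_def mult.assoc)
    qed
    thus "?approx C f F n Z"
      using degP unfolding w_def by blast
  qed
qed

section \<open>One-sided approximation\<close>

text \<open>If all lower derivatives agree at z, Taylor's formula reduces f - P to the i-th term
  plus O(|x - z|^(i+1)), while e > i makes f - P itself that small. Divide by |x - z|^i and let x
  tend to z. D may depend on n and f, so the bound need not be uniform.\<close>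

lemma hermite_from_bound:
  assumes F: "Cr_derivs r f F" and z: "z \<in> {-1..1}" and e: "e \<le> r"
    and bound: "\<And>x. x \<in> {-1..1} \<Longrightarrow> \<bar>f x - poly P x\<bar> \<le> D * \<bar>x - z\<bar> ^ e"
  shows "i < e \<Longrightarrow> poly ((pderiv ^^ i) P) z = F i z"
proof (induction i rule: less_induct)
  case (less i)
  define G where "G j y = F j y - poly ((pderiv ^^ j) P) y" for j y
  have ir: "i < r" using less.prems e by simp
  have deriv: "(G j has_real_derivative G (Suc j) y) (at y within {-1..1})" if "j < r" "y \<in> {-1..1}" for j y
  proof -
    have "(F j has_real_derivative F (Suc j) y) (at y within {-1..1})"
      using F that by (auto simp: Cr_derivs_def)
    moreover have "(poly ((pderiv ^^ j) P) has_real_derivative poly ((pderiv ^^ Suc j) P) y) (at y within {-1..1})"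
      using has_field_derivative_at_within[OF poly_DERIV] by simp
    ultimately show ?thesis unfolding G_def by (intro derivative_intros)
  qed
  have contF: "continuous_on {-1..1} (F (Suc i))"
  proof (cases "Suc i = r")
    case True
    thus ?thesis using F by (simp add: Cr_derivs_def)
  next
    case False
    hence "Suc i < r" using ir by simp
    hence "\<And>x. x \<in> {-1..1} \<Longrightarrow> (F (Suc i) has_real_derivative F (Suc (Suc i)) x) (at x within {-1..1})"
      using F by (auto simp: Cr_derivs_def)
    thus ?thesis by (rule DERIV_continuous_on)
  qed
  have "continuous_on {-1..1} (G (Suc i))"
    unfolding G_def by (intro continuous_intros contF)
  then obtain B where B: "\<And>y. y \<in> {-1..1} \<Longrightarrow> \<bar>G (Suc i) y\<bar> \<le> B"
    using bounded_on_interval by blast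
  have B0: "B \<ge> 0" using B[of 0] by simp
  define M where "M = \<bar>D\<bar> * 2 ^ e + B"
  have M: "M \<ge> 0" using B0 by (simp add: M_def)
  have near: "\<bar>G i z\<bar> \<le> fact i * M * \<bar>x - z\<bar>" if x: "x \<in> {-1..1}" "x \<noteq> z" for x
  proof -
    have "norm (G 0 x - (\<Sum>j\<le>i. G j z * (x - z) ^ j / fact j)) \<le> B * norm (x - z) ^ Suc i / fact i"
      by (rule field_Taylor[where S = "{-1..1}"]) (use deriv ir B x z in auto)
    moreover have "(\<Sum>j\<le>i. G j z * (x - z) ^ j / fact j) = G i z * (x - z) ^ i / fact i"
    proof -
      have "(\<Sum>j\<le>i. G j z * (x - z) ^ j / fact j) = (\<Sum>j<i. G j z * (x - z) ^ j / fact j) + G i z * (x - z) ^ i / fact i"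
        by (simp add: lessThan_Suc_atMost[symmetric])
      moreover have "(\<Sum>j<i. G j z * (x - z) ^ j / fact j) = 0"
        using less.IH less.prems by (intro sum.neutral) (auto simp: G_def)
      ultimately show ?thesis by simp
    qed
    moreover have "B * \<bar>x - z\<bar> ^ Suc i / fact i \<le> B * \<bar>x - z\<bar> ^ Suc i / 1"
      using B0 by (intro divide_left_mono) auto
    moreover have "\<bar>G 0 x\<bar> \<le> \<bar>D\<bar> * 2 ^ e * \<bar>x - z\<bar> ^ Suc i"
    proof -
      have x2: "\<bar>x - z\<bar> \<le> 2" using x z by auto
      have "\<bar>G 0 x\<bar> \<le> D * \<bar>x - z\<bar> ^ e"
        using bound[OF x(1)] F x by (simp add: G_def Cr_derivs_def)
      also have "... \<le> \<bar>D\<bar> * \<bar>x - z\<bar> ^ e" by (intro mult_right_mono) auto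
      also have "\<bar>x - z\<bar> ^ e = \<bar>x - z\<bar> ^ (e - Suc i) * \<bar>x - z\<bar> ^ Suc i"
        using less.prems by (simp add: power_add[symmetric] del: power_Suc)
      also have "\<bar>x - z\<bar> ^ (e - Suc i) \<le> 2 ^ (e - Suc i)" using x2 by (intro power_mono) auto
      also have "(2::real) ^ (e - Suc i) \<le> 2 ^ e" by (intro power_increasing) auto
      finally show ?thesis by (simp add: mult_left_mono mult_right_mono mult.assoc)
    qed
    ultimately have "\<bar>G i z * (x - z) ^ i / fact i\<bar> \<le> M * \<bar>x - z\<bar> ^ Suc i"
      unfolding M_def distrib_right real_norm_def by linarith
    hence "(\<bar>G i z\<bar> / fact i) * \<bar>x - z\<bar> ^ i \<le> (M * \<bar>x - z\<bar>) * \<bar>x - z\<bar> ^ i"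
      by (simp add: abs_mult power_abs mult_ac)
    hence "\<bar>G i z\<bar> / fact i \<le> M * \<bar>x - z\<bar>" 
      by (rule mult_right_le_imp_le) (use x(2) in simp)
    thus ?thesis by (simp add: divide_le_eq mult_ac)
  qed
  have "\<bar>G i z\<bar> \<le> \<epsilon>" if \<epsilon>: "\<epsilon> > 0" for \<epsilon>
  proof -
    define c where "c = fact i * M + 1"
    have c: "c > 0" using M by (simp add: c_def add_nonneg_pos)
    define t where "t = min 1 (\<epsilon> / c)"
    have t: "t > 0" "t \<le> 1" "t \<le> \<epsilon> / c" using c \<epsilon> by (auto simp: t_def)
    \<comment> \<open>Approach z from the side of 0, so that x stays in [-1, 1] even if z is an
      endpoint.\<close>
    define x where "x = (if z \<le> 0 then z + t else z - t)"
    have x: "x \<in> {-1..1}" "x \<noteq> z" "\<bar>x - z\<bar> = t" using z t by (auto simp: x_def)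
    have "\<bar>G i z\<bar> \<le> fact i * M * t" using near[OF x(1,2)] x(3) by simp
    also have "... \<le> c * (\<epsilon> / c)" using t c M by (intro mult_mono) (auto simp: c_def)
    finally show ?thesis using c by simp
  qed
  hence "\<bar>G i z\<bar> \<le> 0" by (meson dense_ge not_le)
  thus ?case by (simp add: G_def)
qed

text \<open>Take the point of Z nearest to x. By separation all others are at least one scale away
  from x, so their factors are at least 1/2 and only the nearest point matters; its exponent is at
  most r.\<close>

lemma cdist_prod_separated:
  fixes n :: nat
  assumes n: "n \<ge> 1" and ne: "Z \<noteq> {}" and sep: "separated n S Z"
    and e: "\<forall>z\<in>Z. e z \<le> r" and x: "x \<in> {-1..1}"
  shows "\<exists>z\<in>Z. cdist n x z ^ r \<le> 2 ^ (r * S) * (\<Prod>z\<in>Z. cdist n x z ^ e z)"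
proof -
  note fin = separatedD(1)[OF sep] and Z = separatedD(2)[OF sep] and card = separatedD(3)[OF sep]
  obtain z0 where z0: "z0 \<in> Z" "\<And>z. z \<in> Z \<Longrightarrow> \<bar>x - z0\<bar> \<le> \<bar>x - z\<bar>"
    using ex_min_if_finite[of "(\<lambda>z. \<bar>x - z\<bar>) ` Z"] fin ne by (force simp: not_less)
  have nn: "0 \<le> cdist n x z" "cdist n x z \<le> 1" if "z \<in> Z" for z
    using cdist_bounds[OF n, of z] that Z by auto
  have half: "1 \<le> 2 * cdist n x z" if z: "z \<in> Z" "z \<noteq> z0" for z
  proof -
    have zI: "z \<in> {-1..1}" using z Z by auto
    have "4 / real n \<le> \<bar>z - z0\<bar>" by (rule separatedD(4)[OF sep z(1) z0(1) z(2)])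
    also have "... \<le> \<bar>x - z\<bar> + \<bar>x - z0\<bar>" by linarith
    also have "... \<le> 2 * \<bar>x - z\<bar>" using z0(2)[OF z(1)] by simp
    finally have "rho n z \<le> \<bar>x - z\<bar>" using rho_le[OF n, of z] by simp
    thus ?thesis using rho_pos[OF n zI] unfolding cdist_def by (simp add: field_simps)
  qed
  have card': "card (Z - {z0}) \<le> S" using card_mono[OF fin, of "Z - {z0}"] card by auto
  have "(\<Prod>z\<in>Z - {z0}. (1::real) ^ e z) \<le> 2 ^ (r * S) * (\<Prod>z\<in>Z - {z0}. cdist n x z ^ e z)"
    using fin card' e nn half by (intro power_prod_le) auto
  hence 1: "1 \<le> 2 ^ (r * S) * (\<Prod>z\<in>Z - {z0}. cdist n x z ^ e z)" by simp
  have "cdist n x z0 ^ r \<le> cdist n x z0 ^ e z0"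
    using nn[OF z0(1)] e z0(1) by (intro power_decreasing) auto
  also have "... = cdist n x z0 ^ e z0 * 1" by simp
  also have "... \<le> cdist n x z0 ^ e z0 * (2 ^ (r * S) * (\<Prod>z\<in>Z - {z0}. cdist n x z ^ e z))"
    using 1 nn[OF z0(1)] by (intro mult_left_mono) auto
  also have "... = 2 ^ (r * S) * (\<Prod>z\<in>Z. cdist n x z ^ e z)"
    using prod.remove[OF fin z0(1), of "\<lambda>z. cdist n x z ^ e z"] by (simp add: mult_ac)
  finally show ?thesis using z0(1) by blast
qed

text \<open>The sign (-1)^r compensates exponents r at both -1 and 1, where ((x + 1) (x - 1))^r
  occurs. The sign condition is empty at zeros of the product, hence the separate clause on equality
  there.\<close>

definition one_sided_approx ::
  "nat \<Rightarrow> nat \<Rightarrow> real \<Rightarrow> (real \<Rightarrow> real) \<Rightarrow> (nat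
    \<Rightarrow> real \<Rightarrow> real) \<Rightarrow> nat \<Rightarrow> real set \<Rightarrow> (real
      \<Rightarrow> nat) \<Rightarrow> real poly \<Rightarrow> bool" where
  "one_sided_approx k r C f F n Z e P \<longleftrightarrow> degree P \<le> n \<and>
    (\<forall>x\<in>{-1..1}. 0 \<le> (-1) ^ r * (\<Prod>z\<in>Z. (x - z) ^ e z) * (poly P x - f x)) \<and>
    (\<forall>x\<in>{-1..1}. (\<Prod>z\<in>Z. (x - z) ^ e z) = 0 \<longrightarrow> poly P x = f x) \<and>
    (\<forall>z\<in>Z. \<forall>i<e z. poly ((pderiv ^^ i) P) z = F i z) \<and>
    (\<forall>x\<in>{-1..1}. \<bar>f x - poly P x\<bar> \<le> C * jscale k r (F r) n x)"

lemma one_sided_approxD: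
  assumes "one_sided_approx k r C f F n Z e P"
  shows "degree P \<le> n"
    "x \<in> {-1..1} \<Longrightarrow> 0 \<le> (-1) ^ r * (\<Prod>z\<in>Z. (x - z) ^ e z) * (poly P x - f x)"
    "x \<in> {-1..1} \<Longrightarrow> (\<Prod>z\<in>Z. (x - z) ^ e z) = 0 \<Longrightarrow> poly P x = f x"
    "z \<in> Z \<Longrightarrow> i < e z \<Longrightarrow> poly ((pderiv ^^ i) P) z = F i z"
    "x \<in> {-1..1} \<Longrightarrow> \<bar>f x - poly P x\<bar> \<le> C * jscale k r (F r) n x"
  using assms unfolding one_sided_approx_def by blast+

text \<open>After multiplication by (-1)^r \<sigma> the correction contributes A \<sigma>^2 B, which
  dominates |\<sigma>| times the error of P0. The order of contact at z drops from r to e z, as the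
  correction is only that small.\<close>

lemma one_sided_hermite_approximation:
  fixes k r S :: nat
  assumes k: "k \<ge> 1" and r: "r \<ge> 1"
  shows "\<exists>C\<ge>1. \<exists>n0. \<forall>f F n Z e. Cr_derivs r f F \<and> n \<ge> n0 \<and> separated n S Z
    \<and> Z \<noteq> {} \<and>
    (\<forall>z\<in>Z. e z \<le> r) \<longrightarrow> (\<exists>P. one_sided_approx k r C f F n Z e P)"
proof -
  obtain C1 n1 where C1: "C1 \<ge> 1" and H: "\<And>f F n Z. \<lbrakk>Cr_derivs r f F; n \<ge> n1; separated n S Z\<rbrakk> \<Longrightarrow>
    \<exists>P. degree P \<le> n \<and> (\<forall>x\<in>{-1..1}. \<forall>z\<in>Z. \<bar>f x - poly P x\<bar>
      \<le> C1 * cdist n x z ^ r * jscale k r (F r) n x)"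
    using hermite_approximation[OF k r, of S] by metis
  obtain C2 n2 where C2: "C2 \<ge> 1" and R: "\<forall>g n Z e. continuous_on {-1..1} g \<and> n \<ge> n2 \<and> finite Z
    \<and> Z \<subseteq> {-1..1} \<and>
    card Z \<le> S \<and> (\<forall>z\<in>Z. e z \<le> r) \<longrightarrow>
    (\<exists>B. degree ((\<Prod>z\<in>Z. [:-z, 1:] ^ e z) * B) \<le> n \<and> (\<forall>x\<in>{-1..1}. 0 \<le> poly B x \<and>
       \<bar>\<Prod>z\<in>Z. (x - z) ^ e z\<bar> * poly B x \<le> C2 * ((\<Prod>z\<in>Z. cdist n x z ^ e z) * jscale k r g n x) \<and>
       (\<Prod>z\<in>Z. cdist n x z ^ e z) * jscale k r g n x \<le> C2 * (\<bar>\<Prod>z\<in>Z. (x - z) ^ e z\<bar> * poly B x)))"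
    using correction_polynomial[OF k, of S r] by (elim exE conjE)
  define C3 where "C3 = C1 * 2 ^ (r * S)"
  \<comment> \<open>Makes A |\<sigma>| B >= C3 \<Phi> w >= |f - P0| by the lower bound on B; the
    upper bound then adds A C2 to the final constant.\<close>
  define A where "A = C3 * C2"
  define C where "C = C3 + A * C2"
  have "1 * 1 \<le> C3" unfolding C3_def using C1 by (intro mult_mono) auto
  hence C3: "C3 \<ge> 1" by simp
  have A: "A \<ge> 0" using C3 C2 by (simp add: A_def)
  have "A * C2 \<ge> 0" using A C2 by simp
  hence "C \<ge> 1" using C3 by (simp add: C_def)
  show ?thesis
  proof (rule exI[of _ C], rule conjI[OF \<open>C \<ge> 1\<close>], rule exI[of _ "n1 + n2 + 2"], intro allI impI, elim conjE)
    fix f F and n :: nat and Z :: "real set" and e :: "real \<Rightarrow> nat"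
    assume F: "Cr_derivs r f F" and n: "n1 + n2 + 2 \<le> n"
      and sep: "separated n S Z" and ne: "Z \<noteq> {}"
      and e: "\<forall>z\<in>Z. e z \<le> r"
    note fin = separatedD(1)[OF sep] and Z = separatedD(2)[OF sep] and card = separatedD(3)[OF sep]
    have nn: "n \<ge> n1" "n \<ge> n2" "n \<ge> 1" "n \<ge> 2" using n by auto
    have cont: "continuous_on {-1..1} (F r)" using F by (simp add: Cr_derivs_def)
    define w where "w = jscale k r (F r) n"
    have w: "w x \<ge> 0" if "x \<in> {-1..1}" for x unfolding w_def by (intro jscale_nonneg cont k nn that)
    obtain P0 where P0: "degree P0 \<le> n" "\<And>x z. x \<in> {-1..1} \<Longrightarrow> z \<in> Z
      \<Longrightarrow> \<bar>f x - poly P0 x\<bar> \<le> C1 * cdist n x z ^ r * w x"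
      using H[OF F nn(1) sep] unfolding w_def by blast
    define \<Phi> where "\<Phi> x = (\<Prod>z\<in>Z. cdist n x z ^ e z)" for x
    define \<sigma> where "\<sigma> x = (\<Prod>z\<in>Z. (x - z) ^ e z)" for x
    obtain B where B: "degree ((\<Prod>z\<in>Z. [:-z, 1:] ^ e z) * B) \<le> n" "\<And>x. x \<in> {-1..1} \<Longrightarrow> 0 \<le> poly B x"
      "\<And>x. x \<in> {-1..1} \<Longrightarrow> \<bar>\<sigma> x\<bar> * poly B x \<le> C2 * (\<Phi> x * w x)"
      "\<And>x. x \<in> {-1..1} \<Longrightarrow> \<Phi> x * w x \<le> C2 * (\<bar>\<sigma> x\<bar> * poly B x)"
      using R[rule_format, of "F r" n Z e, OF conjI[OF cont conjI[OF nn(2) conjI[OF fin conjI[OF Z conjI[OF card]]]]]] e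
      unfolding w_def \<Phi>_def \<sigma>_def by blast
    define P where "P = P0 + smult ((-1) ^ r * A) ((\<Prod>z\<in>Z. [:-z, 1:] ^ e z) * B)"
    have pP: "poly P x - f x = (-1) ^ r * A * \<sigma> x * poly B x - (f x - poly P0 x)" for x
      by (simp add: P_def \<sigma>_def poly_prod)
    have \<Phi>: "0 \<le> \<Phi> x" "\<And>z. z \<in> Z \<Longrightarrow> \<Phi> x \<le> cdist n x z ^ e z" for x
    proof -
      have b: "0 \<le> cdist n x z ^ e z \<and> cdist n x z ^ e z \<le> 1" if "z \<in> Z" for z
        using cdist_bounds[OF nn(3) subsetD[OF Z that], of x] by (simp add: power_le_one)
      thus "0 \<le> \<Phi> x" unfolding \<Phi>_def by (intro prod_nonneg) auto
      fix z assume z: "z \<in> Z"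
      have "\<Phi> x = cdist n x z ^ e z * (\<Prod>z\<in>Z - {z}. cdist n x z ^ e z)"
        unfolding \<Phi>_def by (rule prod.remove[OF fin z])
      also have "... \<le> cdist n x z ^ e z * 1"
        using b z by (intro mult_left_mono prod_le_1) auto
      finally show "\<Phi> x \<le> cdist n x z ^ e z" by simp
    qed
    have \<Phi>1: "\<Phi> x \<le> 1" for x
    proof -
      obtain z where z: "z \<in> Z" using ne by blast
      have "cdist n x z ^ e z \<le> 1" 
        using cdist_bounds[OF nn(3) subsetD[OF Z z], of x] by (simp add: power_le_one)
      thus ?thesis using \<Phi>(2)[OF z, of x] by linarith
    qed
    have fP0: "\<bar>f x - poly P0 x\<bar> \<le> C3 * (\<Phi> x * w x)" if x: "x \<in> {-1..1}" for x
    proof -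
      obtain z where z: "z \<in> Z" "cdist n x z ^ r \<le> 2 ^ (r * S) * \<Phi> x"
        using cdist_prod_separated[OF nn(3) ne sep e x] unfolding \<Phi>_def by blast
      have "C1 * cdist n x z ^ r * w x \<le> C1 * (2 ^ (r * S) * \<Phi> x) * w x"
        using z C1 w[OF x] by (intro mult_right_mono mult_left_mono) auto
      thus ?thesis using P0(2)[OF x z(1)] by (simp add: C3_def mult_ac)
    qed
    have fP: "\<bar>f x - poly P x\<bar> \<le> C * (\<Phi> x * w x)" if x: "x \<in> {-1..1}" for x
    proof -
      have "\<bar>(-1) ^ r * A * \<sigma> x * poly B x\<bar> = A * (\<bar>\<sigma> x\<bar> * poly B x)"
        using A B(2)[OF x] by (simp add: abs_mult)
      also have "... \<le> A * (C2 * (\<Phi> x * w x))" using B(3)[OF x] A by (intro mult_left_mono)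
      finally have "\<bar>poly P x - f x\<bar> \<le> A * (C2 * (\<Phi> x * w x)) + C3 * (\<Phi> x * w x)"
        unfolding pP using fP0[OF x] by linarith
      thus ?thesis by (simp add: C_def algebra_simps abs_minus_commute)
    qed
    have key: "\<bar>f x - poly P0 x\<bar> \<le> A * (\<bar>\<sigma> x\<bar> * poly B x)" if x: "x \<in> {-1..1}" for x
    proof -
      have "C3 * (\<Phi> x * w x) \<le> C3 * (C2 * (\<bar>\<sigma> x\<bar> * poly B x))"
        using B(4)[OF x] C3 by (intro mult_left_mono) auto
      thus ?thesis using fP0[OF x] by (simp add: A_def mult_ac)
    qed
    show "\<exists>P. one_sided_approx k r C f F n Z e P"
      unfolding one_sided_approx_def
    proof (intro exI[of _ P] conjI ballI allI impI)
      show "degree P \<le> n"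
        unfolding P_def using P0(1) B(1) by (intro degree_add_le order_trans[OF degree_smult_le]) auto
      fix x :: real assume x: "x \<in> {-1..1}"
      define s where "s = (-1) ^ r * \<sigma> x"
      have s: "\<bar>s\<bar> = \<bar>\<sigma> x\<bar>" by (simp add: s_def abs_mult)
      have "s * (f x - poly P0 x) \<le> \<bar>s\<bar> * \<bar>f x - poly P0 x\<bar>" by (metis abs_ge_self abs_mult)
      also have "... \<le> \<bar>s\<bar> * (A * (\<bar>s\<bar> * poly B x))"
        using key[OF x] by (intro mult_left_mono) (auto simp: s)
      also have "... = s * (A * s * poly B x)" by (simp add: mult_ac)
      finally have "0 \<le> s * (A * s * poly B x - (f x - poly P0 x))" by (simp add: right_diff_distrib)
      moreover have "poly P x - f x = A * s * poly B x - (f x - poly P0 x)" unfolding pP by (simp add: s_def)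
      ultimately have "0 \<le> s * (poly P x - f x)" by (simp only:)
      thus "0 \<le> (-1) ^ r * (\<Prod>z\<in>Z. (x - z) ^ e z) * (poly P x - f x)" by (simp add: s_def \<sigma>_def)
      show "\<bar>f x - poly P x\<bar> \<le> C * jscale k r (F r) n x"
      proof -
        have "C * (\<Phi> x * w x) \<le> C * (1 * w x)"
          using \<Phi>1[of x] w[OF x] \<open>C \<ge> 1\<close> by (intro mult_left_mono mult_right_mono) auto
        thus ?thesis using fP[OF x] by (simp add: w_def)
      qed
      show "poly P x = f x" if "(\<Prod>z\<in>Z. (x - z) ^ e z) = 0"
      proof -
        have "\<sigma> x = 0" using that by (simp add: \<sigma>_def)
        hence "\<Phi> x * w x \<le> 0" using B(4)[OF x] by simp
        hence "C * (\<Phi> x * w x) \<le> C * 0" using \<open>C \<ge> 1\<close> by (intro mult_left_mono) auto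
        thus ?thesis using fP[OF x] by simp
      qed
    next
      fix z i assume z: "z \<in> Z" and i: "i < e z"
      have zI: "z \<in> {-1..1}" using z Z by auto
      \<comment> \<open>A crude bound for the modulus suffices here: only the order of vanishing at
        z matters, and n >= 2 gives rho <= 1.\<close>
      define M where "M = modsm k (F r) 1 {-1..1}"
      show "poly ((pderiv ^^ i) P) z = F i z"
      proof (rule hermite_from_bound[OF F zI])
        show "e z \<le> r" using e z by blast
        show "i < e z" by (rule i)
        fix x :: real assume x: "x \<in> {-1..1}"
        have rz: "rho n z > 0" by (intro rho_pos nn zI)
        have rx: "rho n x > 0" by (intro rho_pos nn x)
        have "2 / real n \<le> 2 / 2" using nn by (intro divide_left_mono) auto
        hence rx1: "rho n x \<le> 1" using rho_le[OF nn(3), of x] by simp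
        have m: "0 \<le> modsm k (F r) (rho n x) {-1..1}" "modsm k (F r) (rho n x) {-1..1} \<le> M"
          unfolding M_def by (intro modsm_nonneg modsm_mono cont k rx rx1)+
        have "w x \<le> 1 * M"
          unfolding w_def jscale_def using m rx rx1 by (intro mult_mono power_le_one) auto
        moreover have "cdist n x z \<le> \<bar>x - z\<bar> / rho n z"
          unfolding cdist_def using rz by (intro divide_left_mono) (auto intro: add_nonneg_pos)
        hence "cdist n x z ^ e z \<le> (\<bar>x - z\<bar> / rho n z) ^ e z"
          using cdist_bounds[OF nn(3) zI, of x] by (intro power_mono)
        hence "\<Phi> x \<le> (\<bar>x - z\<bar> / rho n z) ^ e z" using \<Phi>(2)[OF z, of x] by linarith
        ultimately have "\<Phi> x * w x \<le> (\<bar>x - z\<bar> / rho n z) ^ e z * (1 * M)"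
          using rz w[OF x] by (intro mult_mono) auto
        hence "C * (\<Phi> x * w x) \<le> C * ((\<bar>x - z\<bar> / rho n z) ^ e z * (1 * M))"
          using \<open>C \<ge> 1\<close> by (intro mult_left_mono) auto
        hence "\<bar>f x - poly P x\<bar> \<le> C * ((\<bar>x - z\<bar> / rho n z) ^ e z * (1 * M))"
          using fP[OF x] by linarith
        thus "\<bar>f x - poly P x\<bar> \<le> (C * M / rho n z ^ e z) * \<bar>x - z\<bar> ^ e z"
          by (simp add: power_divide mult_ac)
      qed
    qed
  qed
qed

theorem theorem2p1:
  fixes k p s r :: nat and m1 m2 m3 :: int
  assumes "k \<ge> 1" and "p \<ge> 1" and "s \<ge> 1"
    and "\<exists>j::nat. (j \<ge> 1 \<and> r = 2*j \<and> m1 = 2*int j - 1 \<and> m2 = 2*int j - 2 \<and> m3 = 2*int j - 1)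
               \<or> (r = 2*j + 1 \<and> m1 = 2*int j - 1 \<and> m2 = 2*int j \<and> m3 = 2*int j)"
  shows "\<exists>c::real. \<exists>N::real \<Rightarrow> nat.
    \<forall>(y::nat \<Rightarrow> real) (\<alpha>::nat \<Rightarrow> real) (f::real \<Rightarrow> real) (F::nat \<Rightarrow> real \<Rightarrow> real) (n::nat).
      (\<forall>i. 1 \<le> i \<and> i < s \<longrightarrow> y (Suc i) < y i) \<and> -1 < y s \<and> y 1 < 1 \<and>
      (\<forall>i. 1 \<le> i \<and> i < p \<longrightarrow> \<alpha> (Suc i) < \<alpha> i) \<and> -1 \<le> \<alpha> p \<and> \<alpha> 1 \<le> 1 \<and>
      y ` {1..s} \<inter> \<alpha> ` {1..p} = {} \<and>
      Cr_derivs r f F \<and>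
      n \<ge> N (dYA y s \<alpha> p)
      \<longrightarrow>
      (\<exists>P :: real poly. degree P \<le> n \<and>
         Delta0 y s (\<lambda>x. poly P x - f x) \<and>
         (\<forall>a\<in>\<alpha> ` {1..p}. \<forall>i::nat. int i \<le> m1 \<longrightarrow> poly ((pderiv ^^ i) P) a = F i a) \<and>
         (\<forall>b\<in>y ` {1..s}. \<forall>i::nat. int i \<le> m2 \<longrightarrow> poly ((pderiv ^^ i) P) b = F i b) \<and>
         (\<forall>i::nat. int i \<le> m3 \<longrightarrow>
             poly ((pderiv ^^ i) P) 1 = F i 1 \<and> poly ((pderiv ^^ i) P) (-1) = F i (-1)) \<and>
         (\<forall>x\<in>{-1..1}. \<bar>f x - poly P x\<bar> \<le>
             c * (rho n x) ^ r * modsm k (F r) (rho n x) {-1..1}))"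
proof -
  \<comment> \<open>Numbers of prescribed conditions. In both families e1 is even, e2 is odd and m3
    + 1 = r; m1 = -1 becomes e1 = 0.\<close>
  define e1 where "e1 = nat (m1 + 1)"
  define e2 where "e2 = nat (m2 + 1)"
  have r: "r \<ge> 1" and e1: "even e1" "e1 \<le> r" "int e1 = m1 + 1" and e2: "odd e2" "e2 \<le> r" "int e2 = m2 + 1"
    and e3: "int r = m3 + 1"
    using assms(4) by (auto simp: e1_def e2_def nat_add_distrib nat_mult_distrib nat_diff_distrib)
  obtain C n0 where approx: "\<forall>f F n Z e. Cr_derivs r f F \<and> n \<ge> n0 \<and> separated n (s + p + 2) Z
    \<and> Z \<noteq> {} \<and> (\<forall>z\<in>Z. e z \<le> r) \<longrightarrow>
    (\<exists>P. one_sided_approx k r C f F n Z e P)"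
    using one_sided_hermite_approximation[OF assms(1) r, of "s + p + 2"] by (elim exE conjE)
  show ?thesis
  \<comment> \<open>For n >= 4/d distinct points of Z are at least 4/n apart; n0 was fixed before
    the points and f.\<close>
  proof (rule exI[of _ C], rule exI[of _ "\<lambda>d. n0 + 1 + nat \<lceil>4 / d\<rceil>"], intro allI impI, elim conjE, goal_cases)
    case (1 y \<alpha> f F n)
    note ydec = 1(1) and ys = 1(2) and y1 = 1(3) and adec = 1(4) and ap = 1(5) and a1 = 1(6)
      and disj = 1(7) and F = 1(8) and n = 1(9)
    have mono: "\<beta> j \<le> \<beta> i" if "\<forall>i. 1 \<le> i \<and> i < t
      \<longrightarrow> \<beta> (Suc i) < \<beta> i" "1 \<le> i" "i \<le> j" "j \<le> t"
      for \<beta> :: "nat \<Rightarrow> real" and t i j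
      using that(3,4)
    proof (induction j rule: dec_induct)
      case (step j)
      thus ?case using that(1)[rule_format, of j] that(2) by simp
    qed simp
    define Y where "Y = y ` {1..s}"
    \<comment> \<open>An \<open>\<alpha> i\<close> equal to -1 or 1 is treated as an endpoint: its
      exponent r is at least e1, so its conditions still follow.\<close>
    define A where "A = \<alpha> ` {1..p} - {-1, 1}"
    define Z where "Z = {-1, 1} \<union> (Y \<union> A)"
    have Y: "Y \<subseteq> {-1<..<1}"
    proof
      fix b assume "b \<in> Y"
      then obtain i where i: "i \<in> {1..s}" "b = y i" by (auto simp: Y_def)
      thus "b \<in> {-1<..<1}" using mono[OF ydec, of 1 i] mono[OF ydec, of i s] ys y1 by auto
    qed
    have A': "\<alpha> ` {1..p} \<subseteq> {-1..1}"
    proof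
      fix b assume "b \<in> \<alpha> ` {1..p}"
      then obtain i where i: "i \<in> {1..p}" "b = \<alpha> i" by auto
      thus "b \<in> {-1..1}" using mono[OF adec, of 1 i] mono[OF adec, of i p] ap a1 by auto
    qed
    have fin: "finite Y" "finite A" "finite Z" by (auto simp: Y_def A_def Z_def)
    have "Y \<subseteq> {-1..1}" by (rule order_trans[OF Y]) auto
    moreover have "A \<subseteq> {-1..1}" unfolding A_def using A' by blast
    ultimately have Z: "Z \<subseteq> {-1..1}" by (simp add: Z_def)
    have injy: "inj_on y {1..s}"
    proof (rule linorder_inj_onI)
      fix i j assume ij: "i < j" "i \<in> {1..s}" "j \<in> {1..s}"
      hence "y j \<le> y (Suc i)" using mono[OF ydec, of "Suc i" j] by auto
      moreover have "y (Suc i) < y i" using ydec ij by auto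
      ultimately show "y i \<noteq> y j" by simp
    qed auto
    have card: "card Z \<le> s + p + 2"
    proof -
      have "card Z \<le> card {-1, 1 :: real} + (card Y + card A)"
        unfolding Z_def by (meson add_left_mono card_Un_le order_trans)
      moreover have "card Y \<le> s" unfolding Y_def using card_image_le[of "{1..s}" y] by simp
      moreover have "card A \<le> p"
        unfolding A_def using card_image_le[of "{1..p}" \<alpha>] card_Diff1_le card_mono[of "\<alpha> ` {1..p}" "\<alpha> ` {1..p} - {-1, 1}"] by fastforce
      ultimately show ?thesis by simp
    qed
    define d where "d = dYA y s \<alpha> p"
    define S where "S = y ` {1..s} \<union> \<alpha> ` {1..p} \<union> {-1, 1}"
    define D where "D = {\<bar>a - b\<bar> | a b. a \<in> S \<and> b \<in> S \<and> a \<noteq> b}"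
    have dD: "d = Min D" by (simp add: d_def dYA_def D_def S_def Let_def)
    have finD: "finite D"
    proof (rule finite_subset)
      show "D \<subseteq> (\<lambda>(a, b). \<bar>a - b\<bar>) ` (S \<times> S)" by (auto simp: D_def)
    qed (simp add: S_def)
    have "\<bar>1 - (-1)\<bar> \<in> D"
      unfolding D_def by (intro CollectI exI[of _ 1] exI[of _ "-1"]) (auto simp: S_def)
    hence dpos: "d > 0" using finD unfolding dD by (subst Min_gr_iff) (auto simp: D_def)
    have ZS: "Z \<subseteq> S" by (auto simp: Z_def S_def Y_def A_def)
    have n1: "n \<ge> 1" "n \<ge> n0" using n by auto
    have "4 / d \<le> real n" using n unfolding d_def by linarith
    hence dn: "4 / real n \<le> d" using dpos n1 by (simp add: field_simps)
    have sep: "separated n (s + p + 2) Z"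
      unfolding separated_def
    proof (intro conjI ballI impI fin(3) Z card)
      fix z z' assume "z \<in> Z" "z' \<in> Z" "z \<noteq> z'"
      hence "\<bar>z - z'\<bar> \<in> D" using ZS by (auto simp: D_def)
      hence "d \<le> \<bar>z - z'\<bar>" unfolding dD using finD by (rule Min_le[rotated])
      thus "4 / real n \<le> \<bar>z - z'\<bar>" using dn by simp
    qed
    define e where "e z = (if z = -1 \<or> z = 1 then r else if z \<in> Y then e2 else e1)" for z :: real
    have er: "\<forall>z\<in>Z. e z \<le> r" using e1 e2 by (auto simp: e_def)
    have "Z \<noteq> {}" by (simp add: Z_def)
    obtain P where "one_sided_approx k r C f F n Z e P"
      using approx[rule_format, of f F n Z e] F n1(2) \<open>Z \<noteq> {}\<close> sep er by blast
    note P = one_sided_approxD[OF this]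
    \<comment> \<open>Of the three groups the first is nonnegative on [-1, 1] and the second is so
      by even powers. The sign is carried by the \<open>y i\<close> alone.\<close>
    have split: "(-1) ^ r * (\<Prod>z\<in>Z. (x - z) ^ e z) = ((1 + x) * (1 - x)) ^ r * (\<Prod>z\<in>A. (x - z) ^ e1) * (\<Prod>i=1..s. (x - y i) ^ e2)" for x
    proof -
      have YA: "Y \<inter> A = {}" using disj by (auto simp: Y_def A_def)
      have "{-1, 1} \<inter> (Y \<union> A) = {}" using Y by (auto simp: A_def)
      hence "(\<Prod>z\<in>Z. (x - z) ^ e z) = (\<Prod>z\<in>{-1, 1}. (x - z) ^ e z) * ((\<Prod>z\<in>Y. (x - z) ^ e z) * (\<Prod>z\<in>A. (x - z) ^ e z))"
        unfolding Z_def using fin YA by (simp add: prod.union_disjoint)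
      also have "(\<Prod>z\<in>{-1, 1}. (x - z) ^ e z) = ((x + 1) * (x - 1)) ^ r"
        by (simp add: e_def power_mult_distrib)
      also have "(\<Prod>z\<in>A. (x - z) ^ e z) = (\<Prod>z\<in>A. (x - z) ^ e1)"
        using YA by (intro prod.cong) (auto simp: e_def A_def)
      also have "(\<Prod>z\<in>Y. (x - z) ^ e z) = (\<Prod>z\<in>Y. (x - z) ^ e2)"
        using Y by (intro prod.cong) (auto simp: e_def)
      also have "... = (\<Prod>i=1..s. (x - y i) ^ e2)"
        unfolding Y_def using injy by (simp add: prod.reindex)
      finally have "(-1) ^ r * (\<Prod>z\<in>Z. (x - z) ^ e z)
        = (-1) ^ r * ((x + 1) * (x - 1)) ^ r * (\<Prod>z\<in>A. (x - z) ^ e1) * (\<Prod>i=1..s. (x - y i) ^ e2)"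
        by (simp add: mult_ac)
      also have "(-1) ^ r * ((x + 1) * (x - 1)) ^ r = ((1 + x) * (1 - x)) ^ r"
        unfolding power_mult_distrib[symmetric] by (simp add: algebra_simps)
      finally show ?thesis .
    qed
    show ?case
    proof (intro exI[of _ P] conjI ballI allI impI)
      show "degree P \<le> n" by (rule P(1))
      show "Delta0 y s (\<lambda>x. poly P x - f x)"
        unfolding Delta0_def
      proof (intro allI impI ballI)
        fix i x assume i: "i \<le> s" and xi: "x \<in> {yext y s (Suc i)..yext y s i}"
        have up: "x \<le> y j" if "1 \<le> j" "j \<le> i" for j
        proof -
          have "x \<le> y i" using xi that i by (auto simp: yext_def)
          thus ?thesis using mono[OF ydec that i] by simp
        qed
        have lo: "y j \<le> x" if "i < j" "j \<le> s" for j
        proof -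
          have "y (Suc i) \<le> x" using xi that by (auto simp: yext_def)
          thus ?thesis using mono[OF ydec, of "Suc i" j] that by simp
        qed
        have xI: "x \<in> {-1..1}"
        proof (cases "i = 0")
          case True
          thus ?thesis using xi lo[of s] assms(3) ys by (auto simp: yext_def)
        next
          case False
          hence "x \<le> 1" using up[of 1] y1 by simp
          moreover have "-1 \<le> x"
            using xi lo[of s] ys i by (cases "i = s") (auto simp: yext_def)
          ultimately show ?thesis by simp
        qed
        define \<Sigma> where "\<Sigma> = (-1) ^ r * (\<Prod>z\<in>Z. (x - z) ^ e z)"
        \<comment> \<open>On the i-th interval exactly the factors with j <= i are nonpositive, so
          the i signs are distributed one to each of them.\<close>
        have "(-1) ^ i * (\<Prod>j=1..s. (x - y j) ^ e2) = (\<Prod>j=1..s. (if j \<le> i then -1 else 1) * (x - y j) ^ e2)"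
        proof -
          have "(\<Prod>j=1..s. (if j \<le> i then -1 else 1 :: real)) = (\<Prod>j\<in>{1..s} \<inter> {j. j \<le> i}. -1)"
            by (simp add: prod.If_cases)
          also have "{1..s} \<inter> {j. j \<le> i} = {1..i}" using i by auto
          finally show ?thesis unfolding prod.distrib by simp
        qed
        also have "... \<ge> 0"
        proof (intro prod_nonneg)
          fix j assume j: "j \<in> {1..s}"
          show "0 \<le> (if j \<le> i then -1 else 1) * (x - y j) ^ e2"
          proof (cases "j \<le> i")
            case True
            hence "(x - y j) ^ e2 \<le> 0" using up[of j] j e2(1) by (simp add: power_le_zero_eq odd_pos)
            thus ?thesis using True by simp
          next
            case False
            thus ?thesis using lo[of j] j by simp
          qed
        qed
        finally have 1: "0 \<le> (-1) ^ i * (\<Prod>j=1..s. (x - y j) ^ e2)" .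
        have 2: "0 \<le> ((1 + x) * (1 - x)) ^ r * (\<Prod>z\<in>A. (x - z) ^ e1)"
        proof (rule mult_nonneg_nonneg)
          show "0 \<le> ((1 + x) * (1 - x)) ^ r" using xI by simp
          show "0 \<le> (\<Prod>z\<in>A. (x - z) ^ e1)" by (intro prod_nonneg zero_le_even_power e1(1))
        qed
        have "(-1) ^ i * \<Sigma> = (((1 + x) * (1 - x)) ^ r * (\<Prod>z\<in>A. (x - z) ^ e1)) * ((-1) ^ i * (\<Prod>j=1..s. (x - y j) ^ e2))"
          unfolding \<Sigma>_def split by (simp add: mult_ac)
        also have "... \<ge> 0" by (rule mult_nonneg_nonneg[OF 2 1])
        finally have 3: "0 \<le> (-1) ^ i * \<Sigma>" .
        show "0 \<le> (-1) ^ i * (poly P x - f x)"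
        \<comment> \<open>If \<open>\<Sigma>\<close> vanishes, nothing can be cancelled, but then P
          and f agree at x. Otherwise divide by its positive multiple.\<close>
        proof (cases "\<Sigma> = 0")
          case True
          hence "(\<Prod>z\<in>Z. (x - z) ^ e z) = 0" by (simp add: \<Sigma>_def)
          thus ?thesis using P(3)[OF xI] by simp
        next
          case False
          have "0 \<le> \<Sigma> * (poly P x - f x)" using P(2)[OF xI] by (simp add: \<Sigma>_def)
          also have "... = ((-1) ^ i * \<Sigma>) * ((-1) ^ i * (poly P x - f x))" by simp
          finally have "((-1) ^ i * \<Sigma>) * 0 \<le> ((-1) ^ i * \<Sigma>) * ((-1) ^ i * (poly P x - f x))"
            by (simp only: mult_zero_right)
          moreover have "(-1) ^ i * \<Sigma> \<noteq> 0" using False by simp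
          hence "0 < (-1) ^ i * \<Sigma>" using 3 by linarith
          ultimately show ?thesis by (rule mult_left_le_imp_le)
        qed
      qed
      fix i :: nat
      show "poly ((pderiv ^^ i) P) a = F i a" if "a \<in> \<alpha> ` {1..p}" "int i \<le> m1" for a
      proof (rule P(4))
        show "a \<in> Z" using that by (auto simp: Z_def A_def)
        have "a \<notin> Y" using that disj by (auto simp: Y_def)
        thus "i < e a" using that e1 by (auto simp: e_def)
      qed
      show "poly ((pderiv ^^ i) P) b = F i b" if "b \<in> y ` {1..s}" "int i \<le> m2" for b
      proof (rule P(4))
        show "b \<in> Z" using that by (auto simp: Z_def Y_def)
        show "i < e b" using that e2 by (auto simp: e_def Y_def)
      qed
      show "poly ((pderiv ^^ i) P) 1 = F i 1" "poly ((pderiv ^^ i) P) (-1) = F i (-1)" if "int i \<le> m3"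
        using that e3 by (auto intro!: P(4) simp: Z_def e_def)
      show "\<bar>f x - poly P x\<bar> \<le> C * rho n x ^ r * modsm k (F r) (rho n x) {-1..1}" if "x \<in> {-1..1}" for x
        using P(5)[OF that] by (simp add: jscale_def mult.assoc)
    qed
  qed
qed

end
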